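(* Fix an integer $p\ge 2$ and, for $n\ge p$, let $Y_{n,p}$ be the size (number of nodes) of the spanning tree of $p$ randomly chosen nodes in a random binary search tree of size $n$. Then $Y_{n,p}$ is asymptotically Gaussian as $n\to\infty$, with convergence rate of order $\mathcal{O}(1/\sqrt{\log n})$: $$\mathbb{P}\left\{\frac{Y_{n,p}-2p\log n}{\sqrt{2p\log n}}<x\right\}=\Phi(x)+\mathcal{O}\left(\frac{1}{\sqrt{\log n}}\right),$$ uniformly with respect to $x\in\mathbb{R}$. Moreover, for every $\varepsilon>0$, the expectation $E_{n,p}=\mathbb{E}(Y_{n,p})$ and the variance $V_{n,p}=\mathbb{V}(Y_{n,p})$ satisfy, as $n\to\infty$, $$E_{n,p}=2p\log n-2pH_p+2p\gamma+3-2p-\frac{2p}{p-1}+\mathcal{O}\left(\frac{1}{n^{1-\varepsilon}}\right),$$ $$V_{n,p}=2p\log n-2pH_p+2p\gamma-\frac{2}{3}\pi^2p^2+4p^2H_p^{(2)}+\frac{2(2p^3-5p^2+7p-2)}{(p-1)^2}+\mathcal{O}\left(\frac{1}{n^{1-\varepsilon}}\right).$$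
   Context: A random binary search tree of size $n$ is the binary search tree obtained by successively inserting the entries of a uniformly random permutation of $\{1,\dots,n\}$ into an initially empty tree (random permutation model). Equivalently: the key at the root is uniformly distributed on $\{1,\dots,n\}$, and, given that the root is $k$, the left subtree (on the keys $1,\dots,k-1$) and the right subtree (on the keys $k+1,\dots,n$) are independent random binary search trees of sizes $k-1$ and $n-k$. Independently of the tree, a set of $p$ nodes is chosen uniformly at random among all $\binom{n}{p}$ sets of $p$ distinct nodes. The spanning tree of the chosen nodes is the smallest connected subgraph (subtree) of the binary search tree, viewed as an undirected tree, which contains all $p$ chosen nodes; its size is its number of nodes, and $Y_{n,p}$ denotes this number. Notation: $H_m=\sum_{k=1}^m\frac1k$, $H_m^{(2)}=\sum_{k=1}^m\frac1{k^2}$, $\gamma$ is the Euler–Mascheroni constant, $\log$ is the natural logarithm, and $\Phi(x)$ is the distribution function of the standard normal distribution $\mathcal{N}(0,1)$. The constants implied by the $\mathcal{O}$-terms may depend on $p$ (and on $\varepsilon$ where it occurs). *)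

theory Defs
  imports
    "HOL-Probability.Probability"
    "HOL-Library.Tree"
    "HOL-Library.Landau_Symbols"
    "Graph_Theory.Digraph_Component"
begin

fun bst_insert :: "'a::linorder \<Rightarrow> 'a tree \<Rightarrow> 'a tree" where
  "bst_insert x \<langle>\<rangle> = \<langle>\<langle>\<rangle>, x, \<langle>\<rangle>\<rangle>"
| "bst_insert x \<langle>l, a, r\<rangle> =
     (if x < a then \<langle>bst_insert x l, a, r\<rangle>
      else if a < x then \<langle>l, a, bst_insert x r\<rangle>
      else \<langle>l, a, r\<rangle>)"

definition random_bst :: "nat \<Rightarrow> nat tree pmf" where
  "random_bst n =
     map_pmf (\<lambda>xs. fold bst_insert xs \<langle>\<rangle>) (pmf_of_set (permutations_of_set {1..n}))"

text \<open>
  The keys of a binary search tree are distinct, so nodes are identified with their keys.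
  Arcs point from parent to child.  The predicate \<^const>\<open>Digraph_Component.connected\<close> refers to
  the underlying undirected graph, so the orientation plays no role below, and the subgraphs are
  exactly the subgraphs of the tree viewed as an undirected graph.
\<close>

definition tree_graph :: "'a tree \<Rightarrow> ('a, 'a \<times> 'a) pre_digraph" where
  "tree_graph t =
     \<lparr> verts = set_tree t,
       arcs = {(x, value c) | l x r c. \<langle>l, x, r\<rangle> \<in> subtrees t \<and> c \<in> {l, r} \<and> c \<noteq> \<langle>\<rangle>},
       tail = fst, head = snd \<rparr>"

definition spanning_tree_size :: "'a tree \<Rightarrow> 'a set \<Rightarrow> nat" where
  "spanning_tree_size t S =
     (LEAST m. \<exists>H. subgraph H (tree_graph t) \<and> Digraph_Component.connected H \<and>
                   S \<subseteq> verts H \<and> card (verts H) = m)"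

text \<open>
  The law of \<open>Y\<^bsub>n,p\<^esub>\<close>.  It is meaningful only for \<open>p \<le> n\<close>; for \<open>p > n\<close> there is no
  \<open>p\<close>-element set of nodes, and \<^const>\<open>pmf_of_set\<close> of the empty set is unspecified.
\<close>

definition Y_pmf :: "nat \<Rightarrow> nat \<Rightarrow> nat pmf" where
  "Y_pmf n p =
     map_pmf (\<lambda>(t, S). spanning_tree_size t S)
       (pair_pmf (random_bst n) (pmf_of_set {S. S \<subseteq> {1..n} \<and> card S = p}))"

definition harm2 :: "nat \<Rightarrow> real" where
  "harm2 m = (\<Sum>k = 1..m. 1 / real k ^ 2)"

end

theory Submission
  imports Defs "HOL-Real_Asymp.Real_Asymp"
begin

text \<open>
  The spanning tree of a set \<open>S\<close> of nodes consists of the nodes whose subtree meets \<open>S\<close>, without the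
  proper ancestors of the lowest common ancestor of \<open>S\<close> (\<open>spanning_tree_size_eq_span_size\<close>).  Both
  parts of this description are compatible with the decomposition at the root, where a random binary
  search tree splits into independent random binary search trees whose sizes are uniformly
  distributed.  Let \<open>v\<close> mark the size.  The sums over all \<open>p\<close>-subsets \<open>S\<close> of the probability
  generating functions of the number of nodes whose subtree meets \<open>S\<close>, and of the size of the
  spanning tree, are then polynomials \<open>hit_poly n p\<close> and \<open>span_poly n p\<close> in \<open>v\<close> which satisfy explicit
  recurrences (\<open>sum_hit_pgf\<close>, \<open>sum_span_pgf\<close>).

  For the limit law, the recurrence for \<open>p = 1\<close> shows that \<open>hit_poly n 1\<close> is a sum of products \<open>v U\<^sub>k\<close>
  with \<open>k < n\<close>, where \<open>U\<^sub>k\<close> is the generating function of a sum of independent Bernoulli variables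
  with parameters \<open>2 / (j + 1)\<close>, \<open>j \<le> k\<close>; it describes the depth at which the key number \<open>k + 1\<close> is
  inserted.  The recurrences for larger \<open>p\<close> only multiply and average.  Hence \<open>span_poly n p\<close> is a
  mixture of terms \<open>v\<^sup>r U\<^sub>k\<^sub>1 \<cdots> U\<^sub>k\<^sub>p\<close>.  Such a term is close to the normal law with mean and variance
  \<open>2 p ln n\<close>, with an error that is linear in its cost \<open>r + \<Sum> ln (n / (k\<^sub>i + 1))\<close>
  (\<open>bernoulli_berry_esseen\<close>, proved by Stein's method).  An error that is linear in the cost can be
  averaged over the mixture, so only the average cost matters.  It satisfies a recurrence of the
  form \<open>n c\<^sub>n \<le> 2 \<Sum>\<^sub>k\<^sub><\<^sub>n c\<^sub>k + O(n\<^bsup>p+1\<^esup>)\<close> and is therefore bounded relative to the number of \<open>p\<close>-subsets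
  (\<open>depth_mix_recurrence\<close>).

  For mean and variance, the derivatives at \<open>v = 1\<close> are collected in power series \<open>y\<close> whose variable
  marks the number of keys.  They satisfy equations \<open>y' = 2 y / (1 - X) + b\<close> with \<open>b\<close> known from
  smaller \<open>p\<close>.  To leading order \<open>y\<close> is \<open>(1 - X)\<^bsup>-p-1\<^esup>\<close> times a quadratic polynomial in
  \<open>log (1 / (1 - X))\<close>; this is verified by substitution.  The remainder satisfies an equation of the
  same form with smaller \<open>b\<close>, and comparison with the majorant \<open>(1 - X)\<^bsup>-p-\<epsilon>\<^esup>\<close> shows that it is
  smaller than the leading term by a factor \<open>O(n\<^bsup>\<epsilon>-1\<^esup>)\<close> (\<open>of_order_transfer\<close>).
  The coefficients of the leading terms are binomial coefficients times polynomials in harmonic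
  numbers, which produce the logarithm, the constant \<open>\<gamma>\<close>, and \<open>\<pi>\<^sup>2\<close> in the variance.
\<close>

section \<open>Spanning trees in binary trees\<close>

text \<open>
  The nodes whose subtree meets \<open>S\<close>; equivalently, the nodes on the paths from the root to the
  elements of \<open>S\<close>.
\<close>

primrec hit_nodes :: "'a tree \<Rightarrow> 'a set \<Rightarrow> 'a set" where
  "hit_nodes \<langle>\<rangle> S = {}"
| "hit_nodes \<langle>l, x, r\<rangle> S =
     (if S \<inter> set_tree \<langle>l, x, r\<rangle> = {} then {} else insert x (hit_nodes l S \<union> hit_nodes r S))"

text \<open>
  As long as one subtree contains all of \<open>S\<close>, the root is a proper ancestor of the lowest common
  ancestor and does not belong to the spanning tree.
\<close>

primrec span_nodes :: "'a tree \<Rightarrow> 'a set \<Rightarrow> 'a set" where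
  "span_nodes \<langle>\<rangle> S = {}"
| "span_nodes \<langle>l, x, r\<rangle> S =
     (if S \<subseteq> set_tree l then span_nodes l S
      else if S \<subseteq> set_tree r then span_nodes r S
      else insert x (hit_nodes l S \<union> hit_nodes r S))"

primrec tree_edges :: "'a tree \<Rightarrow> ('a \<times> 'a) set" where
  "tree_edges \<langle>\<rangle> = {}"
| "tree_edges \<langle>l, x, r\<rangle> =
     tree_edges l \<union> tree_edges r \<union> {(x, value c) | c. c \<in> {l, r} \<and> c \<noteq> \<langle>\<rangle>}"

lemma tree_edges_eq:
  "tree_edges t = {(x, value c) | l x r c. \<langle>l, x, r\<rangle> \<in> subtrees t \<and> c \<in> {l, r} \<and> c \<noteq> \<langle>\<rangle>}"
proof (induction t)
  case (Node l x r)
  have "subtrees \<langle>l, x, r\<rangle> = insert \<langle>l, x, r\<rangle> (subtrees l \<union> subtrees r)" by auto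
  then show ?case unfolding tree_edges.simps Node.IH by (simp only:) blast
qed auto

lemma value_in_set_tree: "t \<noteq> \<langle>\<rangle> \<Longrightarrow> value t \<in> set_tree t"
  by (cases t) auto

lemma tree_edges_in_set_tree: "(a, b) \<in> tree_edges t \<Longrightarrow> a \<in> set_tree t \<and> b \<in> set_tree t"
  by (induction t) (auto dest: value_in_set_tree)

lemma hit_nodes_subset: "hit_nodes t S \<subseteq> set_tree t"
  by (induction t) auto

lemma span_nodes_subset: "span_nodes t S \<subseteq> set_tree t"
proof (induction t)
  case (Node l x r)
  then show ?case using hit_nodes_subset[of l S] hit_nodes_subset[of r S] by auto
qed auto

lemma subset_hit_nodes: "S \<inter> set_tree t \<subseteq> hit_nodes t S"
  by (induction t) auto

lemma subset_span_nodes: "S \<subseteq> set_tree t \<Longrightarrow> S \<subseteq> span_nodes t S"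
proof (induction t)
  case (Node l x r)
  then show ?case using subset_hit_nodes[of S l] subset_hit_nodes[of S r] by auto
qed auto

text \<open>
  Every node in question is joined to the root of the tree by its ancestors, and these have
  subtrees that meet \<open>S\<close> as well.
\<close>

lemma hit_nodes_connected:
  "u \<in> hit_nodes t S \<Longrightarrow>
     (u, value t) \<in> ((tree_edges t \<union> (tree_edges t)\<inverse>) \<inter> hit_nodes t S \<times> hit_nodes t S)\<^sup>*"
proof (induction t)
  case (Node l x r)
  let ?t = "\<langle>l, x, r\<rangle>"
  let ?N = "hit_nodes ?t S"
  let ?R = "(tree_edges ?t \<union> (tree_edges ?t)\<inverse>) \<inter> ?N \<times> ?N"
  have ne: "S \<inter> set_tree ?t \<noteq> {}" using Node.prems by (auto split: if_splits)
  have x: "x \<in> ?N" using ne by simp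
  have sub: "(u, x) \<in> ?R\<^sup>*"
    if c: "c \<in> {l, r}" and u: "u \<in> hit_nodes c S"
      and IH: "(u, value c) \<in> ((tree_edges c \<union> (tree_edges c)\<inverse>) \<inter> hit_nodes c S \<times> hit_nodes c S)\<^sup>*"
    for c
  proof -
    have "(tree_edges c \<union> (tree_edges c)\<inverse>) \<inter> hit_nodes c S \<times> hit_nodes c S \<subseteq> ?R"
      using c ne by auto
    with IH have 1: "(u, value c) \<in> ?R\<^sup>*" using rtrancl_mono by blast
    have cne: "c \<noteq> \<langle>\<rangle>" using u by auto
    have "value c \<in> hit_nodes c S" using u cne by (cases c) (auto split: if_splits)
    then have "value c \<in> ?N" using c ne by auto
    moreover have "(x, value c) \<in> tree_edges ?t" using c cne by auto
    ultimately have "(value c, x) \<in> ?R" using x by auto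
    with 1 show ?thesis by (rule rtrancl_into_rtrancl)
  qed
  from Node.prems ne consider "u = x" | "u \<in> hit_nodes l S" | "u \<in> hit_nodes r S"
    unfolding hit_nodes.simps if_not_P[OF ne] by blast
  then show ?case
    using sub[of l] sub[of r] Node.IH by cases auto
qed auto

lemma span_nodes_connected:
  "\<exists>c. \<forall>u \<in> span_nodes t S.
     (u, c) \<in> ((tree_edges t \<union> (tree_edges t)\<inverse>) \<inter> span_nodes t S \<times> span_nodes t S)\<^sup>*"
proof (induction t)
  case (Node l x r)
  let ?t = "\<langle>l, x, r\<rangle>"
  show ?case
  proof (cases "S \<subseteq> set_tree l \<or> S \<subseteq> set_tree r")
    case True
    define c where "c = (if S \<subseteq> set_tree l then l else r)"
    have c: "c \<in> {l, r}" "span_nodes ?t S = span_nodes c S"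
      using True by (auto simp: c_def)
    have "(tree_edges c \<union> (tree_edges c)\<inverse>) \<inter> span_nodes c S \<times> span_nodes c S \<subseteq>
          (tree_edges ?t \<union> (tree_edges ?t)\<inverse>) \<inter> span_nodes ?t S \<times> span_nodes ?t S"
      unfolding c(2) using c(1) by auto
    from rtrancl_mono[OF this] show ?thesis using Node.IH c by blast
  next
    case False
    then have "S \<noteq> {}" by auto
    show ?thesis
    proof (cases "S \<inter> set_tree ?t = {}")
      case True
      have z: "hit_nodes c S = {}" if "S \<inter> set_tree c = {}" for c
        using that by (cases c) auto
      have "span_nodes ?t S = {x}" using False True z[of l] z[of r] by auto
      then show ?thesis by (intro exI[of _ x]) auto
    next
      case ne: False
      have "span_nodes ?t S = hit_nodes ?t S"
        using False unfolding span_nodes.simps hit_nodes.simps if_not_P[OF ne] by simp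
      then show ?thesis using hit_nodes_connected[of _ ?t S] by metis
    qed
  qed
qed auto

lemma rtrancl_leaves_set:
  assumes "(u, v) \<in> R\<^sup>*" "u \<in> A" "v \<notin> A"
  obtains a b where "(a, b) \<in> R" "a \<in> A" "b \<notin> A"
  using assms by (induction rule: rtrancl_induct) auto

text \<open>
  The situation inside a connected subgraph with vertex set \<open>V\<close>, whose edges in both directions
  form the relation \<open>R\<close>.
\<close>

locale attached_subtree =
  fixes R :: "('a::linorder \<times> 'a) set" and V :: "'a set"
  assumes R_sub: "R \<subseteq> V \<times> V" and sym: "(a, b) \<in> R \<Longrightarrow> (b, a) \<in> R"
    and conn: "u \<in> V \<Longrightarrow> v \<in> V \<Longrightarrow> (u, v) \<in> R\<^sup>*"
begin

text \<open>
  What remains true of a subtree \<open>t\<close> of the whole tree: its root is the only gate through which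
  edges of the subgraph can leave it.  Stating this as a property of \<open>t\<close> alone makes an induction over
  \<open>t\<close> possible.
\<close>

definition attached :: "'a tree \<Rightarrow> bool" where
  "attached t \<longleftrightarrow> (\<forall>a b. (a, b) \<in> R \<longrightarrow> a \<in> set_tree t \<longrightarrow>
     (if b \<in> set_tree t then (a, b) \<in> tree_edges t \<or> (b, a) \<in> tree_edges t else a = value t))"

lemma attached_edge:
  assumes "attached t" "(a, b) \<in> R" "a \<in> set_tree t"
  shows "if b \<in> set_tree t then (a, b) \<in> tree_edges t \<or> (b, a) \<in> tree_edges t else a = value t"
  using assms unfolding attached_def by blast

lemma attached_leave_child:
  assumes "attached \<langle>l, x, r\<rangle>" "x \<notin> set_tree l" "x \<notin> set_tree r" "set_tree l \<inter> set_tree r = {}"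
    and "c \<in> {l, r}" "(a, b) \<in> R" "a \<in> set_tree c" "b \<notin> set_tree c"
  shows "a = value c \<and> b = x"
proof -
  have a: "a \<in> set_tree \<langle>l, x, r\<rangle>" "a \<noteq> x" using assms by auto
  then have "(a, b) \<in> tree_edges \<langle>l, x, r\<rangle> \<or> (b, a) \<in> tree_edges \<langle>l, x, r\<rangle>"
    using attached_edge[OF assms(1,6) a(1)] by (auto split: if_splits)
  then show ?thesis
    using assms(2-5,7-) by (auto dest!: tree_edges_in_set_tree value_in_set_tree)
qed

lemma attached_child:
  assumes "attached \<langle>l, x, r\<rangle>" "x \<notin> set_tree l" "x \<notin> set_tree r" "set_tree l \<inter> set_tree r = {}"
    and "c \<in> {l, r}"
  shows "attached c"
proof -
  have inner: "(a, b) \<in> tree_edges c \<or> (b, a) \<in> tree_edges c"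
    if "(a, b) \<in> R" "a \<in> set_tree c" "b \<in> set_tree c" for a b
  proof -
    have c: "set_tree c \<subseteq> set_tree \<langle>l, x, r\<rangle>" "x \<notin> set_tree c" using assms by auto
    have down: "(u, w) \<in> tree_edges c"
      if "(u, w) \<in> tree_edges \<langle>l, x, r\<rangle>" "u \<in> set_tree c" for u w
      using that c(2) assms(2-5) tree_edges_in_set_tree[of u w l] tree_edges_in_set_tree[of u w r]
      by auto
    from that c have "(a, b) \<in> tree_edges \<langle>l, x, r\<rangle> \<or> (b, a) \<in> tree_edges \<langle>l, x, r\<rangle>"
      using attached_edge[OF assms(1), of a b] by (auto split: if_splits)
    then show ?thesis using down that by blast
  qed
  have leave: "a = value c" if "(a, b) \<in> R" "a \<in> set_tree c" "b \<notin> set_tree c" for a b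
    using attached_leave_child[OF assms that] by simp
  show ?thesis
    unfolding attached_def using inner leave by simp
qed

text \<open>
  If \<open>V\<close> is not confined to \<open>t\<close>, a path from an element of \<open>S\<close> in \<open>t\<close> to the outside must pass
  through the root of \<open>t\<close>.  The root in turn lies outside both subtrees, so that the argument
  repeats.
\<close>

lemma hit_nodes_attached:
  assumes "attached t" "bst t" "S \<subseteq> V" "\<not> V \<subseteq> set_tree t"
  shows "hit_nodes t S \<subseteq> V"
  using assms
proof (induction t)
  case (Node l x r)
  show ?case
  proof (cases "S \<inter> set_tree \<langle>l, x, r\<rangle> = {}")
    case False
    then obtain u v where u: "u \<in> V" "u \<in> set_tree \<langle>l, x, r\<rangle>"
      and v: "v \<in> V" "v \<notin> set_tree \<langle>l, x, r\<rangle>"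
      using Node.prems by blast
    obtain a b where "(a, b) \<in> R" "a \<in> set_tree \<langle>l, x, r\<rangle>" "b \<notin> set_tree \<langle>l, x, r\<rangle>"
      using rtrancl_leaves_set[OF conn[OF u(1) v(1)] u(2) v(2)] by blast
    then have x: "x \<in> V" using attached_edge[OF Node.prems(1), of a b] R_sub by auto
    have d: "x \<notin> set_tree l" "x \<notin> set_tree r" "set_tree l \<inter> set_tree r = {}"
      using Node.prems(2) by fastforce+
    have "hit_nodes l S \<subseteq> V" "hit_nodes r S \<subseteq> V"
      using Node.IH attached_child[OF Node.prems(1) d] Node.prems(2,3) d x by auto
    then show ?thesis using x by simp
  qed auto
qed auto

text \<open>
  At the lowest common ancestor either the root belongs to \<open>S\<close>, or elements of \<open>S\<close> on both sides
  force a path through the root.  From there on the subtrees are left by \<open>V\<close>, and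
  \<open>hit_nodes_attached\<close> applies.
\<close>

lemma span_nodes_attached:
  assumes "attached t" "bst t" "S \<subseteq> V" "S \<subseteq> set_tree t" "S \<noteq> {}"
  shows "span_nodes t S \<subseteq> V"
  using assms
proof (induction t)
  case (Node l x r)
  have d: "x \<notin> set_tree l" "x \<notin> set_tree r" "set_tree l \<inter> set_tree r = {}"
    using Node.prems(2) by fastforce+
  note att = attached_child[OF Node.prems(1) d]
  show ?case
  proof (cases "S \<subseteq> set_tree l \<or> S \<subseteq> set_tree r")
    case True
    then show ?thesis using Node att by auto
  next
    case False
    have x: "x \<in> V"
    proof (cases "x \<in> S")
      case False
      with \<open>\<not> (S \<subseteq> set_tree l \<or> S \<subseteq> set_tree r)\<close> Node.prems
      obtain u v where u: "u \<in> V" "u \<in> set_tree l" and v: "v \<in> V" "v \<notin> set_tree l" by auto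
      obtain a b where ab: "(a, b) \<in> R" "a \<in> set_tree l" "b \<notin> set_tree l"
        using rtrancl_leaves_set[OF conn[OF u(1) v(1)] u(2) v(2)] by blast
      with attached_leave_child[OF Node.prems(1) d, of l] have "b = x" by auto
      then show ?thesis using ab R_sub by auto
    qed (use Node.prems in auto)
    have "hit_nodes l S \<subseteq> V" "hit_nodes r S \<subseteq> V"
      using hit_nodes_attached[of l S] hit_nodes_attached[of r S] att[of l] att[of r]
        Node.prems(2,3) d x by auto
    then show ?thesis using x False by simp
  qed
qed auto

end

lemma span_nodes_is_spanning:
  assumes "bst t" "S \<subseteq> set_tree t" "S \<noteq> {}"
  shows "\<exists>H. subgraph H (tree_graph t) \<and> Digraph_Component.connected H \<and>
             S \<subseteq> verts H \<and> verts H = span_nodes t S"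
proof -
  define N where "N = span_nodes t S"
  define H where "H = \<lparr> verts = N, arcs = tree_edges t \<inter> N \<times> N, tail = fst, head = snd \<rparr>"
  have G: "tree_graph t = \<lparr> verts = set_tree t, arcs = tree_edges t, tail = fst, head = snd \<rparr>"
    unfolding tree_graph_def tree_edges_eq ..
  have N: "N \<subseteq> set_tree t" "S \<subseteq> N"
    unfolding N_def using span_nodes_subset[of t S] subset_span_nodes[of S t] assms by simp_all
  have "wf_digraph (tree_graph t)"
    unfolding G by unfold_locales (auto dest: tree_edges_in_set_tree)
  moreover have wfH: "wf_digraph H" unfolding H_def by unfold_locales auto
  ultimately have "subgraph H (tree_graph t)"
    unfolding subgraph_def using N by (auto simp: G H_def compatible_def)
  moreover have "Digraph_Component.connected H"
  proof -
    define R where "R = (tree_edges t \<union> (tree_edges t)\<inverse>) \<inter> N \<times> N"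
    have R: "(arcs_ends H)\<^sup>s = R"
      unfolding R_def H_def arcs_ends_def arc_to_ends_def
      by (auto simp: symcl_def)
    obtain c where c: "\<And>u. u \<in> N \<Longrightarrow> (u, c) \<in> R\<^sup>*"
      using span_nodes_connected[of t S] unfolding N_def R_def by blast
    have "sym R" unfolding R_def by (auto simp: sym_def)
    then have "(u, v) \<in> R\<^sup>*" if "u \<in> N" "v \<in> N" for u v
      using c[OF that(1)] c[OF that(2)] by (meson rtrancl_trans sym_rtrancl symD)
    then have "(u, v) \<in> rtrancl_on N R" if "u \<in> N" "v \<in> N" for u v
      using that by (intro rtrancl_consistent_rtrancl_on) (auto simp: R_def)
    moreover have "N \<noteq> {}" using N assms by auto
    ultimately show ?thesis
      unfolding Digraph_Component.connected_conv R by (simp add: H_def)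
  qed
  ultimately show ?thesis using N by (intro exI[of _ H]) (simp add: H_def N_def)
qed

lemma span_nodes_minimal:
  assumes "bst t" "S \<subseteq> set_tree t" "S \<noteq> {}"
    and H: "subgraph H (tree_graph t)" "Digraph_Component.connected H" "S \<subseteq> verts H"
  shows "span_nodes t S \<subseteq> verts H"
proof -
  have G: "tree_graph t = \<lparr> verts = set_tree t, arcs = tree_edges t, tail = fst, head = snd \<rparr>"
    unfolding tree_graph_def tree_edges_eq ..
  have wfH: "wf_digraph H" and VH: "verts H \<subseteq> set_tree t" and AH: "arcs H \<subseteq> tree_edges t"
    and th: "tail H = fst" "head H = snd"
    using H(1) unfolding subgraph_def G compatible_def by auto
  define R where "R = (arcs_ends H)\<^sup>s"
  have R: "R = arcs H \<union> (arcs H)\<inverse>"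
    unfolding R_def arcs_ends_def arc_to_ends_def th by (auto simp: symcl_def)
  interpret attached_subtree R "verts H"
  proof
    show "R \<subseteq> verts H \<times> verts H"
      unfolding R using wf_digraph.tail_in_verts[OF wfH] wf_digraph.head_in_verts[OF wfH] th
      by fastforce
    show "(b, a) \<in> R" if "(a, b) \<in> R" for a b using that unfolding R by auto
    show "(u, v) \<in> R\<^sup>*" if "u \<in> verts H" "v \<in> verts H" for u v
      using H(2) that rtrancl_on_rtranclI
      unfolding Digraph_Component.connected_conv R_def by metis
  qed
  have "R \<subseteq> set_tree t \<times> set_tree t" using R_sub VH by auto
  then have "attached t"
    unfolding attached_def using AH by (auto simp: R)
  then show ?thesis using assms by (intro span_nodes_attached) auto
qed

lemma spanning_tree_size_eq_card:
  fixes t :: "'a::linorder tree"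
  assumes "bst t" "S \<subseteq> set_tree t" "S \<noteq> {}"
  shows "spanning_tree_size t S = card (span_nodes t S)"
  unfolding spanning_tree_size_def
proof (rule Least_equality)
  show "\<exists>H. subgraph H (tree_graph t) \<and> Digraph_Component.connected H \<and>
          S \<subseteq> verts H \<and> card (verts H) = card (span_nodes t S)"
    using span_nodes_is_spanning[OF assms] by metis
next
  fix m
  assume "\<exists>H. subgraph H (tree_graph t) \<and> Digraph_Component.connected H \<and>
            S \<subseteq> verts H \<and> card (verts H) = m"
  then obtain H where H: "subgraph H (tree_graph t)" "Digraph_Component.connected H"
    "S \<subseteq> verts H" "card (verts H) = m" by blast
  have "verts H \<subseteq> set_tree t" using H(1) by (simp add: subgraph_def tree_graph_def)
  then have "finite (verts H)" using finite_set_tree finite_subset by blast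
  then show "card (span_nodes t S) \<le> m"
    using span_nodes_minimal[OF assms H(1-3)] H(4) card_mono by blast
qed

text \<open>
  Numerical counterparts of \<open>hit_nodes\<close> and \<open>span_nodes\<close>.  All later arguments use these
  recursions instead of the graph.
\<close>

primrec hit_size :: "'a tree \<Rightarrow> 'a set \<Rightarrow> nat" where
  "hit_size \<langle>\<rangle> S = 0"
| "hit_size \<langle>l, x, r\<rangle> S =
     (if S \<inter> set_tree \<langle>l, x, r\<rangle> = {} then 0 else Suc (hit_size l S + hit_size r S))"

primrec span_size :: "'a tree \<Rightarrow> 'a set \<Rightarrow> nat" where
  "span_size \<langle>\<rangle> S = 0"
| "span_size \<langle>l, x, r\<rangle> S =
     (if S \<subseteq> set_tree l then span_size l S
      else if S \<subseteq> set_tree r then span_size r S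
      else Suc (hit_size l S + hit_size r S))"

lemma card_insert_hit_nodes:
  assumes "bst \<langle>l, x, r\<rangle>" "card (hit_nodes l S) = hit_size l S" "card (hit_nodes r S) = hit_size r S"
  shows "card (insert x (hit_nodes l S \<union> hit_nodes r S)) = Suc (hit_size l S + hit_size r S)"
proof -
  have fin: "finite (hit_nodes c S)" for c :: "'a tree"
    using finite_subset[OF hit_nodes_subset] finite_set_tree by blast
  have "hit_nodes l S \<inter> hit_nodes r S = {}" "x \<notin> hit_nodes l S \<union> hit_nodes r S"
    using assms(1) hit_nodes_subset[of l S] hit_nodes_subset[of r S] by fastforce+
  then show ?thesis using assms fin by (simp add: card_Un_disjoint)
qed

lemma card_hit_nodes: "bst t \<Longrightarrow> card (hit_nodes t S) = hit_size t S"
proof (induction t)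
  case (Node l x r)
  then show ?case using card_insert_hit_nodes[of l x r S] by simp
qed auto

lemma card_span_nodes: "bst t \<Longrightarrow> card (span_nodes t S) = span_size t S"
proof (induction t)
  case (Node l x r)
  then show ?case
    using card_insert_hit_nodes[of l x r S] by (simp add: card_hit_nodes)
qed auto

lemma spanning_tree_size_eq_span_size:
  fixes t :: "'a::linorder tree"
  assumes "bst t" "S \<subseteq> set_tree t" "S \<noteq> {}"
  shows "spanning_tree_size t S = span_size t S"
  using spanning_tree_size_eq_card[OF assms] card_span_nodes[OF assms(1)] by simp

section \<open>The recursive structure of random binary search trees\<close>

text \<open>
  The general key set is needed because the keys of the right subtree do not form an initial
  segment.
\<close>

definition random_bst_on :: "nat set \<Rightarrow> nat tree pmf" where
  "random_bst_on A = map_pmf (\<lambda>xs. fold bst_insert xs \<langle>\<rangle>) (pmf_of_set (permutations_of_set A))"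

lemma fold_bst_insert_Node:
  "fold bst_insert xs \<langle>l, x, r\<rangle> =
     \<langle>fold bst_insert (filter (\<lambda>y. y < x) xs) l, x, fold bst_insert (filter (\<lambda>y. x < y) xs) r\<rangle>"
  by (induction xs arbitrary: l r) auto

lemma bst_insert_bst_set:
  "bst t \<Longrightarrow> bst (bst_insert x t) \<and> set_tree (bst_insert x t) = insert x (set_tree t)"
  by (induction t) auto

lemma fold_bst_insert_props:
  "bst t \<Longrightarrow> bst (fold bst_insert xs t) \<and> set_tree (fold bst_insert xs t) = set xs \<union> set_tree t"
proof (induction xs arbitrary: t)
  case (Cons x xs)
  then show ?case using bst_insert_bst_set[of t x] Cons.IH[of "bst_insert x t"] by auto
qed auto

lemma set_random_bst_on:
  assumes "finite A" "t \<in> set_pmf (random_bst_on A)"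
  shows "bst t" "set_tree t = A"
proof -
  have "permutations_of_set A \<noteq> {}" "finite (permutations_of_set A)"
    using assms by auto
  with assms obtain xs where "xs \<in> permutations_of_set A" "t = fold bst_insert xs \<langle>\<rangle>"
    by (auto simp: random_bst_on_def)
  then show "bst t" "set_tree t = A"
    using fold_bst_insert_props[of "\<langle>\<rangle>" xs] by (auto dest: permutations_of_setD)
qed

lemma finite_set_random_bst_on [simp]: "finite A \<Longrightarrow> finite (set_pmf (random_bst_on A))"
  by (simp add: random_bst_on_def)

text \<open>
  The first key of a uniformly random permutation is the root; splitting the other keys into the
  smaller and the larger ones yields two independent uniformly random permutations.
\<close>

lemma random_bst_on_rec:
  assumes "finite A" "A \<noteq> {}"
  shows "random_bst_on A = pmf_of_set A \<bind> (\<lambda>x. map_pmf (\<lambda>(l, r). \<langle>l, x, r\<rangle>)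
           (pair_pmf (random_bst_on {y \<in> A. y < x}) (random_bst_on {y \<in> A. x < y})))"
proof -
  have "random_bst_on A = pmf_of_set A \<bind> (\<lambda>x. map_pmf (\<lambda>xs. fold bst_insert (x # xs) \<langle>\<rangle>)
          (pmf_of_set (permutations_of_set (A - {x}))))"
    unfolding random_bst_on_def random_permutation_of_set[OF assms]
    by (simp add: map_bind_pmf bind_return_pmf map_pmf_def bind_assoc_pmf)
  also have "\<dots> = pmf_of_set A \<bind> (\<lambda>x. map_pmf (\<lambda>(l, r). \<langle>l, x, r\<rangle>)
           (pair_pmf (random_bst_on {y \<in> A. y < x}) (random_bst_on {y \<in> A. x < y})))"
  proof (rule bind_pmf_cong[OF refl])
    fix x assume "x \<in> set_pmf (pmf_of_set A)"
    then have x: "x \<in> A" using assms by simp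
    have fin: "finite (A - {x})" using assms by simp
    have sets: "{y \<in> A - {x}. y < x} = {y \<in> A. y < x}" "{y \<in> A - {x}. \<not> y < x} = {y \<in> A. x < y}"
      by auto
    have "map_pmf (\<lambda>xs. fold bst_insert (x # xs) \<langle>\<rangle>) (pmf_of_set (permutations_of_set (A - {x}))) =
          map_pmf (\<lambda>xs. (\<lambda>(as, bs). \<langle>fold bst_insert as \<langle>\<rangle>, x, fold bst_insert bs \<langle>\<rangle>\<rangle>)
             (partition (\<lambda>y. y < x) xs)) (pmf_of_set (permutations_of_set (A - {x})))"
    proof (rule map_pmf_cong[OF refl])
      fix xs assume "xs \<in> set_pmf (pmf_of_set (permutations_of_set (A - {x})))"
      then have "xs \<in> permutations_of_set (A - {x})" using fin by simp
      then have "x \<notin> set xs" by (auto dest: permutations_of_setD)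
      then have "filter (\<lambda>y. \<not> y < x) xs = filter (\<lambda>y. x < y) xs"
        by (intro filter_cong) (auto simp: not_less order.order_iff_strict)
      then show "fold bst_insert (x # xs) \<langle>\<rangle> =
          (\<lambda>(as, bs). \<langle>fold bst_insert as \<langle>\<rangle>, x, fold bst_insert bs \<langle>\<rangle>\<rangle>) (partition (\<lambda>y. y < x) xs)"
        by (simp add: fold_bst_insert_Node o_def)
    qed
    also have "\<dots> = map_pmf (\<lambda>(as, bs). \<langle>fold bst_insert as \<langle>\<rangle>, x, fold bst_insert bs \<langle>\<rangle>\<rangle>)
        (map_pmf (partition (\<lambda>y. y < x)) (pmf_of_set (permutations_of_set (A - {x}))))"
      by (simp add: pmf.map_comp o_def)
    also have "\<dots> = map_pmf (\<lambda>(as, bs). \<langle>fold bst_insert as \<langle>\<rangle>, x, fold bst_insert bs \<langle>\<rangle>\<rangle>)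
        (pair_pmf (pmf_of_set (permutations_of_set {y \<in> A. y < x}))
                  (pmf_of_set (permutations_of_set {y \<in> A. x < y})))"
      unfolding partition_random_permutations[OF fin] sets ..
    also have "\<dots> = map_pmf (\<lambda>(l, r). \<langle>l, x, r\<rangle>)
           (pair_pmf (random_bst_on {y \<in> A. y < x}) (random_bst_on {y \<in> A. x < y}))"
      unfolding random_bst_on_def map_pair[symmetric] pmf.map_comp
      by (simp add: o_def case_prod_unfold)
    finally show "map_pmf (\<lambda>xs. fold bst_insert (x # xs) \<langle>\<rangle>) (pmf_of_set (permutations_of_set (A - {x}))) =
        map_pmf (\<lambda>(l, r). \<langle>l, x, r\<rangle>)
           (pair_pmf (random_bst_on {y \<in> A. y < x}) (random_bst_on {y \<in> A. x < y}))" .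
  qed
  finally show ?thesis .
qed

lemma expectation_pair_pmf_mult:
  fixes f :: "'a \<Rightarrow> real" and g :: "'b \<Rightarrow> real"
  assumes "finite (set_pmf M)" "finite (set_pmf N)"
  shows "measure_pmf.expectation (pair_pmf M N) (\<lambda>z. f (fst z) * g (snd z)) =
           measure_pmf.expectation M f * measure_pmf.expectation N g"
proof -
  have "measure_pmf.expectation (pair_pmf M N) (\<lambda>z. f (fst z) * g (snd z)) =
      (\<Sum>z\<in>set_pmf M \<times> set_pmf N. pmf M (fst z) * f (fst z) * (pmf N (snd z) * g (snd z)))"
    using assms by (subst integral_measure_pmf[of "set_pmf M \<times> set_pmf N"])
      (auto simp: pmf_pair mult_ac case_prod_beta intro!: sum.cong simp flip: set_pmf_iff)
  also have "\<dots> = (\<Sum>a\<in>set_pmf M. pmf M a * f a) * (\<Sum>b\<in>set_pmf N. pmf N b * g b)"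
    by (simp add: sum.cartesian_product case_prod_beta sum_product)
  also have "\<dots> = measure_pmf.expectation M f * measure_pmf.expectation N g"
    using assms by (subst (1 2) integral_measure_pmf) (auto simp: set_pmf_iff)
  finally show ?thesis .
qed

lemma expectation_random_bst_on_rec:
  fixes h :: "nat tree \<Rightarrow> real"
  assumes "finite A" "A \<noteq> {}"
  shows "measure_pmf.expectation (random_bst_on A) h =
    (\<Sum>x\<in>A. measure_pmf.expectation (pair_pmf (random_bst_on {y \<in> A. y < x})
       (random_bst_on {y \<in> A. x < y})) (\<lambda>z. h \<langle>fst z, x, snd z\<rangle>)) / real (card A)"
  unfolding random_bst_on_rec[OF assms] using assms
  by (subst pmf_expectation_bind_pmf_of_set) (simp_all add: case_prod_unfold divide_inverse sum_distrib_left mult.commute)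

definition subsets_card :: "'a set \<Rightarrow> nat \<Rightarrow> 'a set set" where
  "subsets_card A p = {S. S \<subseteq> A \<and> card S = p}"

lemma finite_subsets_card [simp]: "finite A \<Longrightarrow> finite (subsets_card A p)"
  by (simp add: subsets_card_def)

lemma card_subsets_card: "finite A \<Longrightarrow> card (subsets_card A p) = card A choose p"
  unfolding subsets_card_def by (rule n_subsets)

lemma subsets_card_0: "finite A \<Longrightarrow> subsets_card A 0 = {{}}"
  by (auto simp: subsets_card_def dest: finite_subset)

text \<open>
  The element \<open>x\<close> plays the role of the root: \<open>h\<close> only sees the part of \<open>S\<close> in the two subtrees,
  so the root may or may not be chosen.
\<close>

lemma sum_subsets_card_insert:
  fixes h :: "'a set \<Rightarrow> 'b::comm_monoid_add"
  assumes "finite A" "x \<notin> A" "p > 0"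
  shows "(\<Sum>S\<in>subsets_card (insert x A) p. h (S \<inter> A)) =
         (\<Sum>S\<in>subsets_card A p. h S) + (\<Sum>S\<in>subsets_card A (p - 1). h S)"
proof -
  have eq: "subsets_card (insert x A) p = subsets_card A p \<union> insert x ` subsets_card A (p - 1)"
  proof (intro equalityI subsetI)
    fix S assume S: "S \<in> subsets_card (insert x A) p"
    show "S \<in> subsets_card A p \<union> insert x ` subsets_card A (p - 1)"
    proof (cases "x \<in> S")
      case True
      have "finite S" using S assms finite_subset[of S "insert x A"] by (auto simp: subsets_card_def)
      then have "S - {x} \<in> subsets_card A (p - 1)" using S True by (auto simp: subsets_card_def)
      moreover have "S = insert x (S - {x})" using True by auto
      ultimately show ?thesis by blast
    qed (use S in \<open>auto simp: subsets_card_def\<close>)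
  next
    fix S assume "S \<in> subsets_card A p \<union> insert x ` subsets_card A (p - 1)"
    then show "S \<in> subsets_card (insert x A) p"
    proof
      assume "S \<in> insert x ` subsets_card A (p - 1)"
      then obtain T where T: "T \<subseteq> A" "card T = p - 1" "S = insert x T" by (auto simp: subsets_card_def)
      then have "finite T" "x \<notin> T" using assms finite_subset by auto
      then show ?thesis using T assms by (auto simp: subsets_card_def)
    qed (auto simp: subsets_card_def)
  qed
  have "(\<Sum>S\<in>subsets_card (insert x A) p. h (S \<inter> A)) =
      (\<Sum>S\<in>subsets_card A p. h (S \<inter> A)) + (\<Sum>S\<in>insert x ` subsets_card A (p - 1). h (S \<inter> A))"
    unfolding eq using assms by (intro sum.union_disjoint) (auto simp: subsets_card_def)
  also have "(\<Sum>S\<in>subsets_card A p. h (S \<inter> A)) = (\<Sum>S\<in>subsets_card A p. h S)"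
    by (intro sum.cong) (auto simp: subsets_card_def Int_absorb2)
  also have "(\<Sum>S\<in>insert x ` subsets_card A (p - 1). h (S \<inter> A)) =
             (\<Sum>S\<in>subsets_card A (p - 1). h (insert x S \<inter> A))"
    using assms by (subst sum.reindex) (auto simp: inj_on_def subsets_card_def insert_ident)
  also have "\<dots> = (\<Sum>S\<in>subsets_card A (p - 1). h S)"
    using assms by (intro sum.cong) (auto simp: subsets_card_def Int_absorb2)
  finally show ?thesis .
qed

lemma sum_subsets_card_Un:
  fixes f g :: "'a set \<Rightarrow> 'b::comm_semiring_0"
  assumes "finite A" "finite B" "A \<inter> B = {}"
  shows "(\<Sum>S\<in>subsets_card (A \<union> B) p. f (S \<inter> A) * g (S \<inter> B)) =
         (\<Sum>i\<le>p. (\<Sum>S\<in>subsets_card A i. f S) * (\<Sum>S\<in>subsets_card B (p - i). g S))"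
proof -
  have "(\<Sum>i\<le>p. (\<Sum>S\<in>subsets_card A i. f S) * (\<Sum>S\<in>subsets_card B (p - i). g S)) =
        (\<Sum>i\<le>p. \<Sum>z\<in>subsets_card A i \<times> subsets_card B (p - i). f (fst z) * g (snd z))"
    by (simp add: sum_product sum.cartesian_product case_prod_beta)
  also have "\<dots> = (\<Sum>w\<in>(SIGMA i:{..p}. subsets_card A i \<times> subsets_card B (p - i)).
                     f (fst (snd w)) * g (snd (snd w)))"
    using assms by (subst sum.Sigma) (auto simp: case_prod_beta)
  also have "\<dots> = (\<Sum>S\<in>subsets_card (A \<union> B) p. f (S \<inter> A) * g (S \<inter> B))"
  proof (rule sum.reindex_bij_witness[of _ "\<lambda>S. (card (S \<inter> A), S \<inter> A, S \<inter> B)"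
        "\<lambda>w. fst (snd w) \<union> snd (snd w)"], goal_cases)
    case (1 w)
    then have "fst (snd w) \<subseteq> A" "snd (snd w) \<subseteq> B" "fst w = card (fst (snd w))"
      by (auto simp: subsets_card_def)
    then have "(fst (snd w) \<union> snd (snd w)) \<inter> A = fst (snd w)"
      "(fst (snd w) \<union> snd (snd w)) \<inter> B = snd (snd w)" using assms by auto
    then show ?case using \<open>fst w = card (fst (snd w))\<close> by (simp add: prod_eq_iff)
  next
    case (2 w)
    then have "fst (snd w) \<subseteq> A" "snd (snd w) \<subseteq> B" "card (fst (snd w)) + card (snd (snd w)) = p"
      by (auto simp: subsets_card_def)
    moreover from this have "card (fst (snd w) \<union> snd (snd w)) = card (fst (snd w)) + card (snd (snd w))"
      using assms by (intro card_Un_disjoint) (auto intro: finite_subset)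
    ultimately show ?case by (auto simp: subsets_card_def)
  next
    case (3 S)
    then show ?case by (auto simp: subsets_card_def)
  next
    case (4 S)
    then have S: "S \<subseteq> A \<union> B" "card S = p" by (auto simp: subsets_card_def)
    have "card S = card (S \<inter> A \<union> S \<inter> B)" using S by (intro arg_cong[of _ _ card]) auto
    also have "\<dots> = card (S \<inter> A) + card (S \<inter> B)"
      using assms by (intro card_Un_disjoint) auto
    finally show ?case using S by (auto simp: subsets_card_def)
  next
    case (5 w)
    then have "fst (snd w) \<subseteq> A" "snd (snd w) \<subseteq> B" by (auto simp: subsets_card_def)
    then have "(fst (snd w) \<union> snd (snd w)) \<inter> A = fst (snd w)"
      "(fst (snd w) \<union> snd (snd w)) \<inter> B = snd (snd w)" using assms by auto
    then show ?case by simp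
  qed
  finally show ?thesis ..
qed

text \<open>
  The size of the left subtree determines everything else, and it is uniformly distributed over
  \<open>{..<card A}\<close>.
\<close>

lemma sum_over_ranks:
  fixes A :: "'a::linorder set" and G :: "nat \<Rightarrow> 'b::comm_monoid_add"
  assumes "finite A"
  shows "(\<Sum>x\<in>A. G (card {y \<in> A. y < x})) = (\<Sum>k<card A. G k)"
  using assms
proof (induction A rule: finite_linorder_max_induct)
  case (insert b A)
  then have b: "b \<notin> A" by auto
  have "{y \<in> insert b A. y < b} = A" using insert by auto
  moreover have "{y \<in> insert b A. y < x} = {y \<in> A. y < x}" if "x \<in> A" for x
    using insert that by auto
  ultimately show ?case using insert b by (simp add: add.commute)
qed auto

lemma card_above_rank:
  fixes A :: "'a::linorder set"
  assumes "finite A" "x \<in> A"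
  shows "card {y \<in> A. x < y} = card A - 1 - card {y \<in> A. y < x}"
proof -
  have "card (A - {x}) = card ({y \<in> A. y < x} \<union> {y \<in> A. x < y})"
    by (intro arg_cong[of _ _ card]) auto
  also have "\<dots> = card {y \<in> A. y < x} + card {y \<in> A. x < y}"
    using assms by (intro card_Un_disjoint) auto
  finally show ?thesis using assms by simp
qed

section \<open>Generating polynomials of the sizes\<close>

text \<open>
  The factor \<open>pCons 0\<close> is the multiplication by \<open>v\<close> for the root.  The two inner sums belong to an
  unchosen and a chosen root.
\<close>

fun hit_poly :: "nat \<Rightarrow> nat \<Rightarrow> real poly" where
  "hit_poly 0 p = (if p = 0 then 1 else 0)"
| "hit_poly (Suc n) p = (if p = 0 then 1 else
     smult (1 / real (Suc n)) (pCons 0 (\<Sum>k\<le>n.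
       (\<Sum>i\<le>p. hit_poly k i * hit_poly (n - k) (p - i)) +
       (\<Sum>i<p. hit_poly k i * hit_poly (n - k) (p - 1 - i)))))"

text \<open>
  Relative to \<open>hit_poly\<close>, the root is dropped when all chosen nodes lie on one side of it; this has
  the same effect for the left and the right side.
\<close>

fun span_poly :: "nat \<Rightarrow> nat \<Rightarrow> real poly" where
  "span_poly 0 p = 0"
| "span_poly (Suc n) p = hit_poly (Suc n) p +
     smult (2 / real (Suc n)) (\<Sum>k\<le>n. span_poly k p - pCons 0 (hit_poly k p))"

declare hit_poly.simps(2) [simp del] span_poly.simps(2) [simp del]

lemma hit_poly_0 [simp]: "hit_poly n 0 = 1"
  by (cases n) (simp_all add: hit_poly.simps)

text \<open>
  Restricting \<open>S\<close> to the keys of a subtree is what allows subsets of the whole key set to be split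
  into independent choices.
\<close>

lemma hit_size_Int: "set_tree t \<subseteq> B \<Longrightarrow> hit_size t (S \<inter> B) = hit_size t S"
proof (induction t)
  case (Node l x r)
  moreover from Node.prems have "S \<inter> B \<inter> set_tree \<langle>l, x, r\<rangle> = S \<inter> set_tree \<langle>l, x, r\<rangle>" by auto
  ultimately show ?case by simp
qed auto

lemma hit_size_empty: "hit_size t {} = 0"
  by (cases t) auto

definition hit_pgf :: "nat set \<Rightarrow> real \<Rightarrow> nat set \<Rightarrow> real" where
  "hit_pgf A v S = measure_pmf.expectation (random_bst_on A) (\<lambda>t. v ^ hit_size t S)"

definition span_pgf :: "nat set \<Rightarrow> real \<Rightarrow> nat set \<Rightarrow> real" where
  "span_pgf A v S = measure_pmf.expectation (random_bst_on A) (\<lambda>t. v ^ span_size t S)"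

lemma hit_pgf_empty: "hit_pgf A v {} = 1"
  by (simp add: hit_pgf_def hit_size_empty)

lemma hit_pgf_Int: "finite A \<Longrightarrow> hit_pgf A v (S \<inter> A) = hit_pgf A v S"
  unfolding hit_pgf_def
  by (intro integral_cong_AE) (auto simp: AE_measure_pmf_iff set_random_bst_on hit_size_Int)

lemma expectation_set_pmf_cong:
  fixes f g :: "'a \<Rightarrow> real"
  assumes "\<And>t. t \<in> set_pmf M \<Longrightarrow> f t = g t"
  shows "measure_pmf.expectation M f = measure_pmf.expectation M g"
  using assms by (intro integral_cong_AE) (auto simp: AE_measure_pmf_iff)

text \<open>
  The case in which the root belongs to the counted nodes, so that the sizes of both subtrees add
  up.
\<close>

lemma expectation_joined:
  assumes A: "finite A" "S \<subseteq> A" and x: "x \<in> A"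
  shows "measure_pmf.expectation (pair_pmf (random_bst_on {y \<in> A. y < x}) (random_bst_on {y \<in> A. x < y}))
           (\<lambda>z. v ^ Suc (hit_size (fst z) S + hit_size (snd z) S)) =
         v * (hit_pgf {y \<in> A. y < x} v S * hit_pgf {y \<in> A. x < y} v S)"
proof -
  have "measure_pmf.expectation (pair_pmf (random_bst_on {y \<in> A. y < x}) (random_bst_on {y \<in> A. x < y}))
           (\<lambda>z. v ^ Suc (hit_size (fst z) S + hit_size (snd z) S)) =
        v * measure_pmf.expectation (pair_pmf (random_bst_on {y \<in> A. y < x}) (random_bst_on {y \<in> A. x < y}))
           (\<lambda>z. v ^ hit_size (fst z) S * v ^ hit_size (snd z) S)"
    by (simp add: power_add)
  then show ?thesis
    using assms expectation_pair_pmf_mult[of "random_bst_on {y \<in> A. y < x}" "random_bst_on {y \<in> A. x < y}"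
        "\<lambda>t. v ^ hit_size t S" "\<lambda>t. v ^ hit_size t S"]
    by (simp add: hit_pgf_def)
qed

lemma set_tree_halves:
  assumes "finite A" "z \<in> set_pmf (pair_pmf (random_bst_on {y \<in> A. y < x}) (random_bst_on {y \<in> A. x < y}))"
  shows "set_tree (fst z) = {y \<in> A. y < x}" "set_tree (snd z) = {y \<in> A. x < y}"
  using assms set_random_bst_on(2)[of "{y \<in> A. y < x}" "fst z"]
    set_random_bst_on(2)[of "{y \<in> A. x < y}" "snd z"] by (auto simp: mem_Times_iff)

lemma hit_pgf_rec:
  assumes A: "finite A" "S \<subseteq> A" "S \<noteq> {}"
  shows "hit_pgf A v S =
    (\<Sum>x\<in>A. v * (hit_pgf {y \<in> A. y < x} v S * hit_pgf {y \<in> A. x < y} v S)) / real (card A)"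
proof -
  have ne: "A \<noteq> {}" using A by auto
  have "measure_pmf.expectation (pair_pmf (random_bst_on {y \<in> A. y < x}) (random_bst_on {y \<in> A. x < y}))
           (\<lambda>z. v ^ hit_size \<langle>fst z, x, snd z\<rangle> S) =
        v * (hit_pgf {y \<in> A. y < x} v S * hit_pgf {y \<in> A. x < y} v S)" if x: "x \<in> A" for x
  proof -
    have "measure_pmf.expectation (pair_pmf (random_bst_on {y \<in> A. y < x}) (random_bst_on {y \<in> A. x < y}))
           (\<lambda>z. v ^ hit_size \<langle>fst z, x, snd z\<rangle> S) =
        measure_pmf.expectation (pair_pmf (random_bst_on {y \<in> A. y < x}) (random_bst_on {y \<in> A. x < y}))
           (\<lambda>z. v ^ Suc (hit_size (fst z) S + hit_size (snd z) S))"
    proof (rule expectation_set_pmf_cong)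
      fix z assume "z \<in> set_pmf (pair_pmf (random_bst_on {y \<in> A. y < x}) (random_bst_on {y \<in> A. x < y}))"
      then have z: "set_tree (fst z) = {y \<in> A. y < x}" "set_tree (snd z) = {y \<in> A. x < y}"
        using set_tree_halves[OF A(1)] by blast+
      have "{y \<in> A. y < x} \<union> {x} \<union> {y \<in> A. x < y} = A" using x by auto
      then have "set_tree \<langle>fst z, x, snd z\<rangle> = A" using z by simp
      then have "S \<inter> set_tree \<langle>fst z, x, snd z\<rangle> \<noteq> {}" using A by auto
      then show "v ^ hit_size \<langle>fst z, x, snd z\<rangle> S = v ^ Suc (hit_size (fst z) S + hit_size (snd z) S)"
        unfolding hit_size.simps by (simp only: if_not_P if_False)
    qed
    then show ?thesis using expectation_joined[OF A(1,2) x] by simp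
  qed
  then show ?thesis
    unfolding hit_pgf_def[of A] expectation_random_bst_on_rec[OF A(1) ne] by simp
qed

lemma sum_hit_pgf_root:
  assumes A: "finite A" and x: "x \<in> A" and p: "p > 0"
    and hp: "\<And>B i. finite B \<Longrightarrow> card B < card A \<Longrightarrow> (\<Sum>S\<in>subsets_card B i. hit_pgf B v S) = h (card B) i"
  defines "k \<equiv> card {y \<in> A. y < x}" and "m \<equiv> card A - 1 - card {y \<in> A. y < x}"
  shows "(\<Sum>S\<in>subsets_card A p. hit_pgf {y \<in> A. y < x} v S * hit_pgf {y \<in> A. x < y} v S) =
         (\<Sum>i\<le>p. h k i * h m (p - i)) + (\<Sum>i<p. h k i * h m (p - 1 - i))"
proof -
  let ?L = "{y \<in> A. y < x}" and ?R = "{y \<in> A. x < y}"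
  have split: "A = insert x (?L \<union> ?R)" using x by auto
  have fin: "finite ?L" "finite ?R" using A by auto
  have cL: "card ?L < card A" "card ?R < card A"
    using A x by (auto intro!: psubset_card_mono)
  have m: "card ?R = m" unfolding m_def by (rule card_above_rank[OF A x])
  have conv: "(\<Sum>S\<in>subsets_card (?L \<union> ?R) q. hit_pgf ?L v S * hit_pgf ?R v S) =
      (\<Sum>i\<le>q. h k i * h m (q - i))" for q
  proof -
    have "(\<Sum>S\<in>subsets_card (?L \<union> ?R) q. hit_pgf ?L v S * hit_pgf ?R v S) =
          (\<Sum>S\<in>subsets_card (?L \<union> ?R) q. hit_pgf ?L v (S \<inter> ?L) * hit_pgf ?R v (S \<inter> ?R))"
      using fin by (simp add: hit_pgf_Int)
    also have "\<dots> = (\<Sum>i\<le>q. (\<Sum>S\<in>subsets_card ?L i. hit_pgf ?L v S) *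
                               (\<Sum>S\<in>subsets_card ?R (q - i). hit_pgf ?R v S))"
      by (rule sum_subsets_card_Un) (use fin in auto)
    finally show ?thesis using hp fin cL m unfolding k_def by simp
  qed
  have "(\<Sum>S\<in>subsets_card A p. hit_pgf ?L v S * hit_pgf ?R v S) =
        (\<Sum>S\<in>subsets_card (insert x (?L \<union> ?R)) p.
            hit_pgf ?L v (S \<inter> (?L \<union> ?R)) * hit_pgf ?R v (S \<inter> (?L \<union> ?R)))"
  proof (subst split[symmetric], intro sum.cong refl)
    fix S
    have "S \<inter> (?L \<union> ?R) \<inter> ?L = S \<inter> ?L" "S \<inter> (?L \<union> ?R) \<inter> ?R = S \<inter> ?R" by auto
    then show "hit_pgf ?L v S * hit_pgf ?R v S =
        hit_pgf ?L v (S \<inter> (?L \<union> ?R)) * hit_pgf ?R v (S \<inter> (?L \<union> ?R))"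
      using hit_pgf_Int[OF fin(1), of v S] hit_pgf_Int[OF fin(1), of v "S \<inter> (?L \<union> ?R)"]
        hit_pgf_Int[OF fin(2), of v S] hit_pgf_Int[OF fin(2), of v "S \<inter> (?L \<union> ?R)"] by simp
  qed
  also have "\<dots> = (\<Sum>S\<in>subsets_card (?L \<union> ?R) p. hit_pgf ?L v S * hit_pgf ?R v S) +
                  (\<Sum>S\<in>subsets_card (?L \<union> ?R) (p - 1). hit_pgf ?L v S * hit_pgf ?R v S)"
    by (rule sum_subsets_card_insert) (use fin p in auto)
  also have "\<dots> = (\<Sum>i\<le>p. h k i * h m (p - i)) + (\<Sum>i\<le>p - 1. h k i * h m (p - 1 - i))"
    unfolding conv ..
  also have "{..p - 1} = {..<p}" using p by auto
  finally show ?thesis .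
qed

lemma sum_hit_pgf:
  "finite A \<Longrightarrow> (\<Sum>S\<in>subsets_card A p. hit_pgf A v S) = poly (hit_poly (card A) p) v"
proof (induction "card A" arbitrary: A p rule: less_induct)
  case less
  show ?case
  proof (cases "p = 0 \<or> A = {}")
    case True
    then show ?thesis
    proof
      assume "p = 0"
      then show ?thesis using less by (simp add: subsets_card_0 hit_pgf_empty)
    next
      assume "A = {}"
      moreover have "subsets_card {} p = (if p = 0 then {{}} else {} :: nat set set)"
        by (auto simp: subsets_card_def)
      ultimately show ?thesis by (simp add: hit_pgf_empty)
    qed
  next
    case False
    then obtain n where n: "card A = Suc n" using less.prems by (cases "card A") auto
    let ?L = "\<lambda>x. {y \<in> A. y < x}" and ?R = "\<lambda>x. {y \<in> A. x < y}"
    define F where "F = (\<lambda>k. (\<Sum>i\<le>p. poly (hit_poly k i) v * poly (hit_poly (n - k) (p - i)) v) +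
                      (\<Sum>i<p. poly (hit_poly k i) v * poly (hit_poly (n - k) (p - 1 - i)) v))"
    have "(\<Sum>S\<in>subsets_card A p. hit_pgf A v S) =
          (\<Sum>S\<in>subsets_card A p. (\<Sum>x\<in>A. v * (hit_pgf (?L x) v S * hit_pgf (?R x) v S)) / real (Suc n))"
    proof (intro sum.cong refl)
      fix S assume "S \<in> subsets_card A p"
      then have "S \<subseteq> A" "S \<noteq> {}" using False by (auto simp: subsets_card_def)
      from hit_pgf_rec[OF less.prems this, of v] n
      show "hit_pgf A v S = (\<Sum>x\<in>A. v * (hit_pgf (?L x) v S * hit_pgf (?R x) v S)) / real (Suc n)" by simp
    qed
    also have "\<dots> = v / real (Suc n) *
        (\<Sum>x\<in>A. \<Sum>S\<in>subsets_card A p. hit_pgf (?L x) v S * hit_pgf (?R x) v S)"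
      by (subst sum.swap) (simp add: sum_distrib_left sum_divide_distrib)
    also have "(\<Sum>x\<in>A. \<Sum>S\<in>subsets_card A p. hit_pgf (?L x) v S * hit_pgf (?R x) v S) =
        (\<Sum>x\<in>A. F (card (?L x)))"
    proof (intro sum.cong refl)
      fix x assume x: "x \<in> A"
      show "(\<Sum>S\<in>subsets_card A p. hit_pgf (?L x) v S * hit_pgf (?R x) v S) = F (card (?L x))"
        using sum_hit_pgf_root[OF less.prems x, of p v "\<lambda>k i. poly (hit_poly k i) v"] less.hyps False n
        by (simp add: F_def)
    qed
    also have "\<dots> = (\<Sum>k\<le>n. F k)"
      using sum_over_ranks[OF less.prems, of F] n by (simp add: lessThan_Suc_atMost)
    also have "v / real (Suc n) * \<dots> = poly (hit_poly (card A) p) v"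
      using False by (simp add: n F_def hit_poly.simps poly_sum)
    finally show ?thesis .
  qed
qed

text \<open>
  Written as a correction of the recursion for \<open>hit_pgf\<close>: if all of \<open>S\<close> lies on one side, then the
  other side contributes the factor 1.
\<close>

lemma span_pgf_rec:
  assumes A: "finite A" "S \<subseteq> A" "S \<noteq> {}"
  shows "span_pgf A v S =
    (\<Sum>x\<in>A. v * (hit_pgf {y \<in> A. y < x} v S * hit_pgf {y \<in> A. x < y} v S) +
       (if S \<subseteq> {y \<in> A. y < x} then span_pgf {y \<in> A. y < x} v S - v * hit_pgf {y \<in> A. y < x} v S else 0) +
       (if S \<subseteq> {y \<in> A. x < y} then span_pgf {y \<in> A. x < y} v S - v * hit_pgf {y \<in> A. x < y} v S else 0))
     / real (card A)"
proof -
  have ne: "A \<noteq> {}" using A by auto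
  have "measure_pmf.expectation (pair_pmf (random_bst_on {y \<in> A. y < x}) (random_bst_on {y \<in> A. x < y}))
           (\<lambda>z. v ^ span_size \<langle>fst z, x, snd z\<rangle> S) =
        v * (hit_pgf {y \<in> A. y < x} v S * hit_pgf {y \<in> A. x < y} v S) +
       (if S \<subseteq> {y \<in> A. y < x} then span_pgf {y \<in> A. y < x} v S - v * hit_pgf {y \<in> A. y < x} v S else 0) +
       (if S \<subseteq> {y \<in> A. x < y} then span_pgf {y \<in> A. x < y} v S - v * hit_pgf {y \<in> A. x < y} v S else 0)"
    (is "?E = ?rhs") if x: "x \<in> A" for x
  proof -
    let ?L = "{y \<in> A. y < x}" and ?R = "{y \<in> A. x < y}"
    let ?M = "pair_pmf (random_bst_on ?L) (random_bst_on ?R)"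
    have "?E = measure_pmf.expectation ?M (\<lambda>z.
        if S \<subseteq> ?L then v ^ span_size (fst z) S
        else if S \<subseteq> ?R then v ^ span_size (snd z) S
        else v ^ Suc (hit_size (fst z) S + hit_size (snd z) S))"
    proof (rule expectation_set_pmf_cong)
      fix z assume "z \<in> set_pmf ?M"
      then have "set_tree (fst z) = ?L" "set_tree (snd z) = ?R"
        using set_tree_halves[OF A(1)] by blast+
      then show "v ^ span_size \<langle>fst z, x, snd z\<rangle> S = (if S \<subseteq> ?L then v ^ span_size (fst z) S
        else if S \<subseteq> ?R then v ^ span_size (snd z) S
        else v ^ Suc (hit_size (fst z) S + hit_size (snd z) S))" by simp
    qed
    also have "\<dots> = (if S \<subseteq> ?L then span_pgf ?L v S else if S \<subseteq> ?R then span_pgf ?R v S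
        else v * (hit_pgf ?L v S * hit_pgf ?R v S))"
      using expectation_joined[OF A(1,2) x]
        expectation_pair_pmf_fst[where f = "\<lambda>t. v ^ span_size t S" and p = "random_bst_on ?L" and q = "random_bst_on ?R"]
        expectation_pair_pmf_snd[where f = "\<lambda>t. v ^ span_size t S" and p = "random_bst_on ?L" and q = "random_bst_on ?R"]
      by (simp add: span_pgf_def)
    also have "\<dots> = ?rhs"
    proof -
      have one: "hit_pgf B v S = 1" if "finite B" "S \<inter> B = {}" for B
        using hit_pgf_Int[OF that(1), of v S] that(2) by (simp add: hit_pgf_empty)
      have "S \<inter> ?R = {}" if "S \<subseteq> ?L" using that by auto
      moreover have "S \<inter> ?L = {}" if "S \<subseteq> ?R" using that by auto
      moreover have "\<not> S \<subseteq> ?R" if "S \<subseteq> ?L" using that A by fastforce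
      ultimately show ?thesis using one[of ?L] one[of ?R] A by simp
    qed
    finally show ?thesis .
  qed
  then show ?thesis
    unfolding span_pgf_def[of A] expectation_random_bst_on_rec[OF A(1) ne] by simp
qed

lemma sum_subsets_card_subset:
  assumes "finite A" "B \<subseteq> A"
  shows "(\<Sum>S\<in>subsets_card A p. if S \<subseteq> B then f S else 0) = (\<Sum>S\<in>subsets_card B p. f S)"
proof -
  have "subsets_card A p \<inter> {S. S \<subseteq> B} = subsets_card B p"
    using assms by (auto simp: subsets_card_def)
  then show ?thesis using assms by (simp add: sum.If_cases)
qed

lemma sum_span_pgf:
  "finite A \<Longrightarrow> p > 0 \<Longrightarrow> (\<Sum>S\<in>subsets_card A p. span_pgf A v S) = poly (span_poly (card A) p) v"
proof (induction "card A" arbitrary: A rule: less_induct)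
  case less
  show ?case
  proof (cases "A = {}")
    case True
    moreover have "subsets_card {} p = ({} :: nat set set)"
      using less.prems by (auto simp: subsets_card_def)
    ultimately show ?thesis by simp
  next
    case False
    then obtain n where n: "card A = Suc n" using less.prems by (cases "card A") auto
    let ?L = "\<lambda>x. {y \<in> A. y < x}" and ?R = "\<lambda>x. {y \<in> A. x < y}"
    define F where "F = (\<lambda>k. poly (span_poly k p) v - v * poly (hit_poly k p) v)"
    have ne: "S \<subseteq> A" "S \<noteq> {}" if "S \<in> subsets_card A p" for S
      using that less.prems by (auto simp: subsets_card_def)
    have "(\<Sum>S\<in>subsets_card A p. span_pgf A v S) - (\<Sum>S\<in>subsets_card A p. hit_pgf A v S) =
      (\<Sum>S\<in>subsets_card A p. \<Sum>x\<in>A.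
       (if S \<subseteq> ?L x then span_pgf (?L x) v S - v * hit_pgf (?L x) v S else 0) +
       (if S \<subseteq> ?R x then span_pgf (?R x) v S - v * hit_pgf (?R x) v S else 0)) / real (Suc n)"
      unfolding sum_subtractf[symmetric] sum_divide_distrib[of _ "subsets_card A p"]
      using span_pgf_rec[OF less.prems(1) ne] hit_pgf_rec[OF less.prems(1) ne] n
      by (intro sum.cong refl) (simp add: sum.distrib add_divide_distrib)
    also have "\<dots> = (\<Sum>x\<in>A. \<Sum>S\<in>subsets_card A p.
       (if S \<subseteq> ?L x then span_pgf (?L x) v S - v * hit_pgf (?L x) v S else 0) +
       (if S \<subseteq> ?R x then span_pgf (?R x) v S - v * hit_pgf (?R x) v S else 0)) / real (Suc n)"
      by (subst sum.swap) simp
    also have "\<dots> = (\<Sum>x\<in>A. F (card (?L x)) + F (n - card (?L x))) / real (Suc n)"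
    proof (intro arg_cong2[of _ _ _ _ "(/)"] sum.cong refl)
      fix x assume x: "x \<in> A"
      have c: "card (?L x) < card A" "card (?R x) < card A"
        using less.prems x by (auto intro!: psubset_card_mono)
      have "(\<Sum>S\<in>subsets_card A p. if S \<subseteq> B then span_pgf B v S - v * hit_pgf B v S else 0) = F (card B)"
        if "B \<subseteq> A" "card B < card A" for B
      proof -
        have "finite B" using that less.prems finite_subset by auto
        have "(\<Sum>S\<in>subsets_card A p. if S \<subseteq> B then span_pgf B v S - v * hit_pgf B v S else 0) =
              (\<Sum>S\<in>subsets_card B p. span_pgf B v S - v * hit_pgf B v S)"
          using less.prems that by (intro sum_subsets_card_subset) auto
        also have "\<dots> = F (card B)"
          using less.hyps[OF that(2)] \<open>finite B\<close> less.prems sum_hit_pgf[of B v p]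
          by (simp add: sum_subtractf F_def flip: sum_distrib_left)
        finally show ?thesis .
      qed
      from this[of "?L x"] this[of "?R x"] c
      show "(\<Sum>S\<in>subsets_card A p.
         (if S \<subseteq> ?L x then span_pgf (?L x) v S - v * hit_pgf (?L x) v S else 0) +
         (if S \<subseteq> ?R x then span_pgf (?R x) v S - v * hit_pgf (?R x) v S else 0)) =
         F (card (?L x)) + F (n - card (?L x))"
        using card_above_rank[OF less.prems(1) x] n by (simp add: sum.distrib)
    qed
    also have "(\<Sum>x\<in>A. F (card (?L x)) + F (n - card (?L x))) = (\<Sum>k\<le>n. F k + F (n - k))"
      using sum_over_ranks[OF less.prems(1), of "\<lambda>k. F k + F (n - k)"] n
      by (simp add: lessThan_Suc_atMost)
    also have "\<dots> = 2 * (\<Sum>k\<le>n. F k)"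
      using sum.nat_diff_reindex[of F "Suc n"] by (simp add: sum.distrib lessThan_Suc_atMost)
    finally have "(\<Sum>S\<in>subsets_card A p. span_pgf A v S) =
       poly (hit_poly (Suc n) p) v + 2 * (\<Sum>k\<le>n. F k) / real (Suc n)"
      using sum_hit_pgf[OF less.prems(1), of v p] n by simp
    then show ?thesis
      by (simp add: n span_poly.simps poly_sum F_def)
  qed
qed

lemma poly_hit_poly_1: "poly (hit_poly n p) 1 = real (n choose p)"
  using sum_hit_pgf[of "{..<n}" 1 p] by (simp add: hit_pgf_def card_subsets_card)

lemma poly_span_poly_1: "p > 0 \<Longrightarrow> poly (span_poly n p) 1 = real (n choose p)"
  using sum_span_pgf[of "{..<n}" p 1] by (simp add: span_pgf_def card_subsets_card)

section \<open>Stein's equation for the normal distribution\<close>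

abbreviation std_normal_cdf :: "real \<Rightarrow> real" ("\<Phi>") where
  "\<Phi> \<equiv> cdf std_normal_distribution"

abbreviation std_normal_pdf :: "real \<Rightarrow> real" ("\<phi>") where
  "\<phi> \<equiv> std_normal_density"

interpretation std_normal: real_distribution std_normal_distribution
  by (rule real_dist_normal_dist)

lemma std_normal_pdf_pos: "\<phi> x > 0"
  by (simp add: normal_density_pos)

lemma std_normal_pdf_le: "\<phi> x \<le> 1"
proof -
  have "exp (- (x\<^sup>2) / 2) \<le> 1" by simp
  moreover have "sqrt (2 * pi) \<ge> 1" using pi_gt3 by (intro real_le_rsqrt) simp
  ultimately have "exp (- (x\<^sup>2) / 2) \<le> sqrt (2 * pi)" by linarith
  moreover have "sqrt (2 * pi) > 0" by simp
  ultimately show ?thesis by (simp add: std_normal_density_def field_simps)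
qed

lemma has_real_derivative_std_normal_pdf:
  "(\<phi> has_real_derivative - x * \<phi> x) (at x)"
proof -
  define c where "c = 1 / sqrt (2 * pi)"
  have "\<phi> = (\<lambda>x. c * exp (- (x\<^sup>2) / 2))"
    by (simp add: fun_eq_iff std_normal_density_def c_def)
  then show ?thesis by (auto intro!: derivative_eq_intros)
qed

lemma std_normal_cdf_diff: "x \<le> y \<Longrightarrow> \<Phi> y - \<Phi> x = integral {x..y} \<phi>"
proof (cases "x = y")
  case False
  assume "x \<le> y"
  with False have "\<Phi> y - \<Phi> x = measure std_normal_distribution {x<..y}"
    by (intro std_normal.cdf_diff_eq) simp
  also have "\<dots> = integral\<^sup>L std_normal_distribution (indicator {x<..y})"
    by simp
  also have "\<dots> = (LINT t:{x<..y}|lborel. \<phi> t)"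
    unfolding set_lebesgue_integral_def
    by (subst integral_density) (auto simp: mult.commute)
  also have "\<dots> = integral {x<..y} \<phi>"
    by (intro set_borel_integral_eq_integral)
       (simp add: set_integrable_def integrable_real_mult_indicator mult.commute)
  also have "\<dots> = integral {x..y} \<phi>"
    by (rule integral_spike_set; rule negligible_subset[of "{x}"]) auto
  finally show ?thesis .
qed auto

lemma continuous_on_std_normal_pdf: "continuous_on A \<phi>"
  by (intro continuous_at_imp_continuous_on ballI DERIV_isCont[OF has_real_derivative_std_normal_pdf])

lemma has_real_derivative_std_normal_cdf: "(\<Phi> has_real_derivative \<phi> x) (at x)"
proof -
  have "((\<lambda>u. integral {x - 1..u} \<phi>) has_real_derivative \<phi> x) (at x within {x - 1..x + 1})"
    by (rule integral_has_real_derivative[OF continuous_on_std_normal_pdf]) simp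
  then have "((\<lambda>u. \<Phi> (x - 1) + integral {x - 1..u} \<phi>) has_real_derivative \<phi> x) (at x within {x - 1..x + 1})"
    by (auto intro!: derivative_eq_intros)
  then have "(\<Phi> has_real_derivative \<phi> x) (at x within {x - 1..x + 1})"
    by (rule has_field_derivative_transform_within[where d = 1])
       (simp_all add: std_normal_cdf_diff[of "x - 1", symmetric])
  moreover have "at x within {x - 1..x + 1} = at x"
    by (rule at_within_interior) simp
  ultimately show ?thesis by simp
qed

lemma continuous_on_std_normal_cdf: "continuous_on A \<Phi>"
  by (intro continuous_at_imp_continuous_on ballI DERIV_isCont[OF has_real_derivative_std_normal_cdf])

lemma std_normal_cdf_lipschitz: "x \<le> y \<Longrightarrow> \<Phi> y - \<Phi> x \<le> y - x"
proof -
  assume "x \<le> y"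
  then have "x - \<Phi> x \<le> y - \<Phi> y"
  proof (rule DERIV_nonneg_imp_nondecreasing)
    fix t
    have "((\<lambda>t. t - \<Phi> t) has_real_derivative 1 - \<phi> t) (at t)"
      by (intro derivative_intros has_real_derivative_std_normal_cdf)
    then show "\<exists>D. ((\<lambda>t. t - \<Phi> t) has_real_derivative D) (at t) \<and> 0 \<le> D"
      using std_normal_pdf_le[of t] by (intro exI[of _ "1 - \<phi> t"]) simp
  qed
  then show ?thesis by simp
qed

text \<open>
  The difference of the two sides is decreasing on the positive half-line and tends to 0.
\<close>

lemma mills_ratio_right:
  assumes "x > 0" shows "1 - \<Phi> x \<le> \<phi> x / x"
proof -
  define g where "g = (\<lambda>t. \<phi> t / t - (1 - \<Phi> t))"
  have mono: "g y \<le> g x" if "x \<le> y" for y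
  proof (rule DERIV_nonpos_imp_nonincreasing[OF that])
    fix t assume "x \<le> t" "t \<le> y"
    then have t: "t > 0" using assms by simp
    have "(g has_real_derivative (- t * \<phi> t * t - \<phi> t * 1) / (t * t) - (0 - \<phi> t)) (at t)"
      unfolding g_def
      by (intro derivative_intros has_real_derivative_std_normal_pdf has_real_derivative_std_normal_cdf)
         (use t in simp)
    moreover have "(- t * \<phi> t * t - \<phi> t * 1) / (t * t) - (0 - \<phi> t) = - \<phi> t / (t * t)"
      using t by (simp add: field_simps)
    moreover have "- \<phi> t / (t * t) \<le> 0" using std_normal_pdf_pos[of t] t by simp
    ultimately show "\<exists>D. (g has_real_derivative D) (at t) \<and> D \<le> 0" by metis
  qed
  have "((\<lambda>t. \<phi> t / t) \<longlongrightarrow> 0) at_top"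
    unfolding std_normal_density_def by real_asymp
  then have "(g \<longlongrightarrow> 0 - (1 - 1)) at_top"
    unfolding g_def by (intro tendsto_intros std_normal.cdf_lim_at_top_prob)
  then have "0 - (1 - 1) \<le> g x"
    by (rule tendsto_upperbound) (use mono in \<open>auto intro: eventually_at_top_linorderI[of x]\<close>)
  then show ?thesis by (simp add: g_def)
qed

lemma mills_ratio_left:
  assumes "x < 0" shows "\<Phi> x \<le> \<phi> x / - x"
proof -
  define g where "g = (\<lambda>t. \<phi> t / - t - \<Phi> t)"
  have mono: "g y \<le> g x" if "y \<le> x" for y
  proof (rule DERIV_nonneg_imp_nondecreasing[OF that])
    fix t assume "y \<le> t" "t \<le> x"
    then have t: "t < 0" using assms by simp
    have "(g has_real_derivative (- t * \<phi> t * - t - \<phi> t * - 1) / (- t * - t) - \<phi> t) (at t)"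
      unfolding g_def
      by (intro derivative_intros has_real_derivative_std_normal_pdf has_real_derivative_std_normal_cdf)
         (use t in simp)
    moreover have "(- t * \<phi> t * - t - \<phi> t * - 1) / (- t * - t) - \<phi> t = \<phi> t / (t * t)"
      using t by (simp add: field_simps)
    moreover have "\<phi> t / (t * t) \<ge> 0" using std_normal_pdf_pos[of t] by simp
    ultimately show "\<exists>D. (g has_real_derivative D) (at t) \<and> 0 \<le> D" by metis
  qed
  have "((\<lambda>t. \<phi> t / - t) \<longlongrightarrow> 0) at_bot"
    unfolding std_normal_density_def by real_asymp
  then have "(g \<longlongrightarrow> 0 - 0) at_bot"
    unfolding g_def by (intro tendsto_intros std_normal.cdf_lim_at_bot)
  then have "0 - 0 \<le> g x"
    by (rule tendsto_upperbound) (use mono in \<open>auto intro: eventually_at_bot_linorderI[of x]\<close>)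
  then show ?thesis by (simp add: g_def)
qed

text \<open>
  The bounded solution of Stein's equation \<open>f' x = x f x + 1\<^bsub>x \<le> z\<^esub> - \<Phi> z\<close>.
\<close>

definition stein_sol :: "real \<Rightarrow> real \<Rightarrow> real" where
  "stein_sol z x = (if x \<le> z then \<Phi> x * (1 - \<Phi> z) else \<Phi> z * (1 - \<Phi> x)) / \<phi> x"

text \<open>
  At the kink \<open>x = z\<close> this is the left derivative.  A single exceptional point does not matter for
  the fundamental theorem of calculus.
\<close>

definition stein_deriv :: "real \<Rightarrow> real \<Rightarrow> real" where
  "stein_deriv z x = x * stein_sol z x + of_bool (x \<le> z) - \<Phi> z"

lemma std_normal_cdf_bounds: "0 \<le> \<Phi> x" "\<Phi> x \<le> 1" "0 \<le> 1 - \<Phi> x" "1 - \<Phi> x \<le> 1"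
  using std_normal.cdf_nonneg[of x] std_normal.cdf_bounded_prob[of x] by auto

lemma stein_sol_nonneg: "0 \<le> stein_sol z x"
  using std_normal_cdf_bounds[of x] std_normal_cdf_bounds[of z] std_normal_pdf_pos[of x]
  by (auto simp: stein_sol_def less_imp_le)

lemma stein_sol_le: "stein_sol z x \<le> \<Phi> x * (1 - \<Phi> x) / \<phi> x"
proof -
  have "(if x \<le> z then \<Phi> x * (1 - \<Phi> z) else \<Phi> z * (1 - \<Phi> x)) \<le> \<Phi> x * (1 - \<Phi> x)"
    using std_normal_cdf_bounds[of x] std_normal_cdf_bounds[of z] std_normal.cdf_nondecreasing[of x z]
      std_normal.cdf_nondecreasing[of z x]
    by (auto intro!: mult_left_mono mult_right_mono)
  then show ?thesis
    unfolding stein_sol_def using std_normal_pdf_pos[of x] by (simp add: divide_right_mono)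
qed

lemma abs_mult_stein_sol_le: "\<bar>x * stein_sol z x\<bar> \<le> 1"
proof -
  have "\<bar>x\<bar> * stein_sol z x \<le> 1"
  proof (cases x "0 :: real" rule: linorder_cases)
    case greater
    have "\<Phi> x * (1 - \<Phi> x) \<le> 1 * (\<phi> x / x)"
      using std_normal_cdf_bounds[of x] mills_ratio_right[OF greater] by (intro mult_mono) auto
    then have "\<Phi> x * (1 - \<Phi> x) / \<phi> x \<le> 1 / x"
      using std_normal_pdf_pos[of x] greater by (simp add: field_simps)
    with stein_sol_le[of z x] have "stein_sol z x \<le> 1 / x" by linarith
    then show ?thesis using greater by (simp add: field_simps)
  next
    case less
    have "\<Phi> x * (1 - \<Phi> x) \<le> (\<phi> x / - x) * 1"
      using std_normal_cdf_bounds[of x] mills_ratio_left[OF less] by (intro mult_mono) auto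
    then have "\<Phi> x * (1 - \<Phi> x) / \<phi> x \<le> 1 / - x"
      using std_normal_pdf_pos[of x] less by (simp add: field_simps)
    with stein_sol_le[of z x] have "stein_sol z x \<le> 1 / - x" by linarith
    then show ?thesis using less by (simp add: field_simps)
  qed simp
  then show ?thesis using stein_sol_nonneg[of z x] by (simp add: abs_mult)
qed

text \<open>
  For \<open>\<bar>x\<bar> \<ge> 1\<close> this follows from the bound on \<open>x f x\<close>, and for \<open>\<bar>x\<bar> \<le> 1\<close> the density in the denominator is
  bounded away from 0.
\<close>

lemma stein_sol_le_5: "stein_sol z x \<le> 5"
proof (cases "\<bar>x\<bar> \<ge> 1")
  case True
  have "1 * stein_sol z x \<le> \<bar>x\<bar> * stein_sol z x"
    using True stein_sol_nonneg by (intro mult_right_mono)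
  then show ?thesis using abs_mult_stein_sol_le[of x z] stein_sol_nonneg[of z x]
    by (simp add: abs_mult)
next
  case False
  have "\<Phi> x * (1 - \<Phi> x) \<le> 1 * 1"
    using std_normal_cdf_bounds[of x] by (intro mult_mono) auto
  then have "stein_sol z x \<le> 1 / \<phi> x"
    using stein_sol_le[of z x] std_normal_pdf_pos[of x]
      divide_right_mono[of "\<Phi> x * (1 - \<Phi> x)" 1 "\<phi> x"] by simp
  also have "1 / \<phi> x = sqrt (2 * pi) * exp (x\<^sup>2 / 2)"
    by (simp add: std_normal_density_def exp_minus field_simps)
  also have "\<dots> \<le> sqrt (2 * pi) * exp (1 / 2)"
    using False by (intro mult_left_mono) (auto simp: abs_square_le_1)
  also have "\<dots> \<le> sqrt ((57 / 20)\<^sup>2) * (7 / 4)"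
  proof (intro mult_mono real_sqrt_le_mono)
    show "2 * pi \<le> (57 / 20)\<^sup>2" using pi_less_4 by (simp add: power2_eq_square)
    show "exp (1 / 2 :: real) \<le> 7 / 4"
      using exp_bound[of "1 / 2 :: real"] by (simp add: power2_eq_square)
  qed auto
  also have "\<dots> \<le> 5" by simp
  finally show ?thesis .
qed

lemma has_real_derivative_stein_sol:
  assumes "x \<noteq> z"
  shows "(stein_sol z has_real_derivative stein_deriv z x) (at x)"
proof -
  have d: "((\<lambda>x. (a + b * \<Phi> x) / \<phi> x) has_real_derivative b + x * ((a + b * \<Phi> x) / \<phi> x)) (at x)" for a b
  proof -
    have "((\<lambda>x. (a + b * \<Phi> x) / \<phi> x) has_real_derivative
        ((0 + b * \<phi> x) * \<phi> x - (a + b * \<Phi> x) * (- x * \<phi> x)) / (\<phi> x * \<phi> x)) (at x)"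
      by (intro derivative_intros DERIV_cmult has_real_derivative_std_normal_pdf has_real_derivative_std_normal_cdf)
         (use std_normal_pdf_pos[of x] in simp)
    moreover have "((0 + b * \<phi> x) * \<phi> x - (a + b * \<Phi> x) * (- x * \<phi> x)) / (\<phi> x * \<phi> x) =
        b + x * ((a + b * \<Phi> x) / \<phi> x)"
      using std_normal_pdf_pos[of x] by (simp add: field_simps)
    ultimately show ?thesis by simp
  qed
  consider "x < z" | "x > z" using assms by linarith
  then show ?thesis
  proof cases
    case 1
    have "(stein_sol z has_real_derivative (1 - \<Phi> z) + x * ((0 + (1 - \<Phi> z) * \<Phi> x) / \<phi> x)) (at x)"
      by (rule DERIV_cong_ev[THEN iffD1, OF refl _ refl d])
         (use eventually_nhds_in_open[of "{..<z}" x] 1 in \<open>auto elim!: eventually_mono simp: stein_sol_def mult.commute\<close>)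
    then show ?thesis using 1 by (simp add: stein_deriv_def stein_sol_def algebra_simps)
  next
    case 2
    have "(stein_sol z has_real_derivative - \<Phi> z + x * ((\<Phi> z + (- \<Phi> z) * \<Phi> x) / \<phi> x)) (at x)"
      by (rule DERIV_cong_ev[THEN iffD1, OF refl _ refl d])
         (use eventually_nhds_in_open[of "{z<..}" x] 2 in \<open>auto elim!: eventually_mono simp: stein_sol_def algebra_simps\<close>)
    then show ?thesis using 2 by (simp add: stein_deriv_def stein_sol_def algebra_simps)
  qed
qed

lemma continuous_on_stein_sol: "continuous_on A (stein_sol z)"
proof -
  note cont = continuous_on_std_normal_pdf continuous_on_std_normal_cdf
  have "continuous_on ({..z} \<union> {z..}) (stein_sol z)"
  proof (intro continuous_on_closed_Un closed_atMost closed_atLeast)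
    have "continuous_on {..z} (\<lambda>x. \<Phi> x * (1 - \<Phi> z) / \<phi> x)"
      using std_normal_pdf_pos by (intro continuous_intros cont) (simp add: less_imp_neq[symmetric])
    then show "continuous_on {..z} (stein_sol z)"
      by (rule continuous_on_eq) (simp add: stein_sol_def)
    have "continuous_on {z..} (\<lambda>x. \<Phi> z * (1 - \<Phi> x) / \<phi> x)"
      using std_normal_pdf_pos by (intro continuous_intros cont) (simp add: less_imp_neq[symmetric])
    then show "continuous_on {z..} (stein_sol z)"
      by (rule continuous_on_eq) (auto simp: stein_sol_def)
  qed
  moreover have "{..z} \<union> {z..} = UNIV" by auto
  ultimately show ?thesis by (metis continuous_on_subset subset_UNIV)
qed

lemma stein_sol_diff_integral:
  "a \<le> b \<Longrightarrow> (stein_deriv z has_integral (stein_sol z b - stein_sol z a)) {a..b}"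
  by (rule fundamental_theorem_of_calculus_strong[of "{z}"])
     (auto intro!: continuous_on_stein_sol has_real_derivative_stein_sol
        simp flip: has_real_derivative_iff_has_vector_derivative)

lemma stein_sol_diff_le:
  assumes "a \<le> b" "\<And>x. a \<le> x \<Longrightarrow> x \<le> b \<Longrightarrow> stein_deriv z x \<le> M"
  shows "stein_sol z b - stein_sol z a \<le> (b - a) * M"
proof -
  have "((\<lambda>x. M) has_integral (b - a) * M) {a..b}"
    using has_integral_const_real[of M a b] assms(1) by simp
  then show ?thesis
    by (rule has_integral_le[OF stein_sol_diff_integral[OF assms(1)]]) (use assms in auto)
qed

lemma stein_sol_diff_ge:
  assumes "a \<le> b" "\<And>x. a \<le> x \<Longrightarrow> x \<le> b \<Longrightarrow> M \<le> stein_deriv z x"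
  shows "(b - a) * M \<le> stein_sol z b - stein_sol z a"
proof -
  have "((\<lambda>x. M) has_integral (b - a) * M) {a..b}"
    using has_integral_const_real[of M a b] assms(1) by simp
  then show ?thesis
    by (rule has_integral_le[OF _ stein_sol_diff_integral[OF assms(1)]]) (use assms in auto)
qed

lemma stein_sol_lipschitz: "\<bar>stein_sol z y - stein_sol z x\<bar> \<le> 2 * \<bar>y - x\<bar>"
proof -
  have b: "stein_deriv z x \<le> 2" "-2 \<le> stein_deriv z x" for x
    using abs_mult_stein_sol_le[of x z] std_normal_cdf_bounds[of z]
    by (auto simp: stein_deriv_def of_bool_def)
  have "\<bar>stein_sol z y - stein_sol z x\<bar> \<le> 2 * (y - x)" if "x \<le> y" for x y
    using stein_sol_diff_le[OF that b(1)] stein_sol_diff_ge[OF that b(2)] by auto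
  from this[of x y] this[of y x] show ?thesis by (cases "x \<le> y") (auto simp: abs_minus_commute)
qed

text \<open>
  Replacing \<open>x f x\<close> by its value at a neighbouring lattice point costs only one factor \<open>\<delta>\<close>.
\<close>

lemma mult_stein_sol_increment:
  assumes "\<bar>x - w\<bar> \<le> \<delta>"
  shows "\<bar>x * stein_sol z x - w * stein_sol z w\<bar> \<le> \<delta> * (5 + 2 * \<bar>w\<bar>)"
proof -
  have "x * stein_sol z x - w * stein_sol z w =
        (x - w) * stein_sol z x + w * (stein_sol z x - stein_sol z w)" by (simp add: algebra_simps)
  also have "\<bar>\<dots>\<bar> \<le> \<bar>x - w\<bar> * stein_sol z x + \<bar>w\<bar> * (2 * \<bar>x - w\<bar>)"
    using stein_sol_nonneg[of z x] stein_sol_lipschitz[of z x w]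
    by (intro order_trans[OF abs_triangle_ineq] add_mono) (auto simp: abs_mult intro!: mult_left_mono)
  also have "\<dots> \<le> \<delta> * 5 + \<bar>w\<bar> * (2 * \<delta>)"
    using assms stein_sol_le_5[of z x] stein_sol_nonneg[of z x]
    by (intro add_mono mult_mono) auto
  finally show ?thesis by (simp add: algebra_simps)
qed

text \<open>
  The increment over one lattice step, compared with the right-hand side of Stein's equation at
  either of its end points.  The shift of \<open>z\<close> by \<open>\<delta>\<close> absorbs the jump of the indicator.
\<close>

lemma stein_sol_increment:
  assumes "\<delta> \<ge> 0" "w \<in> {a, a + \<delta>}"
  shows "stein_sol z (a + \<delta>) - stein_sol z a \<le>
           \<delta> * (w * stein_sol z w + \<delta> * (5 + 2 * \<bar>w\<bar>) + of_bool (w \<le> z + \<delta>) - \<Phi> z)" (is ?A)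
    and "stein_sol z (a + \<delta>) - stein_sol z a \<ge>
           \<delta> * (w * stein_sol z w - \<delta> * (5 + 2 * \<bar>w\<bar>) + of_bool (w \<le> z - \<delta>) - \<Phi> z)" (is ?B)
proof -
  have close: "\<bar>x - w\<bar> \<le> \<delta>" if "a \<le> x" "x \<le> a + \<delta>" for x using assms that by auto
  have "stein_deriv z x \<le> w * stein_sol z w + \<delta> * (5 + 2 * \<bar>w\<bar>) + of_bool (w \<le> z + \<delta>) - \<Phi> z"
    if "a \<le> x" "x \<le> a + \<delta>" for x
  proof -
    have "of_bool (x \<le> z) \<le> (of_bool (w \<le> z + \<delta>) :: real)" using close[OF that] by auto
    then show ?thesis
      using mult_stein_sol_increment[OF close[OF that], of z] by (simp add: stein_deriv_def abs_le_iff)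
  qed
  from stein_sol_diff_le[of a "a + \<delta>", OF _ this] show ?A using assms(1) by simp
  have "stein_deriv z x \<ge> w * stein_sol z w - \<delta> * (5 + 2 * \<bar>w\<bar>) + of_bool (w \<le> z - \<delta>) - \<Phi> z"
    if "a \<le> x" "x \<le> a + \<delta>" for x
  proof -
    have "of_bool (w \<le> z - \<delta>) \<le> (of_bool (x \<le> z) :: real)" using close[OF that] by auto
    then show ?thesis
      using mult_stein_sol_increment[OF close[OF that], of z] by (simp add: stein_deriv_def abs_le_iff)
  qed
  from stein_sol_diff_ge[of a "a + \<delta>", OF _ this] show ?B using assms(1) by simp
qed

section \<open>A Berry--Esseen bound for sums of Bernoulli variables\<close>

text \<open>
  The expectation of \<open>h\<close> applied to a sum of independent Bernoulli variables with the parameters in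
  the list.
\<close>

primrec bern_exp :: "real list \<Rightarrow> (nat \<Rightarrow> real) \<Rightarrow> real" where
  "bern_exp [] h = h 0"
| "bern_exp (q # qs) h = (1 - q) * bern_exp qs h + q * bern_exp qs (\<lambda>k. h (Suc k))"

definition bern_params :: "real list \<Rightarrow> bool" where
  "bern_params qs \<longleftrightarrow> (\<forall>q\<in>set qs. 0 \<le> q \<and> q \<le> 1)"

lemma bern_params_simps [simp]:
  "bern_params []" "bern_params (q # qs) \<longleftrightarrow> 0 \<le> q \<and> q \<le> 1 \<and> bern_params qs"
  "bern_params (qs @ rs) \<longleftrightarrow> bern_params qs \<and> bern_params rs"
  by (auto simp: bern_params_def)

abbreviation bern_var :: "real list \<Rightarrow> real" where
  "bern_var qs \<equiv> (\<Sum>q\<leftarrow>qs. q * (1 - q))"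

lemma bern_exp_add: "bern_exp qs (\<lambda>k. g k + h k) = bern_exp qs g + bern_exp qs h"
  by (induction qs arbitrary: g h) (simp_all add: algebra_simps)

lemma bern_exp_cmult: "bern_exp qs (\<lambda>k. c * h k) = c * bern_exp qs h"
  by (induction qs arbitrary: h) (simp_all add: algebra_simps)

lemma bern_exp_const: "bern_exp qs (\<lambda>_. c) = c"
  by (induction qs) (simp_all add: algebra_simps)

lemma bern_exp_diff: "bern_exp qs (\<lambda>k. g k - h k) = bern_exp qs g - bern_exp qs h"
  using bern_exp_add[of qs g "\<lambda>k. (-1) * h k"] bern_exp_cmult[of qs "-1" h] by simp

lemma bern_exp_mono:
  "bern_params qs \<Longrightarrow> (\<And>k. g k \<le> h k) \<Longrightarrow> bern_exp qs g \<le> bern_exp qs h"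
  by (induction qs arbitrary: g h) (auto intro!: add_mono mult_left_mono)

text \<open>
  Stein's identity \<open>E (W - \<mu>) h(W) = \<Sum> q (1 - q) E (h(W' + 1) - h(W'))\<close>, where \<open>W'\<close> is \<open>W\<close> without the
  summand of parameter \<open>q\<close>.  Since \<open>W\<close> is one of \<open>W'\<close> and \<open>W' + 1\<close>, a bound \<open>G\<close> of the increment by
  either end point makes it possible to replace every \<open>W'\<close> by \<open>W\<close>.  In the induction the new Bernoulli variable
  is averaged into \<open>h\<close> and \<open>G\<close>, which preserves the hypothesis.
\<close>

lemma bern_exp_stein_le:
  assumes "bern_params qs" "\<And>k. h (Suc k) - h k \<le> G k" "\<And>k. h (Suc k) - h k \<le> G (Suc k)"
  shows "bern_exp qs (\<lambda>k. (real k - sum_list qs) * h k) \<le> bern_var qs * bern_exp qs G"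
  using assms
proof (induction qs arbitrary: h G)
  case (Cons q qs)
  let ?h = "\<lambda>k. (1 - q) * h k + q * h (Suc k)" and ?G = "\<lambda>k. (1 - q) * G k + q * G (Suc k)"
  let ?\<mu> = "sum_list qs"
  have q: "0 \<le> q" "q \<le> 1" "bern_params qs" using Cons.prems by auto
  have G: "bern_exp qs ?G = bern_exp (q # qs) G"
    by (simp add: bern_exp_add bern_exp_cmult)
  have "bern_exp (q # qs) (\<lambda>k. (real k - sum_list (q # qs)) * h k) =
        bern_exp qs (\<lambda>k. (real k - ?\<mu>) * ?h k + (q * (1 - q)) * (h (Suc k) - h k))"
    unfolding bern_exp.simps bern_exp_cmult[symmetric] bern_exp_add[symmetric]
    by (intro arg_cong[of _ _ "bern_exp qs"]) (auto simp: algebra_simps)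
  also have "\<dots> = bern_exp qs (\<lambda>k. (real k - ?\<mu>) * ?h k) +
                  q * (1 - q) * bern_exp qs (\<lambda>k. h (Suc k) - h k)"
    unfolding bern_exp_add bern_exp_cmult ..
  also have "\<dots> \<le> bern_var qs * bern_exp qs ?G + q * (1 - q) * bern_exp qs ?G"
  proof (intro add_mono mult_left_mono)
    have le: "a \<le> c \<Longrightarrow> b \<le> d \<Longrightarrow> (1 - q) * a + q * b \<le> (1 - q) * c + q * d" for a b c d :: real
      using q by (intro add_mono mult_left_mono) auto
    show "bern_exp qs (\<lambda>k. (real k - ?\<mu>) * ?h k) \<le> bern_var qs * bern_exp qs ?G"
    proof (rule Cons.IH[OF q(3)])
      fix k
      have "?h (Suc k) - ?h k = (1 - q) * (h (Suc k) - h k) + q * (h (Suc (Suc k)) - h (Suc k))"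
        by (simp add: algebra_simps)
      then show "?h (Suc k) - ?h k \<le> ?G k" "?h (Suc k) - ?h k \<le> ?G (Suc k)"
        using le Cons.prems(2,3) by auto
    qed
    show "bern_exp qs (\<lambda>k. h (Suc k) - h k) \<le> bern_exp qs ?G"
    proof (rule bern_exp_mono[OF q(3)])
      fix k show "h (Suc k) - h k \<le> ?G k"
        using le[OF Cons.prems(2,3), of k k] by (simp add: algebra_simps)
    qed
  qed (use q in auto)
  also have "\<dots> = bern_var (q # qs) * bern_exp (q # qs) G"
    unfolding G by (simp add: algebra_simps)
  finally show ?case .
qed auto

lemma bern_exp_stein_ge:
  assumes "bern_params qs" "\<And>k. h (Suc k) - h k \<ge> G k" "\<And>k. h (Suc k) - h k \<ge> G (Suc k)"
  shows "bern_exp qs (\<lambda>k. (real k - sum_list qs) * h k) \<ge> bern_var qs * bern_exp qs G"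
proof -
  have neg: "bern_exp qs (\<lambda>k. - g k) = - bern_exp qs g" for g
    using bern_exp_cmult[of qs "-1" g] by simp
  have "bern_exp qs (\<lambda>k. (real k - sum_list qs) * - h k) \<le> bern_var qs * bern_exp qs (\<lambda>k. - G k)"
  proof (rule bern_exp_stein_le[OF assms(1)])
    fix k show "- h (Suc k) - - h k \<le> - G k" "- h (Suc k) - - h k \<le> - G (Suc k)"
      using assms(2,3)[of k] by auto
  qed
  then show ?thesis by (simp add: neg)
qed

text \<open>
  Stein's inequality for \<open>h(k) = k - \<mu>\<close>, whose increments equal 1.
\<close>

lemma bern_exp_variance_le:
  assumes "bern_params qs"
  shows "bern_exp qs (\<lambda>k. (real k - sum_list qs)\<^sup>2) \<le> bern_var qs"
  using bern_exp_stein_le[OF assms, of "\<lambda>k. real k - sum_list qs" "\<lambda>_. 1"]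
  by (simp add: bern_exp_const power2_eq_square)

lemma bern_exp_of_bool_bounds:
  assumes "bern_params qs"
  shows "0 \<le> bern_exp qs (\<lambda>k. of_bool (P k))" "bern_exp qs (\<lambda>k. of_bool (P k)) \<le> 1"
  using bern_exp_mono[OF assms, of "\<lambda>_. 0" "\<lambda>k. of_bool (P k)"]
    bern_exp_mono[OF assms, of "\<lambda>k. of_bool (P k)" "\<lambda>_. 1"]
  by (auto simp: bern_exp_const)

context
  fixes qs :: "real list" and s m r D :: real
  assumes qs: "bern_params qs" and s: "s \<ge> 1"
    and D: "\<bar>r + sum_list qs - m\<bar> + \<bar>bern_var qs - s\<^sup>2\<bar> \<le> D" and small: "D \<le> s / 2"
begin

abbreviation "zscore k \<equiv> (real k + r - m) / s"

lemma bern_var_close: "\<bar>bern_var qs / s\<^sup>2 - 1\<bar> \<le> D / s\<^sup>2" "bern_var qs / s\<^sup>2 \<ge> 1 / 2" "bern_var qs / s\<^sup>2 \<le> 3 / 2"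
proof -
  have s2: "s \<le> s\<^sup>2" "s\<^sup>2 > 0" using s by (auto simp: power2_eq_square)
  have "\<bar>bern_var qs / s\<^sup>2 - 1\<bar> = \<bar>bern_var qs - s\<^sup>2\<bar> / s\<^sup>2"
  proof -
    have "bern_var qs / s\<^sup>2 - 1 = (bern_var qs - s\<^sup>2) / s\<^sup>2"
      using s2 by (simp add: diff_divide_distrib)
    then show ?thesis by (simp add: abs_divide)
  qed
  also have "\<dots> \<le> D / s\<^sup>2" using D s2 by (intro divide_right_mono) auto
  finally show *: "\<bar>bern_var qs / s\<^sup>2 - 1\<bar> \<le> D / s\<^sup>2" .
  have "D / s\<^sup>2 \<le> 1 / 2" using small s2 by (simp add: field_simps)
  with * show "bern_var qs / s\<^sup>2 \<ge> 1 / 2" "bern_var qs / s\<^sup>2 \<le> 3 / 2" by linarith+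
qed

lemma bern_exp_abs_std_le: "bern_exp qs (\<lambda>k. \<bar>zscore k\<bar>) \<le> 5 / 2"
proof -
  have s2: "s\<^sup>2 > 0" using s by simp
  have D0: "D \<ge> 0" using D by linarith
  have "bern_exp qs (\<lambda>k. \<bar>zscore k\<bar>) \<le> bern_exp qs (\<lambda>k. 1 / 2 + ((real k - sum_list qs)\<^sup>2 * (1 / s\<^sup>2) + (r + sum_list qs - m)\<^sup>2 / s\<^sup>2))"
  proof (rule bern_exp_mono[OF qs])
    fix k
    have 1: "\<bar>x\<bar> \<le> 1 / 2 + x\<^sup>2 / 2" for x :: real
      using zero_le_power2[of "\<bar>x\<bar> - 1"] by (simp add: power2_eq_square algebra_simps)
    have 2: "(a + b)\<^sup>2 \<le> 2 * a\<^sup>2 + 2 * b\<^sup>2" for a b :: real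
      using zero_le_power2[of "a - b"] by (simp add: power2_eq_square algebra_simps)
    have "(zscore k)\<^sup>2 = ((real k - sum_list qs) + (r + sum_list qs - m))\<^sup>2 / s\<^sup>2"
    proof -
      have "(real k - sum_list qs) + (r + sum_list qs - m) = real k + r - m" by simp
      then show ?thesis by (simp only: power_divide)
    qed
    also have "\<dots> \<le> (2 * (real k - sum_list qs)\<^sup>2 + 2 * (r + sum_list qs - m)\<^sup>2) / s\<^sup>2"
      by (intro divide_right_mono 2) simp
    finally show "\<bar>zscore k\<bar> \<le> 1 / 2 + ((real k - sum_list qs)\<^sup>2 * (1 / s\<^sup>2) + (r + sum_list qs - m)\<^sup>2 / s\<^sup>2)"
      using 1[of "zscore k"] by (simp add: add_divide_distrib)
  qed
  also have "\<dots> = 1 / 2 + (bern_exp qs (\<lambda>k. (real k - sum_list qs)\<^sup>2) / s\<^sup>2 + (r + sum_list qs - m)\<^sup>2 / s\<^sup>2)"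
    using bern_exp_cmult[of qs "1 / s\<^sup>2" "\<lambda>k. (real k - sum_list qs)\<^sup>2"]
    by (simp add: bern_exp_add bern_exp_const mult.commute)
  also have "bern_exp qs (\<lambda>k. (real k - sum_list qs)\<^sup>2) / s\<^sup>2 \<le> 3 / 2"
    using divide_right_mono[OF bern_exp_variance_le[OF qs], of "s\<^sup>2"] bern_var_close(3)
      zero_le_power2[of s] by linarith
  also have "(r + sum_list qs - m)\<^sup>2 / s\<^sup>2 \<le> 1 / 2"
  proof -
    have "\<bar>r + sum_list qs - m\<bar> \<le> s / 2" using D small by linarith
    then have "(r + sum_list qs - m)\<^sup>2 \<le> (s / 2)\<^sup>2"
      using s by (intro abs_le_square_iff[THEN iffD1]) auto
    moreover have "(s / 2)\<^sup>2 = 1 / 4 * s\<^sup>2" by (simp add: power_divide)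
    ultimately have "(r + sum_list qs - m)\<^sup>2 \<le> 1 / 2 * s\<^sup>2" using s2 by linarith
    then show ?thesis using s2 by (simp add: divide_le_eq)
  qed
  finally show ?thesis by simp
qed

text \<open>
  Stein's inequality is applied to the solution for the level \<open>z\<close>.  Both sides contain the
  expectation of \<open>w f(w)\<close>; it cancels up to the factor \<open>1 - \<tau>\<close>, where \<open>\<tau>\<close> is the ratio of the actual to
  the intended variance.  What is left compares the distribution function with \<open>\<Phi> z\<close>.
\<close>

lemma bern_stein_bounds:
  shows "\<Phi> z - bern_exp qs (\<lambda>k. of_bool (zscore k \<le> z + 1 / s)) \<le> (12 * D + 10) / s"
    and "bern_exp qs (\<lambda>k. of_bool (zscore k \<le> z - 1 / s)) - \<Phi> z \<le> (12 * D + 10) / s"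
proof -
  define \<delta> where "\<delta> = 1 / s"
  define \<tau> where "\<tau> = bern_var qs / s\<^sup>2"
  define f where "f = stein_sol z"
  define P where "P = bern_exp qs (\<lambda>k. of_bool (zscore k \<le> z + \<delta>))"
  define Q where "Q = bern_exp qs (\<lambda>k. of_bool (zscore k \<le> z - \<delta>))"
  define A where "A = bern_exp qs (\<lambda>k. zscore k * f (zscore k))"
  define B where "B = bern_exp qs (\<lambda>k. f (zscore k))"
  define M where "M = bern_exp qs (\<lambda>k. \<bar>zscore k\<bar>)"
  have \<delta>: "\<delta> > 0" "\<delta> * s = 1" "\<delta> \<le> 1" using s by (auto simp: \<delta>_def)
  have D0: "D \<ge> 0" using D by linarith
  have \<tau>: "bern_var qs * \<delta> * \<delta> = \<tau>" by (simp add: \<tau>_def \<delta>_def power2_eq_square)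
  have suc: "zscore (Suc k) = zscore k + \<delta>" for k using s by (simp add: \<delta>_def field_simps)
  have A: "\<bar>A\<bar> \<le> 1"
  proof -
    have *: "zscore k * f (zscore k) \<le> 1" "-1 \<le> zscore k * f (zscore k)" for k
      using abs_mult_stein_sol_le[of "zscore k" z] unfolding f_def by linarith+
    have "A \<le> bern_exp qs (\<lambda>_. 1)" unfolding A_def by (rule bern_exp_mono[OF qs *(1)])
    moreover have "bern_exp qs (\<lambda>_. -1) \<le> A" unfolding A_def by (rule bern_exp_mono[OF qs *(2)])
    ultimately show ?thesis by (simp add: bern_exp_const)
  qed
  have B: "\<bar>B\<bar> \<le> 5"
    using bern_exp_mono[OF qs, of "\<lambda>k. f (zscore k)" "\<lambda>_. 5"]
      bern_exp_mono[OF qs, of "\<lambda>_. 0" "\<lambda>k. f (zscore k)"] stein_sol_le_5 stein_sol_nonneg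
    by (simp add: bern_exp_const B_def f_def)
  define L where "L = bern_exp qs (\<lambda>k. (real k - sum_list qs) * f (zscore k))"
  have L: "\<delta> * L = A - \<delta> * (r + sum_list qs - m) * B"
  proof -
    have "\<delta> * L = bern_exp qs (\<lambda>k. zscore k * f (zscore k) - (\<delta> * (r + sum_list qs - m)) * f (zscore k))"
      unfolding L_def bern_exp_cmult[symmetric]
      by (intro arg_cong[of _ _ "bern_exp qs"]) (auto simp: \<delta>_def diff_divide_distrib add_divide_distrib algebra_simps)
    then show ?thesis by (simp only: bern_exp_diff bern_exp_cmult A_def B_def)
  qed
  have err: "\<bar>\<delta> * (r + sum_list qs - m) * B\<bar> + \<bar>(1 - \<tau>) * A\<bar> \<le> 6 * D * \<delta>"
  proof -
    have "\<bar>\<delta> * (r + sum_list qs - m) * B\<bar> \<le> 5 * (D * \<delta>)"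
    proof -
      have "\<bar>\<delta> * (r + sum_list qs - m) * B\<bar> \<le> \<delta> * D * 5"
        unfolding abs_mult using B D \<delta> by (intro mult_mono) auto
      then show ?thesis by (simp add: mult_ac)
    qed
    moreover have "\<bar>(1 - \<tau>) * A\<bar> \<le> (D / s\<^sup>2) * 1"
      unfolding abs_mult using A bern_var_close(1) D0
      by (intro mult_mono) (auto simp: \<tau>_def abs_minus_commute)
    moreover have "D / s\<^sup>2 \<le> D * \<delta>"
      using s D0 by (auto simp: \<delta>_def power2_eq_square field_simps mult_le_cancel_left1)
    ultimately show ?thesis by linarith
  qed
  have M: "M \<le> 5 / 2" using bern_exp_abs_std_le by (simp add: M_def)
  have M0: "M \<ge> 0" unfolding M_def using bern_exp_mono[OF qs, of "\<lambda>_. 0" "\<lambda>k. \<bar>zscore k\<bar>"]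
    by (simp add: bern_exp_const)
  have t: "\<tau> \<ge> 1 / 2" "\<tau> \<le> 3 / 2" using bern_var_close by (auto simp: \<tau>_def)
  \<comment> \<open>Division by \<open>\<tau> \<ge> 1/2\<close>; if \<open>x\<close> is small already, the sign of the difference would be wrong.\<close>
  have fin: "x \<le> (12 * D + 10) / s" if "\<tau> * x \<le> 6 * D * \<delta> + \<tau> * (\<delta> * (5 + 2 * M))" for x
  proof (cases "x \<le> \<delta> * (5 + 2 * M)")
    case True
    then have "x \<le> \<delta> * (5 + 2 * M)" .
    also have "\<dots> \<le> \<delta> * 10" using M \<delta> by (intro mult_left_mono) auto
    also have "\<dots> \<le> (12 * D + 10) / s" using D0 s by (simp add: \<delta>_def divide_right_mono)
    finally show ?thesis .
  next
    case False
    have "1 / 2 * (x - \<delta> * (5 + 2 * M)) \<le> \<tau> * (x - \<delta> * (5 + 2 * M))"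
      using t False by (intro mult_right_mono) auto
    also have "\<dots> \<le> 6 * D * \<delta>" using that by (simp add: algebra_simps)
    finally have "x \<le> 12 * D * \<delta> + \<delta> * (5 + 2 * M)" by simp
    also have "\<dots> \<le> 12 * D * \<delta> + \<delta> * 10" using M \<delta> by (intro add_left_mono mult_left_mono) auto
    also have "\<dots> = (12 * D + 10) / s" by (simp add: \<delta>_def add_divide_distrib)
    finally show ?thesis .
  qed
  define G where "G = (\<lambda>k. \<delta> * (zscore k * f (zscore k) + \<delta> * (5 + 2 * \<bar>zscore k\<bar>) + of_bool (zscore k \<le> z + \<delta>) - \<Phi> z))"
  have "L \<le> bern_var qs * bern_exp qs G"
    unfolding L_def
  proof (rule bern_exp_stein_le[OF qs])
    fix k show "f (zscore (Suc k)) - f (zscore k) \<le> G k" "f (zscore (Suc k)) - f (zscore k) \<le> G (Suc k)"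
      unfolding G_def f_def suc
      by (rule stein_sol_increment(1); use \<delta> in simp)+
  qed
  also have "bern_exp qs G = \<delta> * (A + \<delta> * (5 + 2 * M) + P - \<Phi> z)"
    unfolding G_def A_def P_def M_def by (simp only: bern_exp_cmult bern_exp_add bern_exp_diff bern_exp_const)
  finally have "\<delta> * L \<le> \<delta> * (bern_var qs * (\<delta> * (A + \<delta> * (5 + 2 * M) + P - \<Phi> z)))"
    using \<delta> by (intro mult_left_mono) auto
  also have "\<dots> = \<tau> * (A + \<delta> * (5 + 2 * M) + P - \<Phi> z)" unfolding \<tau>[symmetric] by simp
  also have "\<dots> = A - (1 - \<tau>) * A + \<tau> * (\<delta> * (5 + 2 * M)) - \<tau> * (\<Phi> z - P)"
    by (simp add: algebra_simps)
  finally have "\<tau> * (\<Phi> z - P) \<le> 6 * D * \<delta> + \<tau> * (\<delta> * (5 + 2 * M))"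
    unfolding L using err by linarith
  from fin[OF this] show "\<Phi> z - bern_exp qs (\<lambda>k. of_bool (zscore k \<le> z + 1 / s)) \<le> (12 * D + 10) / s"
    by (simp add: P_def \<delta>_def)
  define H where "H = (\<lambda>k. \<delta> * (zscore k * f (zscore k) - \<delta> * (5 + 2 * \<bar>zscore k\<bar>) + of_bool (zscore k \<le> z - \<delta>) - \<Phi> z))"
  have "bern_var qs * bern_exp qs H \<le> L"
    unfolding L_def
  proof (rule bern_exp_stein_ge[OF qs])
    fix k show "H k \<le> f (zscore (Suc k)) - f (zscore k)" "H (Suc k) \<le> f (zscore (Suc k)) - f (zscore k)"
      unfolding H_def f_def suc
      by (rule stein_sol_increment(2); use \<delta> in simp)+
  qed
  also have "bern_exp qs H = \<delta> * (A - \<delta> * (5 + 2 * M) + Q - \<Phi> z)"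
    unfolding H_def A_def Q_def M_def by (simp only: bern_exp_cmult bern_exp_add bern_exp_diff bern_exp_const)
  finally have "\<delta> * (bern_var qs * (\<delta> * (A - \<delta> * (5 + 2 * M) + Q - \<Phi> z))) \<le> \<delta> * L"
    using \<delta> by (intro mult_left_mono) auto
  also have "\<delta> * (bern_var qs * (\<delta> * (A - \<delta> * (5 + 2 * M) + Q - \<Phi> z))) = \<tau> * (A - \<delta> * (5 + 2 * M) + Q - \<Phi> z)"
    unfolding \<tau>[symmetric] by simp
  also have "\<tau> * (A - \<delta> * (5 + 2 * M) + Q - \<Phi> z) =
      A - (1 - \<tau>) * A - \<tau> * (\<delta> * (5 + 2 * M)) + \<tau> * (Q - \<Phi> z)"
    by (simp add: algebra_simps)
  finally have "\<tau> * (Q - \<Phi> z) \<le> 6 * D * \<delta> + \<tau> * (\<delta> * (5 + 2 * M))"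
    unfolding L using err by linarith
  from fin[OF this] show "bern_exp qs (\<lambda>k. of_bool (zscore k \<le> z - 1 / s)) - \<Phi> z \<le> (12 * D + 10) / s"
    by (simp add: Q_def \<delta>_def)
qed

end

text \<open>
  The centring \<open>m\<close> and the scale \<open>s\<close> are arbitrary and the error is linear in the discrepancy \<open>D\<close>
  between them and the actual mean and variance.  Because of this linearity the bound can be
  averaged over mixtures later.
\<close>

theorem bernoulli_berry_esseen:
  assumes qs: "bern_params qs" and s: "s \<ge> 1"
    and D: "\<bar>r + sum_list qs - m\<bar> + \<bar>bern_var qs - s\<^sup>2\<bar> \<le> D"
  shows "\<bar>bern_exp qs (\<lambda>k. of_bool (r + real k < y)) - \<Phi> ((y - m) / s)\<bar> \<le> 12 * (1 + D) / s"
proof (cases "D \<le> s / 2")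
  case False
  have "\<bar>bern_exp qs (\<lambda>k. of_bool (r + real k < y)) - \<Phi> ((y - m) / s)\<bar> \<le> 1"
    using bern_exp_of_bool_bounds[OF qs, of "\<lambda>k. r + real k < y"] std_normal_cdf_bounds[of "(y - m) / s"] by linarith
  also have "1 \<le> 12 * (1 + D) / s" using False s by (simp add: field_simps)
  finally show ?thesis .
next
  case True
  define x where "x = (y - m) / s"
  let ?E = "bern_exp qs" and ?w = "\<lambda>k. (real k + r - m) / s"
  have lt: "r + real k < y \<longleftrightarrow> ?w k < x" for k
    using s by (auto simp: x_def divide_less_cancel)
  note b = bern_stein_bounds[OF qs s D True]
  \<comment> \<open>One step \<open>1 / s\<close> compensates the shift in the Stein bound, another one the strict inequality.\<close>
  have "\<Phi> x - 2 / s \<le> \<Phi> (x - 2 / s)"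
    using std_normal_cdf_lipschitz[of "x - 2 / s" x] s by simp
  also have "\<dots> \<le> ?E (\<lambda>k. of_bool (?w k \<le> x - 1 / s)) + (12 * D + 10) / s"
    using b(1)[of "x - 2 / s"] by (simp add: algebra_simps diff_divide_distrib)
  also have "?E (\<lambda>k. of_bool (?w k \<le> x - 1 / s)) \<le> ?E (\<lambda>k. of_bool (?w k < x))"
  proof (rule bern_exp_mono[OF qs])
    fix k
    have "1 / s > 0" using s by simp
    then have "?w k \<le> x - 1 / s \<Longrightarrow> ?w k < x" by linarith
    then show "of_bool (?w k \<le> x - 1 / s) \<le> (of_bool (?w k < x) :: real)" by simp
  qed
  finally have 1: "\<Phi> x \<le> ?E (\<lambda>k. of_bool (?w k < x)) + 12 * (1 + D) / s"
    by (simp add: add_divide_distrib algebra_simps)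
  have "?E (\<lambda>k. of_bool (?w k < x)) \<le> ?E (\<lambda>k. of_bool (?w k \<le> (x + 1 / s) - 1 / s))"
    by (rule bern_exp_mono[OF qs]) auto
  also have "\<dots> \<le> \<Phi> (x + 1 / s) + (12 * D + 10) / s"
    using b(2)[of "x + 1 / s"] by linarith
  also have "\<Phi> (x + 1 / s) \<le> \<Phi> x + 1 / s"
    using std_normal_cdf_lipschitz[of x "x + 1 / s"] s by simp
  finally have *: "?E (\<lambda>k. of_bool (?w k < x)) \<le> \<Phi> x + 1 / s + (12 * D + 10) / s" by simp
  have "1 / s + (12 * D + 10) / s = (12 * D + 11) / s" by (simp add: add_divide_distrib)
  also have "\<dots> \<le> 12 * (1 + D) / s" by (intro divide_right_mono) (use s in auto)
  finally have 2: "?E (\<lambda>k. of_bool (?w k < x)) \<le> \<Phi> x + 12 * (1 + D) / s"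
    using * by linarith
  show ?thesis using 1 2 by (simp add: lt flip: x_def)
qed

section \<open>Mixtures of products of depth polynomials\<close>

text \<open>
  A polynomial with nonnegative coefficients is viewed as a finite measure on the exponents.
\<close>

definition poly_exp :: "real poly \<Rightarrow> (nat \<Rightarrow> real) \<Rightarrow> real" where
  "poly_exp P h = (\<Sum>k\<le>degree P. coeff P k * h k)"

lemma poly_exp_upto: "degree P \<le> n \<Longrightarrow> poly_exp P h = (\<Sum>k\<le>n. coeff P k * h k)"
  unfolding poly_exp_def by (rule sum.mono_neutral_left) (auto simp: coeff_eq_0)

lemma poly_exp_add: "poly_exp (P + Q) h = poly_exp P h + poly_exp Q h"
proof -
  define n where "n = max (degree P) (degree Q)"
  have "degree P \<le> n" "degree Q \<le> n" "degree (P + Q) \<le> n"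
    unfolding n_def by (auto intro: degree_add_le_max)
  then show ?thesis by (simp add: poly_exp_upto[of _ n] sum.distrib algebra_simps)
qed

lemma poly_exp_0 [simp]: "poly_exp 0 h = 0"
  by (simp add: poly_exp_def)

lemma poly_exp_smult: "poly_exp (smult a P) h = a * poly_exp P h"
  using poly_exp_upto[of "smult a P" "degree P" h]
  by (simp add: poly_exp_def sum_distrib_left mult_ac)

lemma poly_exp_pCons_0: "poly_exp (pCons 0 P) h = poly_exp P (\<lambda>k. h (Suc k))"
proof -
  have "poly_exp (pCons 0 P) h = (\<Sum>k\<le>Suc (degree P). coeff (pCons 0 P) k * h k)"
    by (rule poly_exp_upto) (rule degree_pCons_le)
  then show ?thesis unfolding sum.atMost_Suc_shift by (simp add: poly_exp_def)
qed

lemma poly_exp_monom_mult: "poly_exp (monom 1 r * P) h = poly_exp P (\<lambda>k. h (r + k))"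
proof (induction r arbitrary: h)
  case (Suc r)
  have "monom 1 (Suc r) * P = pCons 0 (monom 1 r * P)" by (simp add: monom_Suc)
  then show ?case using Suc by (simp add: poly_exp_pCons_0)
qed (simp add: monom_0 one_pCons[symmetric])

definition bern_poly :: "real list \<Rightarrow> real poly" where
  "bern_poly qs = (\<Prod>q\<leftarrow>qs. [:1 - q, q:])"

lemma poly_exp_bern_poly: "poly_exp (bern_poly qs) h = bern_exp qs h"
proof (induction qs arbitrary: h)
  case (Cons q qs)
  have "bern_poly (q # qs) = smult (1 - q) (bern_poly qs) + pCons 0 (smult q (bern_poly qs))"
    by (simp add: bern_poly_def)
  then show ?case
    by (simp add: poly_exp_add poly_exp_smult poly_exp_pCons_0 Cons)
qed (simp add: bern_poly_def poly_exp_def)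

lemma poly_bern_poly_1 [simp]: "poly (bern_poly qs) 1 = 1"
  by (induction qs) (auto simp: bern_poly_def)

text \<open>
  The parameters \<open>2 / (j + 1)\<close>, \<open>j \<le> k\<close>: with the corresponding probability, the path of the key
  number \<open>k + 1\<close> to be inserted passes through the key inserted as number \<open>j\<close>.
\<close>

primrec depth_params :: "nat \<Rightarrow> real list" where
  "depth_params 0 = []"
| "depth_params (Suc k) = 2 / real (k + 2) # depth_params k"

abbreviation depth_poly :: "nat \<Rightarrow> real poly" where
  "depth_poly k \<equiv> bern_poly (depth_params k)"

lemma bern_params_depth: "bern_params (depth_params k)"
  by (induction k) auto

text \<open>
  The sum is \<open>2 H\<^sub>k\<^sub>+\<^sub>1 - 2\<close>.
\<close>

lemma sum_depth_params:
  "sum_list (depth_params k) \<le> 2 * ln (real k + 1)" "2 * ln (real k + 2) - 2 \<le> sum_list (depth_params k)"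
proof -
  have "sum_list (depth_params k) \<le> 2 * ln (real k + 1) \<and> 2 * ln (real k + 2) - 2 \<le> sum_list (depth_params k)"
  proof (induction k)
    case 0
    then show ?case using ln_2_less_1 by simp
  next
    case (Suc k)
    have "ln ((real k + 1) / (real k + 2)) \<le> (real k + 1) / (real k + 2) - 1"
      by (rule ln_le_minus_one) simp
    then have 1: "1 / (real k + 2) \<le> ln (real k + 2) - ln (real k + 1)"
      by (simp add: ln_div field_simps)
    have "ln ((real k + 3) / (real k + 2)) \<le> (real k + 3) / (real k + 2) - 1"
      by (rule ln_le_minus_one) simp
    then have 2: "ln (real k + 3) - ln (real k + 2) \<le> 1 / (real k + 2)"
      by (simp add: ln_div field_simps)
    show ?case using Suc 1 2 by (simp add: add_ac)
  qed
  then show "sum_list (depth_params k) \<le> 2 * ln (real k + 1)"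
    "2 * ln (real k + 2) - 2 \<le> sum_list (depth_params k)" by auto
qed

lemma bern_var_depth_params:
  "\<bar>bern_var (depth_params k) - sum_list (depth_params k)\<bar> \<le> 4"
proof -
  have "bern_var (depth_params k) \<le> sum_list (depth_params k) \<and>
        sum_list (depth_params k) - bern_var (depth_params k) \<le> 4 - 4 / (real k + 1)"
  proof (induction k)
    case (Suc k)
    define x where "x = real k + 2"
    have x: "x \<ge> 2" by (simp add: x_def)
    have "2 / x * (2 / x) \<le> 4 / (x - 1) - 4 / x"
      using x by (simp add: divide_simps)
    moreover have "2 / x * (2 / x) \<ge> 0" by simp
    moreover have "4 / (x - 1) = 4 / (real k + 1)" "4 / (real (Suc k) + 1) = 4 / x"
      by (simp_all add: x_def add_ac)
    moreover have "bern_var (depth_params (Suc k)) = 2 / x - 2 / x * (2 / x) + bern_var (depth_params k)"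
      "sum_list (depth_params (Suc k)) = 2 / x + sum_list (depth_params k)"
      by (simp_all add: x_def right_diff_distrib add.commute)
    ultimately show ?case using Suc by linarith
  qed simp
  moreover have "4 / (real k + 1) \<ge> 0" by simp
  ultimately show ?thesis by linarith
qed

text \<open>
  By the definition of the product, \<open>(n + 2) U\<^sub>n\<^sub>+\<^sub>1 = (n + 2 v) U\<^sub>n\<close>, which telescopes.
\<close>

lemma depth_poly_telescope:
  "real (Suc n) * (v * poly (depth_poly n) v) = v + (2 * v - 1) * (\<Sum>k<n. v * poly (depth_poly k) v)"
proof (induction n)
  case (Suc n)
  have a: "poly (depth_poly (Suc n)) v = (1 - 2 / (real n + 2) + v * (2 / (real n + 2))) * poly (depth_poly n) v"
    by (simp add: bern_poly_def add_ac distrib_right)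
  have b: "(real n + 2) * (1 - 2 / (real n + 2) + v * (2 / (real n + 2))) = real n + 2 * v"
  proof -
    define y where "y = real n + 2"
    have "y > 0" "real n = y - 2" by (auto simp: y_def)
    then show ?thesis by (simp add: distrib_left right_diff_distrib flip: y_def)
  qed
  have "(real n + 2) * poly (depth_poly (Suc n)) v = (real n + 2 * v) * poly (depth_poly n) v"
    by (simp only: a mult.assoc[symmetric] b)
  then have "real (Suc (Suc n)) * (v * poly (depth_poly (Suc n)) v) =
      real (Suc n) * (v * poly (depth_poly n) v) + (2 * v - 1) * (v * poly (depth_poly n) v)"
    by (simp add: algebra_simps)
  then show ?case unfolding Suc by (simp add: algebra_simps)
qed (simp add: bern_poly_def)

text \<open>
  A uniformly random node is inserted at a uniformly random time, and given this time its depth is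
  a sum of independent Bernoulli variables.  Here both sides are shown to satisfy the same
  recurrence.
\<close>

lemma hit_poly_1: "hit_poly n 1 = (\<Sum>k<n. pCons 0 (depth_poly k))"
proof -
  define B where "B = (\<lambda>v n. \<Sum>k<n. v * poly (depth_poly k) v)"
  have B: "real (Suc n) * B v (Suc n) = v * (2 * (\<Sum>k\<le>n. B v k) + real (Suc n))" for n v
  proof (induction n)
    case (Suc n)
    have "real (Suc (Suc n)) * B v (Suc (Suc n)) =
       real (Suc n) * B v (Suc n) + B v (Suc n) + real (Suc (Suc n)) * (v * poly (depth_poly (Suc n)) v)"
      by (simp add: B_def algebra_simps)
    also have "real (Suc (Suc n)) * (v * poly (depth_poly (Suc n)) v) = v + (2 * v - 1) * B v (Suc n)"
      unfolding depth_poly_telescope B_def ..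
    finally show ?case unfolding Suc by (simp add: algebra_simps)
  qed (simp add: B_def bern_poly_def)
  have "poly (hit_poly n 1) v = B v n" for v
  proof (induction n rule: less_induct)
    case (less n)
    show ?case
    proof (cases n)
      case (Suc m)
      have "real (Suc m) * poly (hit_poly (Suc m) 1) v =
        v * (\<Sum>k\<le>m. poly (hit_poly (m - k) 1) v + poly (hit_poly k 1) v + 1)"
        by (simp add: hit_poly.simps poly_sum of_nat_1[unfolded One_nat_def] del: of_nat_Suc)
      also have "\<dots> = v * ((\<Sum>k\<le>m. poly (hit_poly (m - k) 1) v) + (\<Sum>k\<le>m. poly (hit_poly k 1) v) + real (Suc m))"
        by (simp add: sum.distrib)
      also have "(\<Sum>k\<le>m. poly (hit_poly (m - k) 1) v) = (\<Sum>k\<le>m. poly (hit_poly k 1) v)"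
        using sum.nat_diff_reindex[of "\<lambda>k. poly (hit_poly k 1) v" "Suc m"] by (simp add: lessThan_Suc_atMost)
      also have "(\<Sum>k\<le>m. poly (hit_poly k 1) v) = (\<Sum>k\<le>m. B v k)"
        using less Suc by (intro sum.cong) auto
      finally have "real (Suc m) * poly (hit_poly (Suc m) 1) v = real (Suc m) * B v (Suc m)"
        unfolding B by simp
      then show ?thesis using Suc by simp
    qed (simp add: B_def)
  qed
  then have "poly (hit_poly n 1) = poly (\<Sum>k<n. pCons 0 (depth_poly k))"
    by (simp add: fun_eq_iff B_def poly_sum)
  then show ?thesis by (simp only: poly_eq_poly_eq_iff)
qed

text \<open>
  The polynomial is a mixture of products of \<open>p\<close> depth polynomials and a power of \<open>v\<close>; the last
  argument bounds the total cost.  The cost measures how far the components are from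
  \<open>p\<close> independent depths in trees of size \<open>N\<close>.
\<close>

inductive depth_mix :: "nat \<Rightarrow> nat \<Rightarrow> real poly \<Rightarrow> real \<Rightarrow> bool" for N p where
  atom: "\<lbrakk>a \<ge> 0; length ks = p; \<And>k. k \<in> set ks \<Longrightarrow> k < N\<rbrakk> \<Longrightarrow>
     depth_mix N p (smult a (monom 1 r * bern_poly (concat (map depth_params ks))))
       (a * (real r + (\<Sum>k\<leftarrow>ks. ln (real N / (real k + 1)))))"
| zero: "depth_mix N p 0 0"
| add: "\<lbrakk>depth_mix N p P c; depth_mix N p Q d\<rbrakk> \<Longrightarrow> depth_mix N p (P + Q) (c + d)"
| weaken: "\<lbrakk>depth_mix N p P c; c \<le> d\<rbrakk> \<Longrightarrow> depth_mix N p P d"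

lemma depth_mix_cong: "\<lbrakk>depth_mix N p P c; P = P'; c = c'\<rbrakk> \<Longrightarrow> depth_mix N p P' c'"
  by simp

lemma depth_mix_sum:
  assumes "\<And>i. i \<in> A \<Longrightarrow> depth_mix N p (P i) (c i)"
  shows "depth_mix N p (\<Sum>i\<in>A. P i) (\<Sum>i\<in>A. c i)"
  using assms by (induction A rule: infinite_finite_induct) (auto intro: depth_mix.intros)

lemma ln_ratio_nonneg: "k < N \<Longrightarrow> ln (real N / (real k + 1)) \<ge> 0"
  by (intro ln_ge_zero) (simp add: field_simps)

lemma sum_list_ln_ratio_nonneg:
  "(\<And>k. k \<in> set ks \<Longrightarrow> k < N) \<Longrightarrow> (\<Sum>k\<leftarrow>ks. ln (real N / (real k + 1))) \<ge> 0"
  by (intro sum_list_nonneg) (auto intro!: ln_ratio_nonneg)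

lemma poly_atom_1: "poly (smult a (monom 1 r * bern_poly qs)) 1 = a"
  by (simp add: poly_monom)

lemma depth_mix_nonneg: "depth_mix N p P c \<Longrightarrow> 0 \<le> poly P 1 \<and> 0 \<le> c"
proof (induction rule: depth_mix.induct)
  case (atom a ks r)
  then show ?case using sum_list_ln_ratio_nonneg[of ks N] by (simp add: poly_monom)
qed auto

lemma depth_mix_smult:
  "depth_mix N p P c \<Longrightarrow> b \<ge> 0 \<Longrightarrow> depth_mix N p (smult b P) (b * c)"
proof (induction rule: depth_mix.induct)
  case (atom a ks r)
  then show ?case using depth_mix.atom[of "b * a" ks p N r] by (simp add: mult.assoc)
next
  case (add P c Q d)
  then show ?case using depth_mix.add by (simp add: smult_add_right distrib_left)
next
  case (weaken P c d)
  then show ?case using depth_mix.weaken mult_left_mono by blast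
qed (auto intro: depth_mix.zero)

lemma depth_mix_pCons:
  "depth_mix N p P c \<Longrightarrow> depth_mix N p (pCons 0 P) (c + poly P 1)"
proof (induction rule: depth_mix.induct)
  case (atom a ks r)
  show ?case
    by (rule depth_mix_cong[OF depth_mix.atom[of a ks p N "Suc r"]])
       (use atom in \<open>simp_all add: poly_monom monom_Suc algebra_simps\<close>)
next
  case (add P c Q d)
  then show ?case
    using depth_mix.add[of N p "pCons 0 P" "c + poly P 1" "pCons 0 Q" "d + poly Q 1"]
    by (simp add: add_ac)
next
  case (weaken P c d)
  then show ?case using depth_mix.weaken[of N p "pCons 0 P" "c + poly P 1" "d + poly P 1"] by simp
qed (auto intro: depth_mix.zero)

text \<open>
  Passing to a larger reference size \<open>M\<close> increases each of the \<open>p\<close> logarithms by \<open>ln (M / N)\<close>.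
\<close>

lemma depth_mix_mono:
  "depth_mix N p P c \<Longrightarrow> N \<le> M \<Longrightarrow>
     depth_mix M p P (c + poly P 1 * (real p * ln (real M / real N)))"
proof (induction rule: depth_mix.induct)
  case (atom a ks r)
  have "(\<Sum>k\<leftarrow>ks. ln (real M / (real k + 1))) =
        (\<Sum>k\<leftarrow>ks. ln (real N / (real k + 1))) + real (length ks) * ln (real M / real N)"
    using atom(3,4)
  proof (induction ks)
    case (Cons k ks)
    have N: "0 < N" "0 < M" using Cons.prems(1)[of k] Cons.prems(2) by auto
    have "ln (real M / (real k + 1)) = ln (real N / (real k + 1)) + ln (real M / real N)"
      using N by (simp add: ln_div)
    then show ?case using Cons by (simp add: algebra_simps)
  qed simp
  moreover have "\<And>k. k \<in> set ks \<Longrightarrow> k < M" using atom by fastforce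
  ultimately show ?case
    using depth_mix.atom[of a ks p M r] atom by (simp add: poly_monom algebra_simps)
next
  case (add P c Q d)
  then show ?case using depth_mix.add[OF add.IH] by (simp add: algebra_simps)
next
  case (weaken P c d)
  then show ?case using depth_mix.weaken[OF weaken.IH] by simp
qed (auto intro: depth_mix.zero)

text \<open>
  Independent components: the weights multiply, and the costs add up weighted by the mass of the
  other factor.
\<close>

lemma depth_mix_mult:
  assumes "depth_mix N p P c" "depth_mix N q Q d"
  shows "depth_mix N (p + q) (P * Q) (c * poly Q 1 + poly P 1 * d)"
  using assms(1)
proof (induction rule: depth_mix.induct)
  case (atom a ks r)
  note atom1 = atom
  let ?A = "smult a (monom 1 r * bern_poly (concat (map depth_params ks)))"
  let ?c = "a * (real r + (\<Sum>k\<leftarrow>ks. ln (real N / (real k + 1))))"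
  have "depth_mix N (p + q) (?A * Q) (?c * poly Q 1 + a * d)"
    using assms(2)
  proof (induction rule: depth_mix.induct)
    case (atom b ls s)
    have "?A * smult b (monom 1 s * bern_poly (concat (map depth_params ls))) =
       smult (a * b) (monom 1 (r + s) * bern_poly (concat (map depth_params (ks @ ls))))"
    proof -
      have "monom 1 (r + s) = (monom 1 r * monom 1 s :: real poly)" by (simp add: mult_monom)
      then show ?thesis by (simp add: bern_poly_def mult_ac)
    qed
    moreover have "\<And>k. k \<in> set (ks @ ls) \<Longrightarrow> k < N" using atom atom1 by auto
    ultimately show ?case
      using depth_mix.atom[of "a * b" "ks @ ls" "p + q" N "r + s"] atom atom1
      by (simp add: poly_monom algebra_simps)
  next
    case (add P c Q d)
    show ?case
      by (rule depth_mix_cong[OF depth_mix.add[OF add.IH]])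
         (simp_all only: distrib_left distrib_right poly_add add_ac)
  next
    case (weaken P c d)
    then show ?case
      using depth_mix.weaken[OF weaken.IH, of "?c * poly P 1 + a * d"] \<open>a \<ge> 0\<close>
      by (simp add: mult_left_mono)
  qed (auto intro: depth_mix.zero)
  then show ?case by (simp add: poly_monom)
next
  case (add P c Q' d')
  show ?case
    by (rule depth_mix_cong[OF depth_mix.add[OF add.IH]]) (simp_all add: algebra_simps)
next
  case (weaken P c d')
  then show ?case
    using depth_mix.weaken[OF weaken.IH, of "d' * poly Q 1 + poly P 1 * d"] depth_mix_nonneg[OF assms(2)]
    by (simp add: mult_right_mono)
qed (auto intro: depth_mix.zero)

text \<open>
  A component with indices \<open>k\<^sub>1, \<dots>, k\<^sub>p\<close> has mean and variance \<open>2 \<Sum> ln (k\<^sub>i + 1) + O(p)\<close>, and its distance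
  from \<open>s\<^sup>2 = 2 p ln N\<close> is controlled by the cost.  The bound is linear in mass and cost and hence
  additive over the components.
\<close>

lemma depth_mix_normal_approx:
  assumes mix: "depth_mix N p P c" and s: "s \<ge> 1" "s\<^sup>2 = 2 * real p * ln (real N)"
  shows "\<bar>poly_exp P (\<lambda>k. of_bool (real k < y)) - poly P 1 * \<Phi> ((y - s\<^sup>2) / s)\<bar>
           \<le> (12 * (1 + 8 * real p) * poly P 1 + 48 * c) / s"
  using mix
proof (induction rule: depth_mix.induct)
  case (atom a ks r)
  let ?qs = "concat (map depth_params ks)"
  let ?S = "\<Sum>k\<leftarrow>ks. ln (real N / (real k + 1))"
  have qs: "bern_params ?qs"
    unfolding bern_params_def using bern_params_depth by (auto simp: bern_params_def)
  have S0: "?S \<ge> 0" using atom by (intro sum_list_ln_ratio_nonneg)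
  have "\<bar>sum_list ?qs + 2 * ?S - 2 * real (length ks) * ln (real N)\<bar> \<le> 2 * real (length ks) \<and>
        \<bar>bern_var ?qs - sum_list ?qs\<bar> \<le> 4 * real (length ks)"
    using atom(3)
  proof (induction ks)
    case (Cons k ks)
    have k: "k < N" using Cons.prems by simp
    have "ln (real k + 2) \<ge> ln (real k + 1)" by simp
    moreover have "ln (real N / (real k + 1)) = ln (real N) - ln (real k + 1)"
      using k by (simp add: ln_div)
    ultimately have "\<bar>sum_list (depth_params k) + 2 * ln (real N / (real k + 1)) - 2 * ln (real N)\<bar> \<le> 2"
      using sum_depth_params[of k] unfolding abs_le_iff by linarith
    moreover have "\<bar>sum_list (concat (map depth_params ks)) +
        2 * (\<Sum>k\<leftarrow>ks. ln (real N / (real k + 1))) - 2 * real (length ks) * ln (real N)\<bar> \<le> 2 * real (length ks)"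
      "\<bar>bern_var (concat (map depth_params ks)) - sum_list (concat (map depth_params ks))\<bar> \<le> 4 * real (length ks)"
      using Cons by auto
    moreover note bern_var_depth_params[of k]
    ultimately show ?case unfolding abs_le_iff by (simp add: algebra_simps)
  qed simp
  then have D: "\<bar>real r + sum_list ?qs - s\<^sup>2\<bar> + \<bar>bern_var ?qs - s\<^sup>2\<bar> \<le> 8 * real p + 4 * (real r + ?S)"
    unfolding s(2) using S0 atom(2) by (simp add: abs_le_iff) linarith
  have "\<bar>bern_exp ?qs (\<lambda>k. of_bool (real r + real k < y)) - \<Phi> ((y - s\<^sup>2) / s)\<bar>
      \<le> 12 * (1 + (8 * real p + 4 * (real r + ?S))) / s"
    by (rule bernoulli_berry_esseen[OF qs s(1) D])
  then have "a * \<bar>bern_exp ?qs (\<lambda>k. of_bool (real r + real k < y)) - \<Phi> ((y - s\<^sup>2) / s)\<bar>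
      \<le> a * (12 * (1 + (8 * real p + 4 * (real r + ?S))) / s)"
    using atom(1) by (intro mult_left_mono)
  moreover have "poly_exp (smult a (monom 1 r * bern_poly ?qs)) (\<lambda>k. of_bool (real k < y)) =
      a * bern_exp ?qs (\<lambda>k. of_bool (real r + real k < y))"
    by (simp add: poly_exp_smult poly_exp_monom_mult poly_exp_bern_poly)
  moreover have "a * (12 * (1 + (8 * real p + 4 * (real r + ?S))) / s) =
      (12 * (1 + 8 * real p) * a + 48 * (a * (real r + ?S))) / s"
    by (simp add: algebra_simps)
  moreover have "\<bar>a * e - a * f\<bar> = a * \<bar>e - f\<bar>" for e f
    using atom(1) by (simp add: abs_mult flip: right_diff_distrib)
  ultimately show ?case unfolding poly_atom_1 by metis
next
  case (add P c Q d)
  let ?h = "\<lambda>k. of_bool (real k < y)" and ?F = "\<Phi> ((y - s\<^sup>2) / s)"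
  have "poly_exp (P + Q) ?h - poly (P + Q) 1 * ?F =
     (poly_exp P ?h - poly P 1 * ?F) + (poly_exp Q ?h - poly Q 1 * ?F)"
    by (simp add: poly_exp_add algebra_simps)
  also have "\<bar>\<dots>\<bar> \<le> (12 * (1 + 8 * real p) * poly P 1 + 48 * c) / s + (12 * (1 + 8 * real p) * poly Q 1 + 48 * d) / s"
    by (rule order_trans[OF abs_triangle_ineq add_mono[OF add.IH]])
  also have "\<dots> = (12 * (1 + 8 * real p) * poly (P + Q) 1 + 48 * (c + d)) / s"
    by (simp add: add_divide_distrib[symmetric] algebra_simps)
  finally show ?case .
next
  case (weaken P c d)
  have "(12 * (1 + 8 * real p) * poly P 1 + 48 * c) / s \<le> (12 * (1 + 8 * real p) * poly P 1 + 48 * d) / s"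
    using s weaken by (intro divide_right_mono) auto
  then show ?case using weaken by linarith
qed (use s in simp)

lemma power_sum_le: "real (Suc p) * (\<Sum>k<n. real k ^ p) \<le> real n ^ Suc p"
proof -
  have step: "x ^ Suc p + real (Suc p) * x ^ p \<le> (x + 1) ^ Suc p" if "x \<ge> 0" for x :: real and p
  proof (induction p)
    case (Suc p)
    have "x ^ Suc (Suc p) + real (Suc (Suc p)) * x ^ Suc p \<le> (x + 1) * (x ^ Suc p + real (Suc p) * x ^ p)"
      using that by (simp add: algebra_simps)
    also have "\<dots> \<le> (x + 1) * (x + 1) ^ Suc p" using Suc that by (intro mult_left_mono) auto
    finally show ?case by simp
  qed simp
  show ?thesis
  proof (induction n)
    case (Suc n)
    then show ?case using step[of "real n" p] by (simp add: algebra_simps)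
  qed simp
qed

text \<open>
  This keeps the increase of the logarithms harmless: small subtrees have large \<open>ln (N / k)\<close> but
  few subsets.
\<close>

lemma power_ln_ratio_le:
  assumes "k \<le> N" "i \<ge> 1" shows "real k ^ i * ln (real N / real k) \<le> real N ^ i"
proof (cases "k = 0")
  case False
  then have k: "real k > 0" "real N > 0" using assms by auto
  have "real k ^ i * ln (real N / real k) \<le> real k ^ i * (real N / real k - 1)"
    using k by (intro mult_left_mono ln_le_minus_one) auto
  also have "\<dots> \<le> real k ^ i * (real N / real k)" by (intro mult_left_mono) auto
  also have "\<dots> = real k ^ (i - 1) * real N"
    using k assms(2) by (cases i) auto
  also have "\<dots> \<le> real N ^ (i - 1) * real N"
    using assms by (intro mult_right_mono power_mono) auto
  also have "\<dots> = real N ^ i" using assms(2) by (cases i) auto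
  finally show ?thesis .
qed (use assms in auto)

lemma binomial_le_power_real: "real (n choose p) \<le> real n ^ p"
  using binomial_le_pow[of p n]
  by (cases "p \<le> n") (auto simp: binomial_eq_0 simp flip: of_nat_power intro: of_nat_mono)

lemma depth_mix_hit_poly_mono:
  assumes "depth_mix k i (hit_poly k i) (K * real k ^ i)" "k \<le> N" "K \<ge> 0"
  shows "depth_mix N i (hit_poly k i) ((K + real i) * real N ^ i)"
proof (rule depth_mix.weaken[OF depth_mix_mono[OF assms(1,2)]])
  have "K * real k ^ i \<le> K * real N ^ i" using assms by (intro mult_left_mono power_mono) auto
  moreover have "poly (hit_poly k i) 1 * (real i * ln (real N / real k)) \<le> real i * real N ^ i"
  proof (cases "i = 0 \<or> k = 0")
    case False
    then have "ln (real N / real k) \<ge> 0" using assms by (intro ln_ge_zero) (simp add: field_simps)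
    then have "poly (hit_poly k i) 1 * (real i * ln (real N / real k)) \<le> real k ^ i * (real i * ln (real N / real k))"
      unfolding poly_hit_poly_1 using binomial_le_power_real by (intro mult_right_mono) auto
    also have "\<dots> \<le> real i * real N ^ i"
      using power_ln_ratio_le[OF assms(2), of i] False
      by (simp add: mult.left_commute mult_left_mono)
    finally show ?thesis .
  qed auto
  ultimately show "K * real k ^ i + poly (hit_poly k i) 1 * (real i * ln (real N / real k)) \<le> (K + real i) * real N ^ i"
    by (simp add: algebra_simps)
qed

text \<open>
  The contribution of those configurations in which the root is chosen or chosen nodes lie on both
  sides of it.  It involves only subsets with fewer than \<open>p\<close> elements and occurs alike in the
  recurrences of \<open>hit_poly\<close> and \<open>span_poly\<close>.
\<close>

definition branch_poly :: "nat \<Rightarrow> nat \<Rightarrow> real poly" where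
  "branch_poly n p = pCons 0 (\<Sum>k\<le>n.
     (\<Sum>i\<in>{1..<p}. hit_poly k i * hit_poly (n - k) (p - i)) +
     (\<Sum>i<p. hit_poly k i * hit_poly (n - k) (p - 1 - i)))"

text \<open>
  All products have \<open>p\<close> depth factors when the root is not chosen.  If it is chosen, only \<open>p - 1\<close> are
  left, and the trivial factor \<open>U\<^sub>0 = 1\<close> of cost \<open>ln (n + 1)\<close> is added; there are fewer such subsets by a
  factor of order \<open>n\<close>, which compensates the logarithm.
\<close>

lemma depth_mix_branch_poly:
  assumes p: "p \<ge> 2" and K: "K \<ge> 0"
    and hit: "\<And>i k. i < p \<Longrightarrow> depth_mix k i (hit_poly k i) (K * real k ^ i)"
  shows "depth_mix (Suc n) p (branch_poly n p) (2 * real p * (2 * (K + real p) + 2) * real (Suc n) ^ Suc p)"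
proof -
  define N where "N = Suc n"
  define x where "x = real N"
  define L where "L = K + real p"
  have x: "x \<ge> 1" "x \<ge> 0" by (auto simp: x_def N_def)
  have w: "poly (hit_poly k i) 1 \<le> x ^ i" if "k \<le> n" for k i
  proof -
    have "real k ^ i \<le> x ^ i" using that by (intro power_mono) (auto simp: x_def N_def)
    then show ?thesis unfolding poly_hit_poly_1 by (rule order_trans[OF binomial_le_power_real])
  qed
  have w0: "poly (hit_poly k i) 1 \<ge> 0" for k i by (simp add: poly_hit_poly_1)
  have L: "L \<ge> 0" using K by (simp add: L_def)
  have h: "depth_mix N i (hit_poly k i) (L * x ^ i)" if "i < p" "k \<le> n" for i k
  proof (rule depth_mix.weaken[OF depth_mix_hit_poly_mono[OF hit[OF that(1)] _ K]])
    show "k \<le> N" using that by (simp add: N_def)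
    show "(K + real i) * real N ^ i \<le> L * x ^ i"
      using that by (intro mult_mono) (auto simp: L_def x_def K)
  qed
  have prod: "depth_mix N (i + j) (hit_poly k i * hit_poly (n - k) j) (2 * L * x ^ (i + j))"
    if "i < p" "j < p" "k \<le> n" for i j k
  proof (rule depth_mix.weaken[OF depth_mix_mult[OF h h]])
    have "L * x ^ i * poly (hit_poly (n - k) j) 1 \<le> L * x ^ i * x ^ j"
      using w[of "n - k" j] L x by (intro mult_left_mono) auto
    moreover have "poly (hit_poly k i) 1 * (L * x ^ j) \<le> x ^ i * (L * x ^ j)"
      using w[OF that(3), of i] L x by (intro mult_right_mono) auto
    ultimately show "L * x ^ i * poly (hit_poly (n - k) j) 1 + poly (hit_poly k i) 1 * (L * x ^ j) \<le> 2 * L * x ^ (i + j)"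
      by (simp add: power_add algebra_simps)
  qed (use that in auto)
  have wprod: "poly (hit_poly k i * hit_poly (n - k) j) 1 \<le> x ^ (i + j)" if "k \<le> n" for i j k
    unfolding poly_mult power_add using that w w0 x by (intro mult_mono) auto
  have t1: "depth_mix N p (hit_poly k i * hit_poly (n - k) (p - i)) ((2 * L + 1) * x ^ p)"
    if "i \<in> {1..<p}" "k \<le> n" for i k
    using prod[of i "p - i" k] that x
    by (auto elim!: depth_mix.weaken simp: distrib_right)
  \<comment> \<open>The factor \<open>U\<^sub>0 = 1\<close> that stands for the chosen root.\<close>
  have single: "depth_mix N 1 1 (ln x)"
    using depth_mix.atom[of 1 "[0]" 1 N 0] by (simp add: bern_poly_def x_def N_def monom_0 one_pCons[symmetric])
  have t2: "depth_mix N p (hit_poly k i * hit_poly (n - k) (p - 1 - i)) ((2 * L + 1) * x ^ p)"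
    if "i < p" "k \<le> n" for i k
  proof -
    have *: "depth_mix N (p - 1 + 1) (hit_poly k i * hit_poly (n - k) (p - 1 - i) * 1)
        (2 * L * x ^ (p - 1) * poly 1 1 + poly (hit_poly k i * hit_poly (n - k) (p - 1 - i)) 1 * ln x)"
      using prod[of i "p - 1 - i" k] that p by (intro depth_mix_mult[OF _ single]) auto
    have xp: "x ^ p = x ^ (p - 1) * x" using p by (cases p) auto
    have "2 * L * x ^ (p - 1) \<le> 2 * L * x ^ p"
      using x L by (intro mult_left_mono power_increasing) auto
    moreover have "poly (hit_poly k i * hit_poly (n - k) (p - 1 - i)) 1 * ln x \<le> x ^ (p - 1) * x"
      using wprod[OF that(2), of i "p - 1 - i"] that x ln_le_minus_one[of x] w0
      by (intro mult_mono) auto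
    ultimately have "2 * L * x ^ (p - 1) * poly 1 1 + poly (hit_poly k i * hit_poly (n - k) (p - 1 - i)) 1 * ln x
        \<le> (2 * L + 1) * x ^ p" by (simp add: xp algebra_simps)
    then show ?thesis using depth_mix.weaken[OF *] p by simp
  qed
  let ?S = "\<Sum>k\<le>n. (\<Sum>i\<in>{1..<p}. hit_poly k i * hit_poly (n - k) (p - i)) +
     (\<Sum>i<p. hit_poly k i * hit_poly (n - k) (p - 1 - i))"
  have "depth_mix N p ?S (\<Sum>k\<le>n. (\<Sum>i\<in>{1..<p}. (2 * L + 1) * x ^ p) + (\<Sum>i<p. (2 * L + 1) * x ^ p))"
    using t1 t2 by (intro depth_mix_sum depth_mix.add) auto
  from depth_mix_pCons[OF this]
  have "depth_mix N p (branch_poly n p)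
     ((\<Sum>k\<le>n. (\<Sum>i\<in>{1..<p}. (2 * L + 1) * x ^ p) + (\<Sum>i<p. (2 * L + 1) * x ^ p)) + poly ?S 1)"
    by (simp add: branch_poly_def)
  then show ?thesis
    unfolding N_def[symmetric]
  proof (rule depth_mix.weaken)
    have "poly ?S 1 \<le> (\<Sum>k\<le>n. (\<Sum>i\<in>{1..<p}. x ^ p) + (\<Sum>i<p. x ^ p))"
    proof -
      have "poly (hit_poly k i * hit_poly (n - k) (p - i)) 1 \<le> x ^ p" if "k \<le> n" "i \<in> {1..<p}" for k i
        using wprod[OF that(1), of i "p - i"] that by auto
      moreover have "poly (hit_poly k i * hit_poly (n - k) (p - 1 - i)) 1 \<le> x ^ p" if "k \<le> n" "i < p" for k i
      proof -
        have "x ^ (p - 1) \<le> x ^ p" using x by (intro power_increasing) auto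
        then show ?thesis using wprod[OF that(1), of i "p - 1 - i"] that by auto
      qed
      ultimately show ?thesis
        unfolding poly_sum poly_add by (intro sum_mono add_mono) auto
    qed
    also have "\<dots> = x * ((2 * real p - 1) * x ^ p)"
      using p by (simp add: x_def N_def algebra_simps of_nat_diff)
    finally have "(\<Sum>k\<le>n. (\<Sum>i\<in>{1..<p}. (2 * L + 1) * x ^ p) + (\<Sum>i<p. (2 * L + 1) * x ^ p)) + poly ?S 1 \<le>
        x * ((2 * real p - 1) * ((2 * L + 1) * x ^ p)) + x * ((2 * real p - 1) * x ^ p)"
      using p by (simp add: x_def N_def algebra_simps of_nat_diff)
    also have "\<dots> = (2 * real p - 1) * (2 * L + 2) * x ^ Suc p" by (simp add: algebra_simps)
    also have "\<dots> \<le> 2 * real p * (2 * L + 2) * x ^ Suc p"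
      using L x by (intro mult_right_mono) auto
    finally show "(\<Sum>k\<le>n. (\<Sum>i\<in>{1..<p}. (2 * L + 1) * x ^ p) + (\<Sum>i<p. (2 * L + 1) * x ^ p)) + poly ?S 1
        \<le> 2 * real p * (2 * (K + real p) + 2) * real N ^ Suc p"
      by (simp add: L_def x_def)
  qed
qed

section \<open>The central limit theorem with rate\<close>

text \<open>
  With cost at most \<open>K k\<^sup>p\<close> for smaller sizes, the recurrence produces the cost
  \<open>(2 K / (p + 1) + O(1)) n\<^sup>p\<close>.  Since \<open>p \<ge> 2\<close>, the factor of \<open>K\<close> is less than 1 and the induction closes.
  The function \<open>g\<close> is the identity for the spanning tree and the multiplication by \<open>v\<close> for the nodes
  that are hit.
\<close>

lemma depth_mix_recurrence:
  fixes g :: "real poly \<Rightarrow> real poly"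
  assumes p: "p \<ge> 2" and B: "B \<ge> 0" and P0: "P 0 = 0"
    and rec: "\<And>n. smult (real (Suc n)) (P (Suc n)) = smult 2 (\<Sum>k\<le>n. g (P k)) + R n"
    and g: "\<And>N Q c. depth_mix N p Q c \<Longrightarrow> depth_mix N p (g Q) (c + poly Q 1)"
    and R: "\<And>n. depth_mix (Suc n) p (R n) (B * real (Suc n) ^ Suc p)"
    and w: "\<And>n. poly (P n) 1 \<le> real n ^ p"
  shows "\<exists>K\<ge>0. \<forall>n. depth_mix n p (P n) (K * real n ^ p)"
proof -
  \<comment> \<open>the fixed point of the cost recurrence\<close>
  define K where "K = (2 + 2 * real p + B) * (real p + 1) / (real p - 1)"
  have K: "K \<ge> 0" using p B by (simp add: K_def)
  have Kfix: "2 * K / (real p + 1) + (2 + 2 * real p + B) = K"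
  proof -
    have "K * (real p - 1) = (2 + 2 * real p + B) * (real p + 1)" using p by (simp add: K_def)
    then show ?thesis using p by (simp add: field_simps)
  qed
  have "depth_mix n p (P n) (K * real n ^ p)" for n
  proof (induction n rule: less_induct)
    case (less n)
    show ?case
    proof (cases n)
      case 0
      then show ?thesis using P0 p depth_mix.zero[of 0 p] by (simp add: zero_power)
    next
      case (Suc m)
      have term_mix: "depth_mix n p (g (P k)) (K * real k ^ p + (real p + 1) * real n ^ p)" if k: "k \<le> m" for k
      proof (rule depth_mix.weaken[OF g[OF depth_mix_mono[OF less]]])
        have kn: "k \<le> n" "k < n" using k Suc by auto
        then show "k \<le> n" "k < n" by auto
        have "poly (P k) 1 * (real p * ln (real n / real k)) \<le> real p * real n ^ p"
        proof (cases "k = 0")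
          case False
          then have "ln (real n / real k) \<ge> 0" using kn by (intro ln_ge_zero) (simp add: field_simps)
          then have "poly (P k) 1 * (real p * ln (real n / real k)) \<le> real k ^ p * (real p * ln (real n / real k))"
            using w by (intro mult_right_mono) auto
          also have "\<dots> \<le> real p * real n ^ p"
            using power_ln_ratio_le[OF kn(1), of p] p by (simp add: mult.left_commute mult_left_mono)
          finally show ?thesis .
        qed auto
        moreover have "poly (P k) 1 \<le> real n ^ p"
          using w[of k] power_mono[of "real k" "real n" p] kn by simp
        ultimately show "K * real k ^ p + poly (P k) 1 * (real p * ln (real n / real k)) + poly (P k) 1
            \<le> K * real k ^ p + (real p + 1) * real n ^ p"
          by (simp add: algebra_simps)
      qed
      have A: "depth_mix n p (smult (1 / real n) (smult 2 (\<Sum>k\<le>m. g (P k)) + R m))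
          (1 / real n * (2 * (\<Sum>k\<le>m. K * real k ^ p + (real p + 1) * real n ^ p) + B * real n ^ Suc p))"
        using R[of m] term_mix unfolding Suc[symmetric]
        by (intro depth_mix_smult depth_mix.add depth_mix_sum) auto
      have eq: "smult (1 / real n) (smult 2 (\<Sum>k\<le>m. g (P k)) + R m) = P n"
        unfolding rec[of m, symmetric] using Suc by simp
      have le: "1 / real n * (2 * (\<Sum>k\<le>m. K * real k ^ p + (real p + 1) * real n ^ p) + B * real n ^ Suc p)
          \<le> K * real n ^ p"
      proof -
        have "(\<Sum>k\<le>m. real k ^ p) \<le> real n ^ Suc p / (real p + 1)"
          using power_sum_le[of p n] Suc by (simp add: lessThan_Suc_atMost field_simps)
        then have "K * (\<Sum>k\<le>m. real k ^ p) \<le> K * (real n ^ Suc p / (real p + 1))"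
          using K by (intro mult_left_mono)
        moreover have "(\<Sum>k\<le>m. K * real k ^ p + (real p + 1) * real n ^ p) =
            K * (\<Sum>k\<le>m. real k ^ p) + (real p + 1) * real n ^ Suc p"
          using Suc by (simp add: sum.distrib sum_distrib_left)
        ultimately have "2 * (\<Sum>k\<le>m. K * real k ^ p + (real p + 1) * real n ^ p) + B * real n ^ Suc p
            \<le> (2 * K / (real p + 1) + (2 + 2 * real p + B)) * real n ^ Suc p"
          by (simp add: distrib_right)
        also have "\<dots> = real n * (K * real n ^ p)" unfolding Kfix by simp
        finally show ?thesis using Suc by (simp add: divide_le_eq mult.commute)
      qed
      show ?thesis using depth_mix.weaken[OF A le] unfolding eq .
    qed
  qed
  then show ?thesis using K by blast
qed

lemma hit_poly_branch:
  assumes "p \<ge> 1"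
  shows "smult (real (Suc n)) (hit_poly (Suc n) p) = smult 2 (\<Sum>k\<le>n. pCons 0 (hit_poly k p)) + branch_poly n p"
proof -
  have "{..p} = insert 0 (insert p {1..<p})" using assms by auto
  then have ends: "(\<Sum>i\<le>p. hit_poly k i * hit_poly (n - k) (p - i)) =
     (hit_poly (n - k) p + hit_poly k p) + (\<Sum>i\<in>{1..<p}. hit_poly k i * hit_poly (n - k) (p - i))" for k
    using assms by (simp add: add.assoc)
  have "smult (real (Suc n)) (hit_poly (Suc n) p) = pCons 0 (\<Sum>k\<le>n.
       (\<Sum>i\<le>p. hit_poly k i * hit_poly (n - k) (p - i)) +
       (\<Sum>i<p. hit_poly k i * hit_poly (n - k) (p - 1 - i)))"
    using assms by (simp add: hit_poly.simps del: of_nat_Suc)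
  also have "\<dots> = pCons 0 ((\<Sum>k\<le>n. hit_poly (n - k) p) + (\<Sum>k\<le>n. hit_poly k p)) + branch_poly n p"
    unfolding branch_poly_def ends by (simp only: sum.distrib add.assoc add_pCons add_0_left)
  also have "(\<Sum>k\<le>n. hit_poly (n - k) p) = (\<Sum>k\<le>n. hit_poly k p)"
    using sum.nat_diff_reindex[of "\<lambda>k. hit_poly k p" "Suc n"] by (simp add: lessThan_Suc_atMost)
  also have "pCons 0 ((\<Sum>k\<le>n. hit_poly k p) + (\<Sum>k\<le>n. hit_poly k p)) = smult 2 (\<Sum>k\<le>n. pCons 0 (hit_poly k p))"
    by (intro poly_eq_poly_eq_iff[THEN iffD1] ext) (simp add: poly_sum sum_distrib_left algebra_simps)
  finally show ?thesis .
qed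

lemma span_poly_branch:
  assumes "p \<ge> 1"
  shows "smult (real (Suc n)) (span_poly (Suc n) p) = smult 2 (\<Sum>k\<le>n. span_poly k p) + branch_poly n p"
proof -
  have "smult (real (Suc n)) (span_poly (Suc n) p) =
      smult (real (Suc n)) (hit_poly (Suc n) p) + smult 2 (\<Sum>k\<le>n. span_poly k p - pCons 0 (hit_poly k p))"
    by (simp add: span_poly.simps smult_add_right del: of_nat_Suc)
  then show ?thesis
    unfolding hit_poly_branch[OF assms] sum_subtractf smult_diff_right by simp
qed

lemma uniform_depth_mix_const:
  assumes "\<And>i. i < p \<Longrightarrow> \<exists>K\<ge>0. \<forall>n. depth_mix n i (hit_poly n i) (K * real n ^ i)"
  shows "\<exists>K\<ge>0. \<forall>i<p. \<forall>n. depth_mix n i (hit_poly n i) (K * real n ^ i)"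
proof -
  have "\<forall>i. \<exists>K. i < p \<longrightarrow> K \<ge> 0 \<and> (\<forall>n. depth_mix n i (hit_poly n i) (K * real n ^ i))"
    using assms by blast
  from choice[OF this] obtain F
    where F: "\<And>i. i < p \<Longrightarrow> F i \<ge> 0 \<and> (\<forall>n. depth_mix n i (hit_poly n i) (F i * real n ^ i))"
    by blast
  have "depth_mix n i (hit_poly n i) ((\<Sum>i<p. F i) * real n ^ i)" if "i < p" for i n
  proof (rule depth_mix.weaken)
    show "depth_mix n i (hit_poly n i) (F i * real n ^ i)" using F that by blast
    have "F i \<le> (\<Sum>i<p. F i)" using F that by (intro member_le_sum) auto
    then show "F i * real n ^ i \<le> (\<Sum>i<p. F i) * real n ^ i" by (intro mult_right_mono) auto
  qed
  moreover have "(\<Sum>i<p. F i) \<ge> 0" using F by (intro sum_nonneg) auto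
  ultimately show ?thesis by blast
qed

lemma hit_poly_depth_mix: "\<exists>K\<ge>0. \<forall>n. depth_mix n p (hit_poly n p) (K * real n ^ p)"
proof (induction p rule: less_induct)
  case (less p)
  consider "p = 0" | "p = 1" | "p \<ge> 2" by linarith
  then show ?case
  proof cases
    case 1
    have "depth_mix n 0 1 0" for n
      using depth_mix.atom[of 1 "[]" 0 n 0] by (simp add: bern_poly_def monom_0 one_pCons[symmetric])
    then show ?thesis using 1 by (intro exI[of _ 0]) simp
  next
    case 2
    have "depth_mix n 1 (hit_poly n 1) (2 * real n ^ 1)" for n
    proof -
      have "depth_mix n 1 (hit_poly n 1) (\<Sum>k<n. 1 + ln (real n / (real k + 1)))"
        unfolding hit_poly_1
      proof (rule depth_mix_sum)
        fix k assume "k \<in> {..<n}"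
        then show "depth_mix n 1 (pCons 0 (depth_poly k)) (1 + ln (real n / (real k + 1)))"
          using depth_mix.atom[of 1 "[k]" 1 n 1] by (simp add: monom_Suc monom_0 one_pCons[symmetric])
      qed
      moreover have "(\<Sum>k<n. ln (real n / (real k + 1))) \<le> real n"
      proof (induction n)
        case (Suc n)
        have "(\<Sum>k<Suc n. ln (real (Suc n) / (real k + 1))) = (\<Sum>k<n. ln (real (Suc n) / (real k + 1)))"
          by simp
        also have "\<dots> = (\<Sum>k<n. ln (real n / (real k + 1)) + ln (real (Suc n) / real n))"
          by (intro sum.cong refl) (auto simp: ln_div)
        also have "\<dots> = (\<Sum>k<n. ln (real n / (real k + 1))) + real n * ln (real (Suc n) / real n)"
          by (simp add: sum.distrib)
        also have "real n * ln (real (Suc n) / real n) \<le> 1"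
        proof (cases "n = 0")
          case False
          then have "real n * ln (real (Suc n) / real n) \<le> real n * (real (Suc n) / real n - 1)"
            by (intro mult_left_mono ln_le_minus_one) auto
          also have "\<dots> = 1" using False by (simp add: field_simps)
          finally show ?thesis .
        qed simp
        finally show ?case using Suc by simp
      qed simp
      ultimately show ?thesis by (elim depth_mix.weaken) (simp add: sum.distrib)
    qed
    then show ?thesis using 2 by (intro exI[of _ 2]) auto
  next
    case 3
    from uniform_depth_mix_const[of p, OF less] obtain K where K: "K \<ge> 0"
      and hit: "\<forall>i<p. \<forall>n. depth_mix n i (hit_poly n i) (K * real n ^ i)" by auto
    note branch = depth_mix_branch_poly[OF 3 K hit[rule_format]]
    show ?thesis
    proof (rule depth_mix_recurrence[OF 3 _ _ hit_poly_branch depth_mix_pCons branch])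
      show "2 * real p * (2 * (K + real p) + 2) \<ge> 0" using K by simp
      show "poly (hit_poly n p) 1 \<le> real n ^ p" for n
        unfolding poly_hit_poly_1 by (rule binomial_le_power_real)
    qed (use 3 in auto)
  qed
qed

lemma span_poly_depth_mix:
  assumes p: "p \<ge> 2"
  shows "\<exists>K\<ge>0. \<forall>n. depth_mix n p (span_poly n p) (K * real n ^ p)"
proof -
  from uniform_depth_mix_const[OF hit_poly_depth_mix, of p] obtain K where K: "K \<ge> 0"
    and hit: "\<forall>i<p. \<forall>n. depth_mix n i (hit_poly n i) (K * real n ^ i)" by auto
  note branch = depth_mix_branch_poly[OF p K hit[rule_format]]
  show ?thesis
  proof (rule depth_mix_recurrence[where g = "\<lambda>P. P", OF p _ _ span_poly_branch _ branch])
    show "2 * real p * (2 * (K + real p) + 2) \<ge> 0" using K by simp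
    show "depth_mix N p Q c \<Longrightarrow> depth_mix N p Q (c + poly Q 1)" for N Q c
      using depth_mix.weaken[of N p Q c "c + poly Q 1"] depth_mix_nonneg[of N p Q c] by simp
    show "poly (span_poly n p) 1 \<le> real n ^ p" for n
      using binomial_le_power_real[of n p] poly_span_poly_1[of p n] p by simp
  qed (use p in auto)
qed

lemma expectation_finite_sum:
  fixes g :: "'a \<Rightarrow> real"
  shows "finite (set_pmf M) \<Longrightarrow> measure_pmf.expectation M g = (\<Sum>t\<in>set_pmf M. pmf M t * g t)"
  by (subst integral_measure_pmf[of "set_pmf M"]) (auto simp: set_pmf_iff)

lemma expectation_pair_pmf_of_set:
  fixes f :: "'a \<times> 'b \<Rightarrow> real"
  assumes "finite (set_pmf M)" "finite X" "X \<noteq> {}"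
  shows "measure_pmf.expectation (pair_pmf M (pmf_of_set X)) f =
           (\<Sum>S\<in>X. measure_pmf.expectation M (\<lambda>t. f (t, S))) / real (card X)"
proof -
  have "measure_pmf.expectation (pair_pmf M (pmf_of_set X)) f =
      (\<Sum>z\<in>set_pmf M \<times> X. pmf M (fst z) * f z / real (card X))"
    using assms by (subst integral_measure_pmf[of "set_pmf M \<times> X"])
      (auto simp: pmf_pair case_prod_unfold pmf_of_set[OF assms(3,2)] intro!: sum.cong)
  also have "\<dots> = (\<Sum>S\<in>X. \<Sum>t\<in>set_pmf M. pmf M t * f (t, S) / real (card X))"
    by (subst sum.swap) (simp add: sum.cartesian_product case_prod_unfold)
  also have "\<dots> = (\<Sum>S\<in>X. measure_pmf.expectation M (\<lambda>t. f (t, S))) / real (card X)"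
    using assms by (simp add: expectation_finite_sum sum_divide_distrib)
  finally show ?thesis .
qed

lemma poly_exp_monom: "poly_exp (monom c k) h = c * h k"
  using poly_exp_smult[of c "monom 1 k * 1" h] poly_exp_monom_mult[of k 1 h]
  by (simp add: smult_monom poly_exp_def)

lemma poly_exp_sum: "poly_exp (\<Sum>i\<in>A. P i) h = (\<Sum>i\<in>A. poly_exp (P i) h)"
  by (induction A rule: infinite_finite_induct) (simp_all add: poly_exp_add)

lemma subsets_card_nonempty:
  assumes "p \<le> n" shows "subsets_card {1..n} p \<noteq> {}"
proof -
  have "card (subsets_card {1..n} p) > 0" using assms by (simp add: card_subsets_card)
  then show ?thesis by (metis card.empty less_irrefl)
qed

lemma Y_pmf_altdef:
  "Y_pmf n p = map_pmf (\<lambda>(t, S). spanning_tree_size t S)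
     (pair_pmf (random_bst_on {1..n}) (pmf_of_set (subsets_card {1..n} p)))"
  by (simp add: Y_pmf_def random_bst_def random_bst_on_def subsets_card_def)

lemma finite_set_Y_pmf: "p \<le> n \<Longrightarrow> finite (set_pmf (Y_pmf n p))"
  using subsets_card_nonempty[of p n] by (simp add: Y_pmf_altdef)

lemma pgf_Y_pmf:
  assumes "p \<ge> 1" "p \<le> n"
  shows "measure_pmf.expectation (Y_pmf n p) (\<lambda>y. v ^ y) = poly (span_poly n p) v / real (n choose p)"
proof -
  have "measure_pmf.expectation (Y_pmf n p) (\<lambda>y. v ^ y) =
      (\<Sum>S\<in>subsets_card {1..n} p. measure_pmf.expectation (random_bst_on {1..n})
         (\<lambda>t. v ^ spanning_tree_size t S)) / real (n choose p)"
    unfolding Y_pmf_altdef using subsets_card_nonempty[OF assms(2)]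
    by (simp add: expectation_pair_pmf_of_set card_subsets_card case_prod_unfold)
  also have "(\<Sum>S\<in>subsets_card {1..n} p. measure_pmf.expectation (random_bst_on {1..n})
         (\<lambda>t. v ^ spanning_tree_size t S)) = (\<Sum>S\<in>subsets_card {1..n} p. span_pgf {1..n} v S)"
    unfolding span_pgf_def
  proof (intro sum.cong refl expectation_set_pmf_cong)
    fix S t assume S: "S \<in> subsets_card {1..n} p" and t: "t \<in> set_pmf (random_bst_on {1..n})"
    have "bst t" "set_tree t = {1..n}" using set_random_bst_on[OF _ t] by auto
    moreover have "S \<subseteq> {1..n}" "S \<noteq> {}" using S assms by (auto simp: subsets_card_def)
    ultimately show "v ^ spanning_tree_size t S = v ^ span_size t S"
      by (simp add: spanning_tree_size_eq_span_size)
  qed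
  also have "\<dots> = poly (span_poly n p) v" using sum_span_pgf[of "{1..n}" p v] assms by simp
  finally show ?thesis .
qed

text \<open>
  Two finitely supported laws with the same probability generating function agree.
\<close>

lemma expectation_Y_pmf:
  fixes h :: "nat \<Rightarrow> real"
  assumes "p \<ge> 1" "p \<le> n"
  shows "measure_pmf.expectation (Y_pmf n p) h = poly_exp (span_poly n p) h / real (n choose p)"
proof -
  let ?M = "Y_pmf n p"
  define Q where "Q = (\<Sum>y\<in>set_pmf ?M. monom (pmf ?M y) y)"
  have fin: "finite (set_pmf ?M)" by (rule finite_set_Y_pmf[OF assms(2)])
  note E = expectation_finite_sum[OF fin]
  have "poly Q v = poly (smult (1 / real (n choose p)) (span_poly n p)) v" for v
    using pgf_Y_pmf[OF assms, of v] E[of "\<lambda>y. v ^ y"] by (simp add: Q_def poly_sum poly_monom)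
  then have "Q = smult (1 / real (n choose p)) (span_poly n p)"
    by (intro poly_eq_poly_eq_iff[THEN iffD1] ext)
  then have "poly_exp Q h = poly_exp (span_poly n p) h / real (n choose p)"
    by (simp add: poly_exp_smult)
  moreover have "poly_exp Q h = measure_pmf.expectation ?M h"
    by (simp add: E Q_def poly_exp_sum poly_exp_monom)
  ultimately show ?thesis by simp
qed

text \<open>
  The average cost of a component is at most \<open>K n\<^sup>p\<close> divided by the number of \<open>p\<close>-subsets, which is
  bounded.
\<close>

theorem Y_pmf_berry_esseen:
  assumes p: "p \<ge> 2"
  shows "\<exists>C. \<forall>\<^sub>F n in sequentially. \<forall>x::real.
        \<bar>measure_pmf.prob (Y_pmf n p)
            {y. (real y - 2 * real p * ln (real n)) / sqrt (2 * real p * ln (real n)) < x}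
          - cdf std_normal_distribution x\<bar> \<le> C * (1 / sqrt (ln (real n)))"
proof -
  obtain K where K: "K \<ge> 0" "\<And>n. depth_mix n p (span_poly n p) (K * real n ^ p)"
    using span_poly_depth_mix[OF p] by blast
  define C where "C = 12 * (1 + 8 * real p) + 48 * (K * real p ^ p)"
  have C: "C \<ge> 0" using K by (simp add: C_def)
  have "\<bar>measure_pmf.prob (Y_pmf n p)
            {y. (real y - 2 * real p * ln (real n)) / sqrt (2 * real p * ln (real n)) < x}
          - \<Phi> x\<bar> \<le> C * (1 / sqrt (ln (real n)))" if n: "n \<ge> max p 3" for n x
  proof -
    define s where "s = sqrt (2 * real p * ln (real n))"
    \<comment> \<open>The bound \<open>n \<ge> 3\<close> ensures \<open>ln n \<ge> 1\<close> and hence \<open>s \<ge> 1\<close>.\<close>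
    have "exp 1 \<le> real n" using n exp_le by linarith
    then have ln: "ln (real n) \<ge> 1" using n by (subst ln_ge_iff) auto
    have "1 * 1 \<le> (2 * real p) * ln (real n)" using ln p by (intro mult_mono) auto
    then have s: "s \<ge> 1" "s\<^sup>2 = 2 * real p * ln (real n)" unfolding s_def by auto
    have b: "real (n choose p) > 0" using n by simp
    have bin: "real n ^ p \<le> real p ^ p * real (n choose p)"
    proof -
      have "(real n / real p) ^ p \<le> real (n choose p)"
        using binomial_ge_n_over_k_pow_k[of p n, where 'a = real] n by simp
      then show ?thesis using p by (simp add: power_divide field_simps)
    qed
    have "{y. (real y - 2 * real p * ln (real n)) / s < x} = {y. real y < s\<^sup>2 + s * x}"
      using s by (auto simp: field_simps)
    then have "measure_pmf.prob (Y_pmf n p) {y. (real y - 2 * real p * ln (real n)) / s < x} =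
        measure_pmf.expectation (Y_pmf n p) (indicator {y. real y < s\<^sup>2 + s * x})" by simp
    also have "\<dots> = poly_exp (span_poly n p) (indicator {y. real y < s\<^sup>2 + s * x}) / real (n choose p)"
      using p n by (intro expectation_Y_pmf) auto
    also have "(indicator {y. real y < s\<^sup>2 + s * x} :: nat \<Rightarrow> real) = (\<lambda>k. of_bool (real k < s\<^sup>2 + s * x))"
      by (auto simp: indicator_def fun_eq_iff)
    finally have E: "measure_pmf.prob (Y_pmf n p) {y. (real y - 2 * real p * ln (real n)) / s < x} =
        poly_exp (span_poly n p) (\<lambda>k. of_bool (real k < s\<^sup>2 + s * x)) / real (n choose p)" .
    have "\<bar>X / b - F\<bar> = \<bar>X - b * F\<bar> / b" if "b > 0" for X b F :: real
    proof -
      have "X / b - F = (X - b * F) / b" using that by (simp add: field_simps)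
      then show ?thesis using that by simp
    qed
    from this[OF b] have "\<bar>measure_pmf.prob (Y_pmf n p) {y. (real y - 2 * real p * ln (real n)) / s < x} - \<Phi> x\<bar> =
        \<bar>poly_exp (span_poly n p) (\<lambda>k. of_bool (real k < s\<^sup>2 + s * x)) - poly (span_poly n p) 1 * \<Phi> x\<bar> / real (n choose p)"
      unfolding E poly_span_poly_1[OF less_le_trans[OF zero_less_numeral p]] .
    also have "\<dots> \<le> ((12 * (1 + 8 * real p) * poly (span_poly n p) 1 + 48 * (K * real n ^ p)) / s) / real (n choose p)"
      using depth_mix_normal_approx[OF K(2) s, of "s\<^sup>2 + s * x"] s by (intro divide_right_mono) auto
    also have "\<dots> \<le> ((12 * (1 + 8 * real p) * poly (span_poly n p) 1 + 48 * (K * (real p ^ p * real (n choose p)))) / s) / real (n choose p)"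
      using bin K s by (intro divide_right_mono add_left_mono mult_left_mono) auto
    also have "\<dots> = C / s"
      using b p s poly_span_poly_1[of p n] by (simp add: C_def field_simps)
    also have "\<dots> \<le> C / sqrt (ln (real n))"
    proof -
      have "1 * ln (real n) \<le> 2 * real p * ln (real n)" using p ln by (intro mult_right_mono) auto
      then have "sqrt (ln (real n)) \<le> s" unfolding s_def by (intro real_sqrt_le_mono) simp
      then show ?thesis using C ln s by (intro divide_left_mono) auto
    qed
    finally show ?thesis by (simp add: s_def)
  qed
  then have "\<forall>\<^sub>F n in sequentially. \<forall>x. \<bar>measure_pmf.prob (Y_pmf n p)
            {y. (real y - 2 * real p * ln (real n)) / sqrt (2 * real p * ln (real n)) < x}
          - \<Phi> x\<bar> \<le> C * (1 / sqrt (ln (real n)))"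
    using eventually_ge_at_top[of "max p 3"] by (auto elim!: eventually_mono)
  then show ?thesis by blast
qed

section \<open>Coefficient bounds for formal power series\<close>

unbundle no vec_syntax
unbundle fps_syntax

text \<open>
  The power series \<open>(1 - X)\<^bsup>-a\<^esup>\<close> for real \<open>a\<close>.
\<close>

definition inv_pow :: "real \<Rightarrow> real fps" where
  "inv_pow a = Abs_fps (\<lambda>n. pochhammer a n / fact n)"

lemma inv_pow_nth: "inv_pow a $ n = pochhammer a n / fact n"
  by (simp add: inv_pow_def)

lemma inv_pow_nth_nonneg: "a \<ge> 0 \<Longrightarrow> inv_pow a $ n \<ge> 0"
  by (cases "a = 0") (auto simp: inv_pow_nth pochhammer_0_left intro!: divide_nonneg_nonneg less_imp_le[OF pochhammer_pos])

lemma inv_pow_add: "inv_pow (a + b) = inv_pow a * inv_pow b"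
proof (rule fps_ext)
  fix n
  have eq: "inv_pow c $ k = (- 1) ^ k * (- c gchoose k)" for c k
    by (simp add: inv_pow_nth gbinomial_pochhammer flip: mult.assoc power_mult_distrib)
  have "inv_pow (a + b) $ n = (- 1) ^ n * (fps_binomial (- a + - b) $ n)" by (simp add: eq)
  also have "\<dots> = (- 1) ^ n * (\<Sum>i=0..n. (- a gchoose i) * (- b gchoose (n - i)))"
    unfolding fps_binomial_add_mult fps_mult_nth by simp
  also have "\<dots> = (\<Sum>i=0..n. ((- 1) ^ i * (- a gchoose i)) * ((- 1) ^ (n - i) * (- b gchoose (n - i))))"
    unfolding sum_distrib_left
  proof (intro sum.cong refl)
    fix i assume "i \<in> {0..n}"
    then have "(- 1 :: real) ^ n = (- 1) ^ i * (- 1) ^ (n - i)" by (simp flip: power_add)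
    then show "(- 1) ^ n * ((- a gchoose i) * (- b gchoose (n - i))) =
      ((- 1) ^ i * (- a gchoose i)) * ((- 1) ^ (n - i) * (- b gchoose (n - i)))" by simp
  qed
  finally show "inv_pow (a + b) $ n = (inv_pow a * inv_pow b) $ n"
    unfolding fps_mult_nth eq .
qed

lemma fps_deriv_inv_pow: "fps_deriv (inv_pow a) = fps_const a * inv_pow (a + 1)"
  by (rule fps_ext) (simp add: inv_pow_nth pochhammer_rec divide_simps del: of_nat_Suc)

lemma inv_pow_mono: "0 \<le> a \<Longrightarrow> a \<le> b \<Longrightarrow> inv_pow a $ n \<le> inv_pow b $ n"
  unfolding inv_pow_nth pochhammer_prod by (intro divide_right_mono prod_mono) auto

text \<open>
  Coefficientwise domination by a multiple of \<open>(1 - X)\<^bsup>-a\<^esup>\<close>.  In contrast to bounds by powers of \<open>n\<close>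
  this is exactly compatible with products and derivatives.
\<close>

definition of_order :: "real \<Rightarrow> real fps set" where
  "of_order a = {A. \<exists>C\<ge>0. \<forall>n. \<bar>A $ n\<bar> \<le> C * inv_pow a $ n}"

lemma of_orderI: "C \<ge> 0 \<Longrightarrow> (\<And>n. \<bar>A $ n\<bar> \<le> C * inv_pow a $ n) \<Longrightarrow> A \<in> of_order a"
  unfolding of_order_def by blast

lemma of_order_0 [simp]: "a \<ge> 0 \<Longrightarrow> 0 \<in> of_order a"
  by (intro of_orderI[of 0]) auto

lemma of_order_mono:
  assumes "A \<in> of_order a" "0 \<le> a" "a \<le> b" shows "A \<in> of_order b"
proof -
  obtain C where C: "C \<ge> 0" "\<And>n. \<bar>A $ n\<bar> \<le> C * inv_pow a $ n" using assms unfolding of_order_def by blast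
  show ?thesis
    by (rule of_orderI[OF C(1)], rule order_trans[OF C(2)])
       (intro mult_left_mono C(1) inv_pow_mono assms)
qed

lemma of_order_add:
  assumes "A \<in> of_order a" "B \<in> of_order a" shows "A + B \<in> of_order a"
proof -
  obtain C where C: "C \<ge> 0" "\<And>n. \<bar>A $ n\<bar> \<le> C * inv_pow a $ n" using assms unfolding of_order_def by blast
  obtain D where D: "D \<ge> 0" "\<And>n. \<bar>B $ n\<bar> \<le> D * inv_pow a $ n" using assms unfolding of_order_def by blast
  show ?thesis
  proof (rule of_orderI)
    show "C + D \<ge> 0" using C D by simp
    show "\<bar>(A + B) $ n\<bar> \<le> (C + D) * inv_pow a $ n" for n
      using C(2)[of n] D(2)[of n] by (simp add: distrib_right)
  qed
qed

lemma of_order_cmult: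
  assumes "A \<in> of_order a" shows "fps_const c * A \<in> of_order a"
proof -
  obtain C where C: "C \<ge> 0" "\<And>n. \<bar>A $ n\<bar> \<le> C * inv_pow a $ n" using assms unfolding of_order_def by blast
  show ?thesis
  proof (rule of_orderI)
    show "\<bar>c\<bar> * C \<ge> 0" using C by simp
    show "\<bar>(fps_const c * A) $ n\<bar> \<le> \<bar>c\<bar> * C * inv_pow a $ n" for n
      using C(2)[of n] by (simp add: abs_mult mult_left_mono mult.assoc)
  qed
qed

lemma of_order_diff: "A \<in> of_order a \<Longrightarrow> B \<in> of_order a \<Longrightarrow> A - B \<in> of_order a"
  using of_order_add[OF _ of_order_cmult[of B a "-1"], of A] by (simp add: fps_const_neg[symmetric] del: fps_const_neg)

lemma of_order_sum: "(\<And>i. i \<in> I \<Longrightarrow> A i \<in> of_order a) \<Longrightarrow> a \<ge> 0 \<Longrightarrow> (\<Sum>i\<in>I. A i) \<in> of_order a"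
  by (induction I rule: infinite_finite_induct) (auto intro: of_order_add)

lemma of_order_mult:
  assumes "A \<in> of_order a" "B \<in> of_order b" shows "A * B \<in> of_order (a + b)"
proof -
  obtain C where C: "C \<ge> 0" "\<And>n. \<bar>A $ n\<bar> \<le> C * inv_pow a $ n" using assms unfolding of_order_def by blast
  obtain D where D: "D \<ge> 0" "\<And>n. \<bar>B $ n\<bar> \<le> D * inv_pow b $ n" using assms unfolding of_order_def by blast
  show ?thesis
  proof (rule of_orderI)
    show "C * D \<ge> 0" using C D by simp
    fix n
    have "\<bar>(A * B) $ n\<bar> \<le> (\<Sum>i=0..n. \<bar>A $ i\<bar> * \<bar>B $ (n - i)\<bar>)"
      unfolding fps_mult_nth by (rule order_trans[OF sum_abs]) (simp add: abs_mult)
    also have "\<dots> \<le> (\<Sum>i=0..n. (C * inv_pow a $ i) * (D * inv_pow b $ (n - i)))"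
      by (intro sum_mono mult_mono C D) (auto intro: order_trans[OF abs_ge_zero C(2)])
    also have "\<dots> = C * D * inv_pow (a + b) $ n"
      unfolding inv_pow_add fps_mult_nth by (simp add: sum_distrib_left mult_ac)
    finally show "\<bar>(A * B) $ n\<bar> \<le> C * D * inv_pow (a + b) $ n" .
  qed
qed

lemma of_order_deriv:
  assumes "A \<in> of_order a" "a \<ge> 0" shows "fps_deriv A \<in> of_order (a + 1)"
proof -
  obtain C where C: "C \<ge> 0" "\<And>n. \<bar>A $ n\<bar> \<le> C * inv_pow a $ n" using assms unfolding of_order_def by blast
  show ?thesis
  proof (rule of_orderI)
    show "C * a \<ge> 0" using C assms by simp
    fix n
    have "\<bar>fps_deriv A $ n\<bar> \<le> real (n + 1) * (C * inv_pow a $ (n + 1))"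
      using C(2)[of "n + 1"] by (simp add: abs_mult mult_left_mono del: of_nat_Suc)
    also have "\<dots> = C * fps_deriv (inv_pow a) $ n" by simp
    also have "\<dots> = C * a * inv_pow (a + 1) $ n" unfolding fps_deriv_inv_pow by simp
    finally show "\<bar>fps_deriv A $ n\<bar> \<le> C * a * inv_pow (a + 1) $ n" .
  qed
qed

text \<open>
  \<open>1 / (1 - X)\<close>
\<close>

definition geom :: "real fps" where "geom = Abs_fps (\<lambda>_. 1)"

text \<open>
  \<open>log (1 / (1 - X))\<close>
\<close>

definition log_geom :: "real fps" where "log_geom = Abs_fps (\<lambda>n. if n = 0 then 0 else 1 / real n)"

lemma geom_nth [simp]: "geom $ n = 1" by (simp add: geom_def)

lemma geom_mult_nth: "(geom * A) $ n = (\<Sum>k\<le>n. A $ k)"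
proof -
  have "(geom * A) $ n = (A * geom) $ n" by (simp add: mult.commute)
  then show ?thesis by (simp add: fps_mult_nth atLeast0AtMost)
qed

lemma inv_pow_1: "inv_pow 1 = geom"
  by (rule fps_ext) (simp add: inv_pow_nth pochhammer_fact[symmetric])

lemma geom_power: "geom ^ m = inv_pow (real m)"
proof (induction m)
  case 0
  show ?case by (rule fps_ext) (auto simp: inv_pow_nth pochhammer_0_left)
next
  case (Suc m)
  then show ?case using inv_pow_add[of 1 "real m"] by (simp add: inv_pow_1)
qed

lemma geom_power_of_order: "geom ^ m \<in> of_order (real m)"
  by (rule of_orderI[of 1]) (simp_all add: geom_power inv_pow_nth_nonneg)

lemma geom_X: "geom * fps_X = geom - 1"
  by (rule fps_ext) (simp add: fps_X_mult_right_nth)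

lemma fps_deriv_geom: "fps_deriv geom = geom ^ 2"
  using fps_deriv_inv_pow[of 1] geom_power[of 2] by (simp add: inv_pow_1)

lemma fps_deriv_log_geom: "fps_deriv log_geom = geom"
  by (rule fps_ext) (simp add: log_geom_def)

lemma fps_deriv_geom_power: "fps_deriv (geom ^ m) = of_nat m * geom ^ Suc m"
proof -
  have "fps_deriv (geom ^ m) = fps_const (real m) * inv_pow (real (Suc m))"
    unfolding geom_power fps_deriv_inv_pow by (simp add: add.commute)
  then show ?thesis unfolding geom_power fps_of_nat .
qed

text \<open>
  Logarithms are absorbed by an arbitrarily small power; in the coefficients this is
  \<open>1 / n \<le> (\<epsilon> / n) \<Prod>\<^sub>j (1 + \<epsilon> / j) / \<epsilon>\<close>.
\<close>

lemma log_geom_of_order: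
  assumes "\<epsilon> > 0" shows "log_geom \<in> of_order \<epsilon>"
proof (rule of_orderI)
  show "1 / \<epsilon> \<ge> 0" using assms by simp
  fix n show "\<bar>log_geom $ n\<bar> \<le> 1 / \<epsilon> * inv_pow \<epsilon> $ n"
  proof (cases n)
    case (Suc m)
    have "fact m = (pochhammer 1 m :: real)" by (simp add: pochhammer_fact)
    also have "\<dots> \<le> pochhammer (\<epsilon> + 1) m"
      unfolding pochhammer_prod using assms by (intro prod_mono) auto
    finally have *: "fact m \<le> pochhammer (\<epsilon> + 1) m" .
    have "1 / real (Suc m) = 1 / \<epsilon> * (\<epsilon> * fact m / fact (Suc m))" using assms by simp
    also have "\<dots> \<le> 1 / \<epsilon> * (\<epsilon> * pochhammer (\<epsilon> + 1) m / fact (Suc m))"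
      using assms * by (intro mult_left_mono divide_right_mono) auto
    finally show ?thesis unfolding Suc inv_pow_nth pochhammer_rec by (simp add: log_geom_def)
  qed (use assms in \<open>simp add: log_geom_def inv_pow_nth\<close>)
qed

text \<open>
  The majorant \<open>M = K (1 - X)\<^bsup>-a\<^esup>\<close> satisfies \<open>M' = 2 M / (1 - X) + (a - 2) K (1 - X)\<^bsup>-a-1\<^esup>\<close>.  For \<open>a > 2\<close>
  and large \<open>K\<close> its inhomogeneous part dominates \<open>B\<close>, so that it dominates the solution.
\<close>

lemma of_order_transfer:
  assumes ode: "fps_deriv A = 2 * geom * A + B" and B: "B \<in> of_order (a + 1)" and a: "a > 2"
  shows "A \<in> of_order a"
proof -
  obtain C where C: "C \<ge> 0" "\<And>n. \<bar>B $ n\<bar> \<le> C * inv_pow (a + 1) $ n" using B unfolding of_order_def by blast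
  \<comment> \<open>The first bound serves the initial value, the second one the induction step.\<close>
  define K where "K = max \<bar>A $ 0\<bar> (C / (a - 2))"
  have K0: "K \<ge> 0" by (simp add: K_def)
  have "C / (a - 2) \<le> K" by (simp add: K_def)
  then have K: "2 * K + C \<le> a * K" using a by (simp add: pos_divide_le_eq algebra_simps)
  have "\<bar>A $ n\<bar> \<le> K * inv_pow a $ n" for n
  proof (induction n rule: less_induct)
    case (less n)
    show ?case
    proof (cases n)
      case 0
      then show ?thesis by (simp add: K_def inv_pow_nth)
    next
      case (Suc m)
      have "real (m + 1) * A $ (m + 1) = 2 * (\<Sum>k\<le>m. A $ k) + B $ m"
        using arg_cong[OF ode, of "\<lambda>F. F $ m"] geom_mult_nth[of "2 * A" m]
        by (simp add: mult.assoc mult.left_commute[of geom] sum_distrib_left fps_numeral_nth numeral_fps_const)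
      then have "\<bar>real (m + 1) * A $ (m + 1)\<bar> = \<bar>2 * (\<Sum>k\<le>m. A $ k) + B $ m\<bar>"
        by (rule arg_cong)
      then have "real (m + 1) * \<bar>A $ (m + 1)\<bar> \<le> 2 * (\<Sum>k\<le>m. \<bar>A $ k\<bar>) + \<bar>B $ m\<bar>"
        unfolding abs_mult abs_of_nat using sum_abs[of "\<lambda>k. A $ k" "{..m}"] by linarith
      also have "\<dots> \<le> 2 * (\<Sum>k\<le>m. K * inv_pow a $ k) + C * inv_pow (a + 1) $ m"
        using less Suc C(2)[of m] by (intro add_mono mult_left_mono sum_mono) auto
      also have "(\<Sum>k\<le>m. K * inv_pow a $ k) = K * inv_pow (a + 1) $ m"
        using geom_mult_nth[of "inv_pow a" m] inv_pow_add[of 1 a]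
        by (simp add: sum_distrib_left inv_pow_1 add.commute)
      also have "2 * (K * inv_pow (a + 1) $ m) + C * inv_pow (a + 1) $ m = (2 * K + C) * inv_pow (a + 1) $ m"
        by (simp add: algebra_simps)
      also have "\<dots> \<le> a * K * inv_pow (a + 1) $ m"
        using K a by (intro mult_right_mono inv_pow_nth_nonneg) auto
      also have "\<dots> = K * fps_deriv (inv_pow a) $ m" unfolding fps_deriv_inv_pow by simp
      also have "\<dots> = real (m + 1) * (K * inv_pow a $ (m + 1))" by simp
      finally have "real (m + 1) * \<bar>A $ (m + 1)\<bar> \<le> real (m + 1) * (K * inv_pow a $ (m + 1))" .
      then show ?thesis using Suc by (simp del: of_nat_Suc of_nat_add)
    qed
  qed
  then show ?thesis by (rule of_orderI[OF K0])
qed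

text \<open>
  The homogeneous solutions are the multiples of \<open>(1 - X)\<^bsup>-2\<^esup>\<close>.  They are of leading order for \<open>p = 1\<close>,
  for which \<open>of_order_transfer\<close> is not available; this case is solved exactly.
\<close>

lemma fps_ode_unique:
  assumes "fps_deriv A = 2 * geom * A" "A $ 0 = (0 :: real)"
  shows "A = 0"
proof (rule fps_ext)
  fix n show "A $ n = 0 $ n"
  proof (induction n rule: less_induct)
    case (less n)
    show ?case
    proof (cases n)
      case (Suc m)
      have "real (m + 1) * A $ (m + 1) = 2 * (\<Sum>k\<le>m. A $ k)"
        using arg_cong[OF assms(1), of "\<lambda>F. F $ m"] geom_mult_nth[of "2 * A" m]
        by (simp add: mult.assoc mult.left_commute[of geom] sum_distrib_left fps_numeral_nth numeral_fps_const)
      also have "(\<Sum>k\<le>m. A $ k) = 0" using less Suc by (intro sum.neutral) auto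
      finally show ?thesis using Suc by simp
    qed (use assms in simp)
  qed
qed

text \<open>
  The leading terms are powers of \<open>geom\<close> times such quadratic polynomials in the logarithm, and all
  computations with them reduce to the three coefficients.
\<close>

definition log_quad :: "real \<Rightarrow> real \<Rightarrow> real \<Rightarrow> real fps" where
  "log_quad a b c = fps_const a * log_geom ^ 2 + fps_const b * log_geom + fps_const c"

lemma log_quad_add: "log_quad a b c + log_quad a' b' c' = log_quad (a + a') (b + b') (c + c')"
  by (simp add: log_quad_def algebra_simps flip: fps_const_add)

lemma log_quad_cmult: "fps_const k * log_quad a b c = log_quad (k * a) (k * b) (k * c)"
  by (simp add: log_quad_def algebra_simps flip: fps_const_mult)

lemma log_quad_mult: "log_quad 0 b c * log_quad 0 b' c' = log_quad (b * b') (b * c' + b' * c) (c * c')"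
  by (simp add: log_quad_def algebra_simps power2_eq_square flip: fps_const_mult fps_const_add)

lemma log_quad_sum: "(\<Sum>i\<in>I. log_quad (a i) (b i) (c i)) = log_quad (\<Sum>i\<in>I. a i) (\<Sum>i\<in>I. b i) (\<Sum>i\<in>I. c i)"
  by (induction I rule: infinite_finite_induct) (simp_all add: log_quad_add, simp_all add: log_quad_def)

lemma fps_deriv_geom_log_quad:
  "fps_deriv (geom ^ m * log_quad a b c) =
     geom ^ Suc m * log_quad (real m * a) (real m * b + 2 * a) (real m * c + b)"
proof -
  have "fps_deriv (log_quad a b c) = geom * log_quad 0 (2 * a) b"
    by (simp add: log_quad_def fps_deriv_log_geom power2_eq_square algebra_simps numeral_fps_const flip: fps_const_mult)
  moreover have "of_nat m * geom ^ Suc m * log_quad a b c = geom ^ Suc m * log_quad (real m * a) (real m * b) (real m * c)"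
    unfolding log_quad_cmult[symmetric] fps_of_nat[symmetric] by (simp only: mult_ac)
  ultimately have "fps_deriv (geom ^ m * log_quad a b c) =
     geom ^ Suc m * (log_quad (real m * a) (real m * b) (real m * c) + log_quad 0 (2 * a) b)"
    by (simp add: fps_deriv_geom_power algebra_simps)
  then show ?thesis by (simp add: log_quad_add)
qed

lemma log_quad_of_order:
  assumes "\<epsilon> > 0" shows "log_quad a b c \<in> of_order \<epsilon>"
proof -
  have "log_geom ^ 2 \<in> of_order (\<epsilon> / 2 + \<epsilon> / 2)"
    unfolding power2_eq_square using assms by (intro of_order_mult log_geom_of_order) auto
  moreover have "1 \<in> of_order \<epsilon>"
    using of_order_mono[OF geom_power_of_order[of 0], of \<epsilon>] assms by simp
  ultimately show ?thesis
    unfolding log_quad_def using assms log_geom_of_order[OF assms]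
      of_order_cmult[of 1 \<epsilon> c] by (intro of_order_add of_order_cmult) auto
qed

lemma geom_log_quad_of_order:
  "\<epsilon> > 0 \<Longrightarrow> geom ^ m * log_quad a b c \<in> of_order (real m + \<epsilon>)"
  by (intro of_order_mult geom_power_of_order log_quad_of_order)

section \<open>Differential equations for the factorial moments\<close>

lemma poly_exp_pCons: "poly_exp (pCons a P) h = a * h 0 + poly_exp P (\<lambda>k. h (Suc k))"
proof -
  have "pCons a P = monom a 0 + pCons 0 P" by (simp add: monom_0)
  then show ?thesis by (simp only: poly_exp_add poly_exp_monom poly_exp_pCons_0)
qed

lemma poly_exp_const: "poly_exp P (\<lambda>_. c) = c * poly P 1"
  by (induction P) (simp_all add: poly_exp_pCons algebra_simps)

lemma poly_exp_add_fun: "poly_exp P (\<lambda>k. g k + h k) = poly_exp P g + poly_exp P h"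
  by (simp add: poly_exp_def sum.distrib algebra_simps)

lemma poly_exp_cmult_fun: "poly_exp P (\<lambda>k. c * h k) = c * poly_exp P h"
  by (simp add: poly_exp_def sum_distrib_left algebra_simps)

lemma poly_exp_mean: "poly_exp P real = poly (pderiv P) 1"
proof (induction P)
  case (pCons a P)
  have "poly_exp (pCons a P) real = poly_exp P (\<lambda>k. real k + 1)"
    by (simp add: poly_exp_pCons add.commute)
  then show ?case using pCons by (simp add: poly_exp_add_fun poly_exp_const pderiv_pCons)
qed simp

lemma poly_exp_factorial_2: "poly_exp P (\<lambda>k. real k * (real k - 1)) = poly (pderiv (pderiv P)) 1"
proof (induction P)
  case (pCons a P)
  have "poly_exp (pCons a P) (\<lambda>k. real k * (real k - 1)) = poly_exp P (\<lambda>k. real k * (real k - 1) + 2 * real k)"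
    by (simp add: poly_exp_pCons algebra_simps)
  then show ?case using pCons
    by (simp add: poly_exp_add_fun poly_exp_cmult_fun poly_exp_mean pderiv_pCons pderiv_add)
qed simp

definition hit_fps :: "nat \<Rightarrow> real fps" where
  "hit_fps p = Abs_fps (\<lambda>n. real (n choose p))"

definition hit_fps1 :: "nat \<Rightarrow> real fps" where
  "hit_fps1 p = Abs_fps (\<lambda>n. poly (pderiv (hit_poly n p)) 1)"

definition hit_fps2 :: "nat \<Rightarrow> real fps" where
  "hit_fps2 p = Abs_fps (\<lambda>n. poly (pderiv (pderiv (hit_poly n p))) 1)"

text \<open>
  The difference accounts for the proper ancestors of the lowest common ancestor.  It satisfies a
  much simpler recurrence than \<open>span_poly\<close> itself.
\<close>

definition anc_poly :: "nat \<Rightarrow> nat \<Rightarrow> real poly" where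
  "anc_poly n p = hit_poly n p - span_poly n p"

definition anc_fps1 :: "nat \<Rightarrow> real fps" where
  "anc_fps1 p = Abs_fps (\<lambda>n. poly (pderiv (anc_poly n p)) 1)"

definition anc_fps2 :: "nat \<Rightarrow> real fps" where
  "anc_fps2 p = Abs_fps (\<lambda>n. poly (pderiv (pderiv (anc_poly n p))) 1)"

lemma pderiv_sum: "pderiv (\<Sum>i\<in>A. f i) = (\<Sum>i\<in>A. pderiv (f i))"
  by (induction A rule: infinite_finite_induct) (simp_all add: pderiv_add)

text \<open>
  The convolution over the subtree sizes and over the distribution of the chosen nodes to the two
  subtrees.
\<close>

definition conv_poly :: "nat \<Rightarrow> nat \<Rightarrow> real poly" where
  "conv_poly n p = (\<Sum>k\<le>n. \<Sum>i\<le>p. hit_poly k i * hit_poly (n - k) (p - i))"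

text \<open>
  The two convolutions belong to an unchosen and a chosen root.
\<close>

lemma hit_poly_conv:
  assumes "p \<ge> 1"
  shows "smult (real (Suc n)) (hit_poly (Suc n) p) = pCons 0 (conv_poly n p + conv_poly n (p - 1))"
proof -
  have "{..p - 1} = {..<p}" using assms by auto
  then show ?thesis
    using assms by (simp add: hit_poly.simps conv_poly_def sum.distrib del: of_nat_Suc)
qed

lemma sum_fps_mult_nth:
  "(\<Sum>k\<le>n. \<Sum>i\<le>p. A i $ k * B (p - i) $ (n - k)) = (\<Sum>i\<le>p. A i * B (p - i)) $ n"
  by (subst sum.swap) (simp add: fps_sum_nth fps_mult_nth atLeast0AtMost)

lemma conv_sym:
  fixes A B :: "nat \<Rightarrow> real fps"
  shows "(\<Sum>i\<le>p. A i * B (p - i)) = (\<Sum>i\<le>p. B i * A (p - i))"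
proof -
  have "(\<Sum>i\<le>p. A i * B (p - i)) = (\<Sum>i\<le>p. A (p - i) * B (p - (p - i)))"
    using sum.nat_diff_reindex[of "\<lambda>i. A i * B (p - i)" "Suc p"] by (simp add: lessThan_Suc_atMost)
  also have "\<dots> = (\<Sum>i\<le>p. B i * A (p - i))"
    by (intro sum.cong refl) (simp add: mult.commute)
  finally show ?thesis .
qed

lemma conv_poly_1: "poly (pderiv (conv_poly n p)) 1 = (2 * (\<Sum>i\<le>p. hit_fps1 i * hit_fps (p - i))) $ n"
proof -
  have "poly (pderiv (conv_poly n p)) 1 =
     (\<Sum>k\<le>n. \<Sum>i\<le>p. hit_fps i $ k * hit_fps1 (p - i) $ (n - k) + hit_fps1 i $ k * hit_fps (p - i) $ (n - k))"
    unfolding conv_poly_def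
    by (simp add: pderiv_sum pderiv_mult poly_sum poly_hit_poly_1 hit_fps_def hit_fps1_def mult.commute)
  also have "\<dots> = ((\<Sum>i\<le>p. hit_fps i * hit_fps1 (p - i)) + (\<Sum>i\<le>p. hit_fps1 i * hit_fps (p - i))) $ n"
    by (simp only: sum.distrib sum_fps_mult_nth fps_add_nth)
  finally show ?thesis unfolding conv_sym[of hit_fps] by (simp add: numeral_fps_const)
qed

lemma conv_poly_2: "poly (pderiv (pderiv (conv_poly n p))) 1 =
   (2 * (\<Sum>i\<le>p. hit_fps2 i * hit_fps (p - i)) + 2 * (\<Sum>i\<le>p. hit_fps1 i * hit_fps1 (p - i))) $ n"
proof -
  have "poly (pderiv (pderiv (conv_poly n p))) 1 =
     (\<Sum>k\<le>n. \<Sum>i\<le>p. hit_fps i $ k * hit_fps2 (p - i) $ (n - k) + hit_fps2 i $ k * hit_fps (p - i) $ (n - k) +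
        (hit_fps1 i $ k * hit_fps1 (p - i) $ (n - k) + hit_fps1 i $ k * hit_fps1 (p - i) $ (n - k)))"
    unfolding conv_poly_def
    by (simp add: pderiv_sum pderiv_mult pderiv_add poly_sum poly_hit_poly_1 hit_fps_def hit_fps1_def
        hit_fps2_def algebra_simps)
  also have "\<dots> = ((\<Sum>i\<le>p. hit_fps i * hit_fps2 (p - i)) + (\<Sum>i\<le>p. hit_fps2 i * hit_fps (p - i)) +
     ((\<Sum>i\<le>p. hit_fps1 i * hit_fps1 (p - i)) + (\<Sum>i\<le>p. hit_fps1 i * hit_fps1 (p - i)))) $ n"
    by (simp only: sum.distrib sum_fps_mult_nth fps_add_nth)
  finally show ?thesis unfolding conv_sym[of hit_fps] by (simp add: numeral_fps_const)
qed

text \<open>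
  Differentiate the recurrence of \<open>hit_poly\<close> at 1.  The derivative of the factor \<open>v\<close> reproduces the
  recurrence at \<open>v = 1\<close> itself, which is the first summand.
\<close>

lemma hit_fps1_ode_raw:
  assumes "p \<ge> 1"
  shows "fps_deriv (hit_fps1 p) = fps_deriv (hit_fps p) +
     2 * (\<Sum>i\<le>p. hit_fps1 i * hit_fps (p - i)) + 2 * (\<Sum>i\<le>p - 1. hit_fps1 i * hit_fps (p - 1 - i))"
proof (rule fps_ext)
  fix n
  let ?C = "conv_poly n p + conv_poly n (p - 1)"
  have 0: "real (Suc n) * poly (hit_poly (Suc n) p) 1 = poly ?C 1"
    using arg_cong[OF hit_poly_conv[OF assms, of n], of "\<lambda>P. poly P 1"] by simp
  have "real (Suc n) * poly (pderiv (hit_poly (Suc n) p)) 1 = poly ?C 1 + poly (pderiv ?C) 1"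
    using arg_cong[OF hit_poly_conv[OF assms, of n], of "\<lambda>P. poly (pderiv P) 1"]
    by (simp add: pderiv_smult pderiv_pCons)
  then show "fps_deriv (hit_fps1 p) $ n = (fps_deriv (hit_fps p) +
     2 * (\<Sum>i\<le>p. hit_fps1 i * hit_fps (p - i)) + 2 * (\<Sum>i\<le>p - 1. hit_fps1 i * hit_fps (p - 1 - i))) $ n"
    unfolding fps_add_nth conv_poly_1[symmetric] 0[symmetric]
    by (simp add: hit_fps1_def hit_fps_def poly_hit_poly_1 pderiv_add)
qed

lemma hit_fps2_ode_raw:
  assumes "p \<ge> 1"
  shows "fps_deriv (hit_fps2 p) = 2 * (fps_deriv (hit_fps1 p) - fps_deriv (hit_fps p)) +
     (2 * (\<Sum>i\<le>p. hit_fps2 i * hit_fps (p - i)) + 2 * (\<Sum>i\<le>p. hit_fps1 i * hit_fps1 (p - i))) +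
     (2 * (\<Sum>i\<le>p - 1. hit_fps2 i * hit_fps (p - 1 - i)) + 2 * (\<Sum>i\<le>p - 1. hit_fps1 i * hit_fps1 (p - 1 - i)))"
proof (rule fps_ext)
  fix n
  let ?C = "conv_poly n p + conv_poly n (p - 1)"
  have 0: "real (Suc n) * poly (hit_poly (Suc n) p) 1 = poly ?C 1"
    using arg_cong[OF hit_poly_conv[OF assms, of n], of "\<lambda>P. poly P 1"] by simp
  have 1: "real (Suc n) * poly (pderiv (hit_poly (Suc n) p)) 1 = poly ?C 1 + poly (pderiv ?C) 1"
    using arg_cong[OF hit_poly_conv[OF assms, of n], of "\<lambda>P. poly (pderiv P) 1"]
    by (simp add: pderiv_smult pderiv_pCons)
  have 2: "real (Suc n) * poly (pderiv (pderiv (hit_poly (Suc n) p))) 1 = 2 * poly (pderiv ?C) 1 + poly (pderiv (pderiv ?C)) 1"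
    using arg_cong[OF hit_poly_conv[OF assms, of n], of "\<lambda>P. poly (pderiv (pderiv P)) 1"]
    by (simp add: pderiv_smult pderiv_pCons pderiv_add)
  have "fps_deriv (hit_fps2 p) $ n = 2 * (real (Suc n) * poly (pderiv (hit_poly (Suc n) p)) 1 -
      real (Suc n) * poly (hit_poly (Suc n) p) 1) +
      poly (pderiv (pderiv (conv_poly n p))) 1 + poly (pderiv (pderiv (conv_poly n (p - 1)))) 1"
    using 0 1 2 by (simp add: hit_fps2_def pderiv_add)
  then show "fps_deriv (hit_fps2 p) $ n = (2 * (fps_deriv (hit_fps1 p) - fps_deriv (hit_fps p)) +
     (2 * (\<Sum>i\<le>p. hit_fps2 i * hit_fps (p - i)) + 2 * (\<Sum>i\<le>p. hit_fps1 i * hit_fps1 (p - i))) +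
     (2 * (\<Sum>i\<le>p - 1. hit_fps2 i * hit_fps (p - 1 - i)) + 2 * (\<Sum>i\<le>p - 1. hit_fps1 i * hit_fps1 (p - 1 - i)))) $ n"
    unfolding fps_add_nth conv_poly_2[unfolded fps_add_nth]
    by (simp add: hit_fps1_def hit_fps_def poly_hit_poly_1 numeral_fps_const)
qed

text \<open>
  The branching terms of the recurrences for \<open>hit_poly\<close> and \<open>span_poly\<close> cancel.
\<close>

lemma anc_poly_rec:
  "smult (real (Suc n)) (anc_poly (Suc n) p) =
     smult 2 (\<Sum>k\<le>n. anc_poly k p) + smult 2 ([:-1, 1:] * (\<Sum>k\<le>n. hit_poly k p))"
proof -
  have "smult (real (Suc n)) (anc_poly (Suc n) p) = - smult 2 (\<Sum>k\<le>n. span_poly k p - pCons 0 (hit_poly k p))"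
    by (simp add: anc_poly_def span_poly.simps del: of_nat_Suc)
  also have "\<dots> = smult 2 (\<Sum>k\<le>n. anc_poly k p) + smult 2 ([:-1, 1:] * (\<Sum>k\<le>n. hit_poly k p))"
    by (intro poly_eq_poly_eq_iff[THEN iffD1] ext)
       (simp add: anc_poly_def poly_sum sum_subtractf sum_distrib_left algebra_simps)
  finally show ?thesis .
qed

lemma anc_fps1_ode: "fps_deriv (anc_fps1 p) = 2 * geom * anc_fps1 p + 2 * geom * hit_fps p"
proof (rule fps_ext)
  fix n
  have "real (Suc n) * poly (pderiv (anc_poly (Suc n) p)) 1 =
     2 * (\<Sum>k\<le>n. poly (pderiv (anc_poly k p)) 1) + 2 * (\<Sum>k\<le>n. poly (hit_poly k p) 1)"
    using arg_cong[OF anc_poly_rec[of n p], of "\<lambda>P. poly (pderiv P) 1"]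
    by (simp add: pderiv_smult pderiv_add pderiv_diff pderiv_sum poly_sum pderiv_pCons)
  then show "fps_deriv (anc_fps1 p) $ n = (2 * geom * anc_fps1 p + 2 * geom * hit_fps p) $ n"
    by (simp add: anc_fps1_def hit_fps_def poly_hit_poly_1 mult.assoc geom_mult_nth numeral_fps_const)
qed

lemma anc_fps2_ode: "fps_deriv (anc_fps2 p) = 2 * geom * anc_fps2 p + 4 * geom * hit_fps1 p"
proof (rule fps_ext)
  fix n
  have "real (Suc n) * poly (pderiv (pderiv (anc_poly (Suc n) p))) 1 =
     2 * (\<Sum>k\<le>n. poly (pderiv (pderiv (anc_poly k p))) 1) + 4 * (\<Sum>k\<le>n. poly (pderiv (hit_poly k p)) 1)"
    using arg_cong[OF anc_poly_rec[of n p], of "\<lambda>P. poly (pderiv (pderiv P)) 1"]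
    by (simp add: pderiv_smult pderiv_add pderiv_diff pderiv_sum poly_sum pderiv_pCons)
  then show "fps_deriv (anc_fps2 p) $ n = (2 * geom * anc_fps2 p + 4 * geom * hit_fps1 p) $ n"
    by (simp add: anc_fps2_def hit_fps1_def mult.assoc geom_mult_nth numeral_fps_const)
qed

lemma hit_fps_0: "hit_fps 0 = geom"
  by (rule fps_ext) (simp add: hit_fps_def)

lemma hit_fps1_0: "hit_fps1 0 = 0" and hit_fps2_0: "hit_fps2 0 = 0"
  by (rule fps_ext, simp add: hit_fps1_def hit_fps2_def)+

lemma hit_fps_Suc: "hit_fps (Suc p) = (geom - 1) * hit_fps p"
proof -
  have "(1 - fps_X) * hit_fps (Suc p) = fps_X * hit_fps p"
  proof (rule fps_ext)
    fix n show "((1 - fps_X) * hit_fps (Suc p)) $ n = (fps_X * hit_fps p) $ n"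
      by (cases n) (simp_all add: hit_fps_def left_diff_distrib fps_X_mult_nth)
  qed
  then have "geom * (1 - fps_X) * hit_fps (Suc p) = geom * fps_X * hit_fps p"
    by (simp only: mult.assoc)
  then show ?thesis by (simp add: right_diff_distrib geom_X)
qed

text \<open>
  The binomial coefficients \<open>n choose p\<close> and \<open>(n + p) choose p\<close> agree to leading order.
\<close>

lemma hit_fps_error: "hit_fps p - geom ^ Suc p \<in> of_order (real p)"
proof (induction p)
  case 0
  show ?case by (simp add: hit_fps_0)
next
  case (Suc p)
  have "hit_fps (Suc p) - geom ^ Suc (Suc p) =
      geom * (hit_fps p - geom ^ Suc p) - (hit_fps p - geom ^ Suc p) - geom ^ Suc p"
    unfolding hit_fps_Suc by (simp add: algebra_simps)
  also have "\<dots> \<in> of_order (real (Suc p))"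
  proof (rule of_order_diff[OF of_order_diff])
    show "geom * (hit_fps p - geom ^ Suc p) \<in> of_order (real (Suc p))"
      using of_order_mult[OF geom_power_of_order[of 1] Suc] by (simp add: add.commute)
    show "hit_fps p - geom ^ Suc p \<in> of_order (real (Suc p))"
      by (rule of_order_mono[OF Suc]) auto
    show "geom ^ Suc p \<in> of_order (real (Suc p))" by (rule geom_power_of_order)
  qed
  finally show ?case .
qed

lemma hit_fps_of_order: "hit_fps p \<in> of_order (real p + 1)"
proof -
  have "hit_fps p - geom ^ Suc p + geom ^ Suc p \<in> of_order (real p + 1)"
  proof (rule of_order_add)
    show "hit_fps p - geom ^ Suc p \<in> of_order (real p + 1)"
      by (rule of_order_mono[OF hit_fps_error]) auto
    show "geom ^ Suc p \<in> of_order (real p + 1)"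
      using geom_power_of_order[of "Suc p"] by (simp add: add.commute)
  qed
  then show ?thesis by simp
qed

section \<open>Leading terms of the factorial moments\<close>

lemma of_order_numeral: "A \<in> of_order a \<Longrightarrow> numeral k * A \<in> of_order a"
  by (simp add: numeral_fps_const of_order_cmult)

lemma log_quad_cong: "\<lbrakk>a = a'; b = b'; c = c'\<rbrakk> \<Longrightarrow> g * log_quad a b c = g * log_quad a' b' c'"
  by simp

text \<open>
  The leading terms come from solving the equations with all lower order terms omitted, starting
  from the exact solution for \<open>i = 1\<close>.  Up to the power of \<open>geom\<close>, the second one is the square of
  \<open>2 i L + 1 - 2 i\<close> plus \<open>6 i - 3\<close>, where \<open>L = log_geom\<close>.
\<close>

definition hit_main1 :: "nat \<Rightarrow> real fps" where
  "hit_main1 i = geom ^ Suc i * log_quad 0 (2 * real i) (1 - 2 * real i)"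

definition hit_main2 :: "nat \<Rightarrow> real fps" where
  "hit_main2 i = geom ^ Suc i *
     log_quad (4 * real i ^ 2) (4 * real i - 8 * real i ^ 2) (4 * real i ^ 2 + 2 * real i - 2)"

lemma sum_quadratic:
  assumes "p \<ge> 1"
  shows "(\<Sum>i\<in>{1..<p}. A + B * real i + C * real i ^ 2) =
     A * (real p - 1) + B * (real p * (real p - 1) / 2) + C * ((real p - 1) * real p * (2 * real p - 1) / 6)"
  using assms
proof (induction p rule: dec_induct)
  case (step p)
  then show ?case by (simp add: field_simps power2_eq_square)
qed simp

lemma geom_power_split: "i \<in> {1..<p} \<Longrightarrow> geom ^ Suc i * geom ^ Suc (p - i) = geom ^ Suc (Suc p)"
  by (simp flip: power_add power_Suc)

text \<open>
  The equation of \<open>hit_fps1\<close> without its lower order terms.  The power of \<open>geom\<close> is the same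
  everywhere, and the remaining identity between polynomials in the logarithm reduces to sums of
  powers of \<open>i\<close>.
\<close>

lemma hit_main1_identity:
  assumes "p \<ge> 1"
  shows "fps_deriv (hit_main1 p) = fps_deriv (geom ^ Suc p) + 2 * geom * hit_main1 p +
     2 * (\<Sum>i\<in>{1..<p}. hit_main1 i * geom ^ Suc (p - i))"
proof -
  let ?g = "geom ^ Suc (Suc p)"
  have 1: "fps_deriv (geom ^ Suc p) = ?g * log_quad 0 0 (real p + 1)"
    using fps_deriv_geom_log_quad[of "Suc p" 0 0 1] by (simp add: log_quad_def add.commute)
  have 2: "2 * geom * hit_main1 p = ?g * log_quad 0 (4 * real p) (2 - 4 * real p)"
    using log_quad_cmult[of 2 0 "2 * real p" "1 - 2 * real p"]
    by (simp add: hit_main1_def numeral_fps_const mult_ac)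
  have "(\<Sum>i\<in>{1..<p}. hit_main1 i * geom ^ Suc (p - i)) =
        (\<Sum>i\<in>{1..<p}. ?g * log_quad 0 (2 * real i) (1 - 2 * real i))"
  proof (intro sum.cong refl)
    fix i assume "i \<in> {1..<p}"
    from geom_power_split[OF this] show "hit_main1 i * geom ^ Suc (p - i) = ?g * log_quad 0 (2 * real i) (1 - 2 * real i)"
      unfolding hit_main1_def by (metis mult.assoc mult.commute)
  qed
  also have "\<dots> = ?g * log_quad 0 (\<Sum>i\<in>{1..<p}. 2 * real i) (\<Sum>i\<in>{1..<p}. 1 - 2 * real i)"
    using log_quad_sum[of "\<lambda>_. 0" "\<lambda>i. 2 * real i" "\<lambda>i. 1 - 2 * real i" "{1..<p}"] by (simp flip: sum_distrib_left)
  also have "(\<Sum>i\<in>{1..<p}. 2 * real i) = real p * (real p - 1)"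
    using sum_quadratic[OF assms, of 0 2 0] by simp
  also have "(\<Sum>i\<in>{1..<p}. 1 - 2 * real i) = (real p - 1) - real p * (real p - 1)"
    using sum_quadratic[OF assms, of 1 "-2" 0] by simp
  finally have 3: "2 * (\<Sum>i\<in>{1..<p}. hit_main1 i * geom ^ Suc (p - i)) =
     ?g * log_quad 0 (2 * (real p * (real p - 1))) (2 * ((real p - 1) - real p * (real p - 1)))"
    using log_quad_cmult[of 2 0 "real p * (real p - 1)" "(real p - 1) - real p * (real p - 1)"]
    by (simp add: numeral_fps_const mult_ac)
  show ?thesis
    unfolding 1 2 3 distrib_left[symmetric] log_quad_add
    unfolding hit_main1_def fps_deriv_geom_log_quad
    by (rule log_quad_cong) (simp_all add: algebra_simps)
qed

lemma hit_main2_identity: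
  assumes "p \<ge> 1"
  shows "fps_deriv (hit_main2 p) = 2 * (fps_deriv (hit_main1 p) - fps_deriv (geom ^ Suc p)) +
     2 * geom * hit_main2 p + 2 * (\<Sum>i\<in>{1..<p}. hit_main2 i * geom ^ Suc (p - i)) +
     2 * (\<Sum>i\<in>{1..<p}. hit_main1 i * hit_main1 (p - i))"
proof -
  let ?g = "geom ^ Suc (Suc p)" and ?p = "real p"
  have 1: "2 * (fps_deriv (hit_main1 p) - fps_deriv (geom ^ Suc p)) =
     ?g * log_quad 0 (4 * ?p * (?p + 1)) (2 * ((?p + 1) * (1 - 2 * ?p) + 2 * ?p - (?p + 1)))"
  proof -
    have "fps_deriv (geom ^ Suc p) = ?g * log_quad 0 0 (?p + 1)"
      using fps_deriv_geom_log_quad[of "Suc p" 0 0 1] by (simp add: log_quad_def add.commute)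
    then have "2 * (fps_deriv (hit_main1 p) - fps_deriv (geom ^ Suc p)) =
      ?g * (fps_const 2 * (log_quad 0 ((?p + 1) * (2 * ?p)) ((?p + 1) * (1 - 2 * ?p) + 2 * ?p) +
         fps_const (-1) * log_quad 0 0 (?p + 1)))"
      unfolding hit_main1_def fps_deriv_geom_log_quad
      by (simp add: numeral_fps_const right_diff_distrib add.commute mult_ac fps_const_neg[symmetric] del: fps_const_neg)
    then show ?thesis unfolding log_quad_cmult log_quad_add
      by (simp add: mult_ac)
  qed
  have 2: "2 * geom * hit_main2 p = ?g * log_quad (8 * ?p\<^sup>2) (2 * (4 * ?p - 8 * ?p\<^sup>2)) (2 * (4 * ?p\<^sup>2 + 2 * ?p - 2))"
    using log_quad_cmult[of 2 "4 * ?p\<^sup>2" "4 * ?p - 8 * ?p\<^sup>2" "4 * ?p\<^sup>2 + 2 * ?p - 2"]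
    by (simp add: hit_main2_def numeral_fps_const mult_ac)
  have "(\<Sum>i\<in>{1..<p}. hit_main2 i * geom ^ Suc (p - i)) + (\<Sum>i\<in>{1..<p}. hit_main1 i * hit_main1 (p - i)) =
        (\<Sum>i\<in>{1..<p}. ?g * log_quad (4 * ?p * real i)
           (2 * ?p + (4 - 8 * ?p) * real i) (1 - 2 * ?p - 2 + (4 * ?p + 2) * real i))"
    unfolding sum.distrib[symmetric]
  proof (intro sum.cong refl)
    fix i assume i: "i \<in> {1..<p}"
    then have r: "real (p - i) = ?p - real i" by auto
    have "hit_main2 i * geom ^ Suc (p - i) + hit_main1 i * hit_main1 (p - i) =
       (geom ^ Suc i * geom ^ Suc (p - i)) * (log_quad (4 * real i ^ 2) (4 * real i - 8 * real i ^ 2) (4 * real i ^ 2 + 2 * real i - 2)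
         + log_quad 0 (2 * real i) (1 - 2 * real i) * log_quad 0 (2 * real (p - i)) (1 - 2 * real (p - i)))"
      unfolding hit_main1_def hit_main2_def by (simp add: algebra_simps)
    also have "\<dots> = ?g * log_quad (4 * ?p * real i)
           (2 * ?p + (4 - 8 * ?p) * real i) (1 - 2 * ?p - 2 + (4 * ?p + 2) * real i)"
      unfolding geom_power_split[OF i] log_quad_mult log_quad_add r
      by (rule log_quad_cong)
         (simp_all add: algebra_simps power2_eq_square)
    finally show "hit_main2 i * geom ^ Suc (p - i) + hit_main1 i * hit_main1 (p - i) =
       ?g * log_quad (4 * ?p * real i) (2 * ?p + (4 - 8 * ?p) * real i) (1 - 2 * ?p - 2 + (4 * ?p + 2) * real i)" .
  qed
  also have "\<dots> = ?g * log_quad (\<Sum>i\<in>{1..<p}. 4 * ?p * real i) (\<Sum>i\<in>{1..<p}. 2 * ?p + (4 - 8 * ?p) * real i)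
      (\<Sum>i\<in>{1..<p}. 1 - 2 * ?p - 2 + (4 * ?p + 2) * real i)"
    unfolding sum_distrib_left[symmetric, of ?g] log_quad_sum ..
  also have "(\<Sum>i\<in>{1..<p}. 4 * ?p * real i) = 4 * ?p * (?p * (?p - 1) / 2)"
    using sum_quadratic[OF assms, of 0 "4 * ?p" 0] by simp
  also have "(\<Sum>i\<in>{1..<p}. 2 * ?p + (4 - 8 * ?p) * real i) = 2 * ?p * (?p - 1) + (4 - 8 * ?p) * (?p * (?p - 1) / 2)"
    using sum_quadratic[OF assms, of "2 * ?p" "4 - 8 * ?p" 0] by simp
  also have "(\<Sum>i\<in>{1..<p}. 1 - 2 * ?p - 2 + (4 * ?p + 2) * real i) =
      (1 - 2 * ?p - 2) * (?p - 1) + (4 * ?p + 2) * (?p * (?p - 1) / 2)"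
    using sum_quadratic[OF assms, of "1 - 2 * ?p - 2" "4 * ?p + 2" 0] by simp
  finally have 3: "2 * (\<Sum>i\<in>{1..<p}. hit_main2 i * geom ^ Suc (p - i)) + 2 * (\<Sum>i\<in>{1..<p}. hit_main1 i * hit_main1 (p - i)) =
     ?g * (fps_const 2 * log_quad (4 * ?p * (?p * (?p - 1) / 2)) (2 * ?p * (?p - 1) + (4 - 8 * ?p) * (?p * (?p - 1) / 2))
      ((1 - 2 * ?p - 2) * (?p - 1) + (4 * ?p + 2) * (?p * (?p - 1) / 2)))"
    by (simp only: distrib_left[symmetric] numeral_fps_const mult.left_commute)
  show ?thesis
    unfolding add.assoc 3
    unfolding 1 2 distrib_left[symmetric] log_quad_add log_quad_cmult
    unfolding hit_main2_def fps_deriv_geom_log_quad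
    by (rule log_quad_cong)
       (simp_all add: field_simps power2_eq_square)
qed

lemma sum_atMost_ends:
  fixes f :: "nat \<Rightarrow> 'a::comm_monoid_add"
  assumes "p \<ge> 1"
  shows "(\<Sum>i\<le>p. f i) = f 0 + (f p + (\<Sum>i\<in>{1..<p}. f i))" "(\<Sum>i\<le>p - 1. f i) = f 0 + (\<Sum>i\<in>{1..<p}. f i)"
proof -
  have "{..p} = insert 0 (insert p {1..<p})" "{..p - 1} = insert 0 {1..<p}" using assms by auto
  then show "(\<Sum>i\<le>p. f i) = f 0 + (f p + (\<Sum>i\<in>{1..<p}. f i))" "(\<Sum>i\<le>p - 1. f i) = f 0 + (\<Sum>i\<in>{1..<p}. f i)"
    using assms by simp_all
qed

lemma hit_fps1_ode:
  assumes "p \<ge> 1"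
  shows "fps_deriv (hit_fps1 p) = fps_deriv (hit_fps p) + 2 * geom * hit_fps1 p +
     2 * (\<Sum>i\<in>{1..<p}. hit_fps1 i * hit_fps (p - i)) + 2 * (\<Sum>i\<in>{1..<p}. hit_fps1 i * hit_fps (p - 1 - i))"
  unfolding hit_fps1_ode_raw[OF assms] sum_atMost_ends[OF assms]
  by (simp add: hit_fps1_0 hit_fps_0 algebra_simps)

lemma hit_fps2_ode:
  assumes "p \<ge> 1"
  shows "fps_deriv (hit_fps2 p) = 2 * (fps_deriv (hit_fps1 p) - fps_deriv (hit_fps p)) + 2 * geom * hit_fps2 p +
     2 * (\<Sum>i\<in>{1..<p}. hit_fps2 i * hit_fps (p - i)) + 2 * (\<Sum>i\<in>{1..<p}. hit_fps1 i * hit_fps1 (p - i)) +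
     2 * (\<Sum>i\<in>{1..<p}. hit_fps2 i * hit_fps (p - 1 - i)) + 2 * (\<Sum>i\<in>{1..<p}. hit_fps1 i * hit_fps1 (p - 1 - i))"
  unfolding hit_fps2_ode_raw[OF assms] sum_atMost_ends[OF assms]
  by (simp add: hit_fps1_0 hit_fps2_0 hit_fps_0 algebra_simps)

lemma hit_fps_1: "hit_fps 1 = geom ^ 2 - geom"
  using hit_fps_Suc[of 0] by (simp add: hit_fps_0 power2_eq_square algebra_simps)

text \<open>
  Here the remainder is explicit: \<open>hit_fps1 1\<close> equals \<open>(2 log_geom - X) geom\<^sup>2\<close>.
\<close>

lemma hit_fps1_1: "hit_fps1 1 = hit_main1 1 + geom"
proof -
  have m: "fps_deriv (hit_main1 1) = geom ^ 3 * log_quad 0 4 0"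
    unfolding hit_main1_def fps_deriv_geom_log_quad by (simp add: numeral_eq_Suc)
  have m': "2 * geom * hit_main1 1 = geom ^ 3 * log_quad 0 4 (-2)"
    using log_quad_cmult[of 2 0 2 "-1"]
    by (simp add: hit_main1_def numeral_fps_const mult_ac numeral_eq_Suc)
  have "fps_deriv (hit_fps1 1 - (hit_main1 1 + geom)) = 2 * geom * (hit_fps1 1 - (hit_main1 1 + geom))"
  proof -
    have "fps_deriv (hit_fps1 1) = 2 * geom ^ 3 - geom ^ 2 + 2 * geom * hit_fps1 1"
      using hit_fps1_ode[of 1] fps_deriv_geom_power[of 2] unfolding hit_fps_1
      by (simp add: fps_deriv_geom numeral_eq_Suc)
    moreover have "geom ^ 3 * log_quad 0 4 0 = geom ^ 3 * log_quad 0 4 (-2) + 2 * geom ^ 3"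
    proof -
      have "log_quad 0 4 0 = log_quad 0 4 (-2) + 2"
        by (simp add: log_quad_def numeral_fps_const add.assoc)
      then show ?thesis by (simp add: distrib_left mult.commute)
    qed
    ultimately show ?thesis
      unfolding fps_deriv_sub fps_deriv_add m right_diff_distrib distrib_left m'
      by (simp add: fps_deriv_geom power2_eq_square)
  qed
  moreover have "(hit_fps1 1 - (hit_main1 1 + geom)) $ 0 = 0"
    by (simp add: hit_fps1_def hit_main1_def log_quad_def log_geom_def)
  ultimately have "hit_fps1 1 - (hit_main1 1 + geom) = 0" by (rule fps_ode_unique)
  then show ?thesis by simp
qed

text \<open>
  The value of the leading constant is determined at this point, since the homogeneous solution
  \<open>geom\<^sup>2\<close> has the same order as the leading term.
\<close>

lemma hit_fps2_1: "hit_fps2 1 = hit_main2 1 - 4 * geom"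
proof -
  have m: "fps_deriv (hit_main2 1) = geom ^ 3 * log_quad 8 0 4"
    unfolding hit_main2_def fps_deriv_geom_log_quad by (simp add: numeral_eq_Suc)
  have m': "2 * geom * hit_main2 1 = geom ^ 3 * log_quad 8 (-8) 8"
    using log_quad_cmult[of 2 4 "-4" 4]
    by (simp add: hit_main2_def numeral_fps_const mult_ac numeral_eq_Suc)
  have m1: "2 * geom * hit_main1 1 = geom ^ 3 * log_quad 0 4 (-2)"
    using log_quad_cmult[of 2 0 2 "-1"]
    by (simp add: hit_main1_def numeral_fps_const mult_ac numeral_eq_Suc)
  have "fps_deriv (hit_fps2 1 - (hit_main2 1 - 4 * geom)) = 2 * geom * (hit_fps2 1 - (hit_main2 1 - 4 * geom))"
  proof -
    have "fps_deriv (hit_fps1 1) - fps_deriv (hit_fps 1) = 2 * geom * hit_fps1 1"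
      using hit_fps1_ode[of 1] by simp
    then have "fps_deriv (hit_fps2 1) = 2 * (geom ^ 3 * log_quad 0 4 (-2)) + 4 * geom ^ 2 + 2 * geom * hit_fps2 1"
      using hit_fps2_ode[of 1] unfolding hit_fps1_1 m1[symmetric] by (simp add: power2_eq_square algebra_simps)
    moreover have "geom ^ 3 * log_quad 8 0 4 = geom ^ 3 * log_quad 8 (-8) 8 + 2 * (geom ^ 3 * log_quad 0 4 (-2))"
    proof -
      have "log_quad 8 0 4 = log_quad 8 (-8) 8 + fps_const 2 * log_quad 0 4 (-2)"
        unfolding log_quad_cmult log_quad_add by simp
      then show ?thesis by (simp add: numeral_fps_const algebra_simps)
    qed
    ultimately show ?thesis
      unfolding fps_deriv_sub m right_diff_distrib m'
      by (simp add: fps_deriv_geom algebra_simps power2_eq_square)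
  qed
  moreover have "(hit_fps2 1 - (hit_main2 1 - 4 * geom)) $ 0 = 0"
    by (simp add: hit_fps2_def hit_main2_def log_quad_def log_geom_def numeral_fps_const)
  ultimately have "hit_fps2 1 - (hit_main2 1 - 4 * geom) = 0" by (rule fps_ode_unique)
  then show ?thesis by simp
qed

section \<open>Remainders of the factorial moments\<close>

lemma hit_main1_of_order: "\<epsilon> > 0 \<Longrightarrow> hit_main1 i \<in> of_order (real i + 1 + \<epsilon>)"
  unfolding hit_main1_def using geom_log_quad_of_order[of \<epsilon> "Suc i"] by (simp add: add_ac)

lemma hit_main2_of_order: "\<epsilon> > 0 \<Longrightarrow> hit_main2 i \<in> of_order (real i + 1 + \<epsilon>)"
  unfolding hit_main2_def using geom_log_quad_of_order[of \<epsilon> "Suc i"] by (simp add: add_ac)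

lemma of_order_from_main:
  assumes "A - M \<in> of_order (a + \<epsilon>)" "M \<in> of_order (a + 1 + \<epsilon>)" "a + \<epsilon> \<ge> 0"
  shows "A \<in> of_order (a + 1 + \<epsilon>)"
  using of_order_add[OF of_order_mono[OF assms(1), of "a + 1 + \<epsilon>"] assms(2)] assms(3) by simp

text \<open>
  Subtracting the equation of the leading term leaves an equation for the remainder.  In its
  inhomogeneous part each product contains a remainder or has lost a factor \<open>geom\<close> because the root
  is chosen.
\<close>

lemma hit_fps1_asymp:
  assumes "\<epsilon> > 0" "p \<ge> 1"
  shows "hit_fps1 p - hit_main1 p \<in> of_order (real p + \<epsilon>)"
  using assms(2)
proof (induction p rule: less_induct)
  case (less p)
  show ?case
  proof (cases "p = 1")
    case True
    then show ?thesis
      using of_order_mono[OF geom_power_of_order[of 1], of "1 + \<epsilon>"] assms unfolding True hit_fps1_1 by simp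
  next
    case False
    then have p: "p \<ge> 2" using less.prems by simp
    have E: "hit_fps1 i - hit_main1 i \<in> of_order (real i + \<epsilon>)" if "i \<in> {1..<p}" for i
      using less.IH that by auto
    have F: "hit_fps1 i \<in> of_order (real i + 1 + \<epsilon>)" if "i \<in> {1..<p}" for i
      using of_order_from_main[OF E[OF that] hit_main1_of_order[OF assms(1)]] assms(1) by simp
    let ?e = "\<lambda>q. hit_fps q - geom ^ Suc q"
    let ?B = "fps_deriv (?e p) +
       2 * (\<Sum>i\<in>{1..<p}. (hit_fps1 i - hit_main1 i) * geom ^ Suc (p - i) + hit_fps1 i * ?e (p - i)) +
       2 * (\<Sum>i\<in>{1..<p}. hit_fps1 i * hit_fps (p - 1 - i))"
    show ?thesis
    proof (rule of_order_transfer)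
      have S: "(\<Sum>i\<in>{1..<p}. (hit_fps1 i - hit_main1 i) * geom ^ Suc (p - i) + hit_fps1 i * ?e (p - i)) =
         (\<Sum>i\<in>{1..<p}. hit_fps1 i * hit_fps (p - i)) - (\<Sum>i\<in>{1..<p}. hit_main1 i * geom ^ Suc (p - i))"
        unfolding sum_subtractf[symmetric] by (intro sum.cong refl) (simp add: algebra_simps)
      show "fps_deriv (hit_fps1 p - hit_main1 p) = 2 * geom * (hit_fps1 p - hit_main1 p) + ?B"
        unfolding fps_deriv_sub hit_fps1_ode[OF less.prems] hit_main1_identity[OF less.prems] S
        by (simp only: algebra_simps)
      show "?B \<in> of_order (real p + \<epsilon> + 1)"
      proof (intro of_order_add of_order_numeral of_order_sum)
        show "fps_deriv (?e p) \<in> of_order (real p + \<epsilon> + 1)"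
          by (rule of_order_mono[OF of_order_deriv[OF hit_fps_error]]) (use assms in auto)
      next
        fix i assume i: "i \<in> {1..<p}"
        then have r: "real (Suc (p - i)) = real p - real i + 1" "real (p - i) = real p - real i"
          "real (p - 1 - i) = real p - 1 - real i" by auto
        show "(hit_fps1 i - hit_main1 i) * geom ^ Suc (p - i) \<in> of_order (real p + \<epsilon> + 1)"
          using of_order_mult[OF E[OF i] geom_power_of_order[of "Suc (p - i)"]] unfolding r by (simp add: algebra_simps)
        show "hit_fps1 i * ?e (p - i) \<in> of_order (real p + \<epsilon> + 1)"
          using of_order_mult[OF F[OF i] hit_fps_error[of "p - i"]] unfolding r by (simp add: algebra_simps)
        show "hit_fps1 i * hit_fps (p - 1 - i) \<in> of_order (real p + \<epsilon> + 1)"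
          using of_order_mult[OF F[OF i] hit_fps_of_order[of "p - 1 - i"]] unfolding r by (simp add: algebra_simps)
      qed (use assms in auto)
      show "real p + \<epsilon> > 2" using p assms by simp
    qed
  qed
qed

lemma hit_fps1_of_order:
  assumes "\<epsilon> > 0" shows "hit_fps1 p \<in> of_order (real p + 1 + \<epsilon>)"
proof (cases "p = 0")
  case True
  then show ?thesis using assms by (simp add: hit_fps1_0)
next
  case False
  then show ?thesis
    using of_order_from_main[OF hit_fps1_asymp[OF assms] hit_main1_of_order[OF assms], of p] assms by simp
qed

lemma hit_fps2_asymp:
  assumes "\<epsilon> > 0" "p \<ge> 1"
  shows "hit_fps2 p - hit_main2 p \<in> of_order (real p + \<epsilon>)"
  using assms(2)
proof (induction p rule: less_induct)
  case (less p)
  show ?case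
  proof (cases "p = 1")
    case True
    have "0 - 4 * geom \<in> of_order (1 + \<epsilon>)"
      using of_order_mono[OF geom_power_of_order[of 1], of "1 + \<epsilon>"] assms
      by (intro of_order_diff of_order_numeral) auto
    then show ?thesis unfolding True hit_fps2_1 by simp
  next
    case False
    then have p: "p \<ge> 2" using less.prems by simp
    have E: "hit_fps2 i - hit_main2 i \<in> of_order (real i + \<epsilon>)" if "i \<in> {1..<p}" for i
      using less.IH that by auto
    have F: "hit_fps2 i \<in> of_order (real i + 1 + \<epsilon>)" if "i \<in> {1..<p}" for i
      using of_order_from_main[OF E[OF that] hit_main2_of_order[OF assms(1)]] assms(1) by simp
    \<comment> \<open>Products of two first moments carry two logarithms, so each of them gets half of the exponent.\<close>
    have e2: "\<epsilon> / 2 > 0" using assms by simp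
    note E1 = hit_fps1_asymp[OF e2]
    note F1 = hit_fps1_of_order[OF e2]
    note M1 = hit_main1_of_order[OF e2]
    let ?e = "\<lambda>q. hit_fps q - geom ^ Suc q"
    let ?B = "2 * (fps_deriv (hit_fps1 p - hit_main1 p) - fps_deriv (?e p)) +
       2 * (\<Sum>i\<in>{1..<p}. (hit_fps2 i - hit_main2 i) * geom ^ Suc (p - i) + hit_fps2 i * ?e (p - i)) +
       2 * (\<Sum>i\<in>{1..<p}. (hit_fps1 i - hit_main1 i) * hit_fps1 (p - i) + hit_main1 i * (hit_fps1 (p - i) - hit_main1 (p - i))) +
       2 * (\<Sum>i\<in>{1..<p}. hit_fps2 i * hit_fps (p - 1 - i)) +
       2 * (\<Sum>i\<in>{1..<p}. hit_fps1 i * hit_fps1 (p - 1 - i))"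
    show ?thesis
    proof (rule of_order_transfer)
      have S: "(\<Sum>i\<in>{1..<p}. (hit_fps2 i - hit_main2 i) * geom ^ Suc (p - i) + hit_fps2 i * ?e (p - i)) =
         (\<Sum>i\<in>{1..<p}. hit_fps2 i * hit_fps (p - i)) - (\<Sum>i\<in>{1..<p}. hit_main2 i * geom ^ Suc (p - i))"
        unfolding sum_subtractf[symmetric] by (intro sum.cong refl) (simp add: algebra_simps)
      have S': "(\<Sum>i\<in>{1..<p}. (hit_fps1 i - hit_main1 i) * hit_fps1 (p - i) + hit_main1 i * (hit_fps1 (p - i) - hit_main1 (p - i))) =
         (\<Sum>i\<in>{1..<p}. hit_fps1 i * hit_fps1 (p - i)) - (\<Sum>i\<in>{1..<p}. hit_main1 i * hit_main1 (p - i))"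
        unfolding sum_subtractf[symmetric] by (intro sum.cong refl) (simp add: algebra_simps)
      show "fps_deriv (hit_fps2 p - hit_main2 p) = 2 * geom * (hit_fps2 p - hit_main2 p) + ?B"
        unfolding fps_deriv_sub hit_fps2_ode[OF less.prems] hit_main2_identity[OF less.prems] S S'
        by (simp only: algebra_simps)
      show "?B \<in> of_order (real p + \<epsilon> + 1)"
      proof (intro of_order_add of_order_numeral of_order_sum)
        show "fps_deriv (hit_fps1 p - hit_main1 p) - fps_deriv (?e p) \<in> of_order (real p + \<epsilon> + 1)"
        proof (rule of_order_diff)
          show "fps_deriv (hit_fps1 p - hit_main1 p) \<in> of_order (real p + \<epsilon> + 1)"
            by (rule of_order_mono[OF of_order_deriv[OF E1[OF less.prems]]]) (use assms in auto)
          show "fps_deriv (?e p) \<in> of_order (real p + \<epsilon> + 1)"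
            by (rule of_order_mono[OF of_order_deriv[OF hit_fps_error]]) (use assms in auto)
        qed
      next
        fix i assume i: "i \<in> {1..<p}"
        then have r: "real (Suc (p - i)) = real p - real i + 1" "real (p - i) = real p - real i"
          "real (p - 1 - i) = real p - 1 - real i" and i': "i \<ge> 1" "p - i \<ge> 1" by auto
        show "(hit_fps2 i - hit_main2 i) * geom ^ Suc (p - i) \<in> of_order (real p + \<epsilon> + 1)"
          using of_order_mult[OF E[OF i] geom_power_of_order[of "Suc (p - i)"]] unfolding r by (simp add: algebra_simps)
        show "hit_fps2 i * ?e (p - i) \<in> of_order (real p + \<epsilon> + 1)"
          using of_order_mult[OF F[OF i] hit_fps_error[of "p - i"]] unfolding r by (simp add: algebra_simps)
        show "hit_fps2 i * hit_fps (p - 1 - i) \<in> of_order (real p + \<epsilon> + 1)"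
          using of_order_mult[OF F[OF i] hit_fps_of_order[of "p - 1 - i"]] unfolding r by (simp add: algebra_simps)
        show "(hit_fps1 i - hit_main1 i) * hit_fps1 (p - i) \<in> of_order (real p + \<epsilon> + 1)"
          using of_order_mult[OF E1[OF i'(1)] F1[of "p - i"]] unfolding r by (simp add: algebra_simps)
        show "hit_main1 i * (hit_fps1 (p - i) - hit_main1 (p - i)) \<in> of_order (real p + \<epsilon> + 1)"
          using of_order_mult[OF M1[of i] E1[OF i'(2)]] unfolding r by (simp add: algebra_simps)
        show "hit_fps1 i * hit_fps1 (p - 1 - i) \<in> of_order (real p + \<epsilon> + 1)"
          using of_order_mult[OF F1[of i] F1[of "p - 1 - i"]] unfolding r by (simp add: algebra_simps)
      qed (use assms in auto)
      show "real p + \<epsilon> > 2" using p assms by simp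
    qed
  qed
qed

text \<open>
  The constant \<open>2 / (p - 1)\<close> is the limit of the expected number of proper ancestors of the lowest
  common ancestor.
\<close>

lemma anc_fps1_asymp:
  assumes "\<epsilon> > 0" "p \<ge> 2"
  shows "anc_fps1 p - geom ^ Suc p * log_quad 0 0 (2 / (real p - 1)) \<in> of_order (real p + \<epsilon>)"
proof (rule of_order_transfer)
  let ?M = "geom ^ Suc p * log_quad 0 0 (2 / (real p - 1))"
  have "fps_deriv ?M = 2 * geom * ?M + 2 * geom * geom ^ Suc p"
  proof -
    have "2 * geom * ?M + 2 * geom * geom ^ Suc p = geom ^ Suc (Suc p) * log_quad 0 0 (2 * (2 / (real p - 1)) + 2)"
      by (simp add: log_quad_def numeral_fps_const algebra_simps flip: fps_const_add fps_const_mult)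
    moreover have "2 * (2 / (real p - 1)) + 2 = real (Suc p) * (2 / (real p - 1))"
      using assms(2) by (simp add: field_simps)
    ultimately show ?thesis unfolding fps_deriv_geom_log_quad by simp
  qed
  then show "fps_deriv (anc_fps1 p - ?M) = 2 * geom * (anc_fps1 p - ?M) + 2 * (geom * (hit_fps p - geom ^ Suc p))"
    unfolding fps_deriv_sub anc_fps1_ode by (simp add: algebra_simps)
  show "2 * (geom * (hit_fps p - geom ^ Suc p)) \<in> of_order (real p + \<epsilon> + 1)"
    by (intro of_order_numeral of_order_mono[OF of_order_mult[OF geom_power_of_order[of 1, simplified] hit_fps_error]])
       (use assms in auto)
qed (use assms in auto)

lemma anc_fps2_asymp:
  assumes "\<epsilon> > 0" "p \<ge> 2"
  shows "anc_fps2 p - geom ^ Suc p * log_quad 0 (8 * real p / (real p - 1))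
     (4 * (1 - 2 * real p) / (real p - 1) - 8 * real p / (real p - 1) ^ 2) \<in> of_order (real p + \<epsilon>)"
    (is "_ - geom ^ Suc p * log_quad 0 ?b ?c \<in> _")
proof (rule of_order_transfer)
  let ?M = "geom ^ Suc p * log_quad 0 ?b ?c"
  have "fps_deriv ?M = 2 * geom * ?M + 4 * geom * hit_main1 p"
  proof -
    have "2 * geom * ?M + 4 * geom * hit_main1 p =
       geom ^ Suc (Suc p) * (fps_const 2 * log_quad 0 ?b ?c + fps_const 4 * log_quad 0 (2 * real p) (1 - 2 * real p))"
      by (simp add: hit_main1_def numeral_fps_const algebra_simps)
    also have "\<dots> = fps_deriv ?M"
      unfolding log_quad_cmult log_quad_add fps_deriv_geom_log_quad
    proof (rule log_quad_cong)
      define x where "x = real p - 1"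
      have x: "x > 0" "real p = x + 1" using assms(2) by (auto simp: x_def)
      show "2 * ?b + 4 * (2 * real p) = real (Suc p) * ?b + 2 * 0"
        using x(1) unfolding of_nat_Suc x(2) by (simp add: field_simps)
      show "2 * ?c + 4 * (1 - 2 * real p) = real (Suc p) * ?c + ?b"
        using x(1) unfolding of_nat_Suc x(2) by (simp add: field_simps power2_eq_square)
    qed simp
    finally show ?thesis ..
  qed
  then show "fps_deriv (anc_fps2 p - ?M) = 2 * geom * (anc_fps2 p - ?M) + 4 * (geom * (hit_fps1 p - hit_main1 p))"
    unfolding fps_deriv_sub anc_fps2_ode by (simp add: algebra_simps)
  have "p \<ge> 1" using assms by simp
  from of_order_mult[OF geom_power_of_order[of 1, simplified] hit_fps1_asymp[OF assms(1) this]]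
  show "4 * (geom * (hit_fps1 p - hit_main1 p)) \<in> of_order (real p + \<epsilon> + 1)"
    by (intro of_order_numeral) (simp add: add_ac)
qed (use assms in auto)

section \<open>From power series to asymptotics of coefficients\<close>

text \<open>
  Multiplying the derivative by \<open>1 - X\<close> gives a first-order recurrence in \<open>n\<close>.  Up to the binomial
  coefficient, it adds \<open>1 / (n + p + 1)\<close> to the harmonic number in each step; the harmonic number of
  second order corrects the square.
\<close>

lemma geom_log_quad_nth:
  fixes p :: nat
  defines "h \<equiv> \<lambda>n. harm (n + p) - harm p :: real" and "s \<equiv> \<lambda>n. harm2 (n + p) - harm2 p"
  shows "(geom ^ Suc p * log_quad a b c) $ n =
     real ((n + p) choose p) * (a * ((h n)\<^sup>2 - s n) + b * h n + c)"
proof (induction n arbitrary: a b c)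
  case 0
  have "(geom ^ Suc p) $ 0 = 1" by (simp add: geom_power inv_pow_nth)
  then show ?case by (simp add: h_def s_def log_quad_def log_geom_def)
next
  case (Suc n)
  define A where "A = geom ^ Suc p * log_quad a b c"
  define \<delta> where "\<delta> = 1 / real (n + p + 1)"
  have \<delta>: "\<delta> * real (n + p + 1) = 1" by (simp add: \<delta>_def)
  have g1: "(1 - fps_X) * geom = 1" using geom_X by (simp add: algebra_simps)
  have "(1 - fps_X) * fps_deriv A = (1 - fps_X) * geom * (geom ^ Suc p *
      log_quad (real (Suc p) * a) (real (Suc p) * b + 2 * a) (real (Suc p) * c + b))"
    unfolding A_def fps_deriv_geom_log_quad by (simp add: mult_ac)
  also have "\<dots> = fps_const (real (Suc p)) * A + geom ^ Suc p * log_quad 0 (2 * a) b"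
    unfolding g1 A_def mult.left_commute[of "fps_const _"] log_quad_cmult distrib_left[symmetric] log_quad_add
    by simp
  finally have ode: "fps_deriv A = fps_X * fps_deriv A + (fps_const (real (Suc p)) * A + geom ^ Suc p * log_quad 0 (2 * a) b)"
    by (simp add: algebra_simps)
  have "(fps_X * fps_deriv A) $ n = real n * A $ n"
    by (cases n) (simp_all add: fps_X_mult_nth)
  then have "real (n + 1) * A $ (n + 1) = real (n + p + 1) * A $ n + (geom ^ Suc p * log_quad 0 (2 * a) b) $ n"
    using arg_cong[OF ode, of "\<lambda>F. F $ n"] by (simp add: algebra_simps)
  also have "A $ n = real ((n + p) choose p) * (a * ((h n)\<^sup>2 - s n) + b * h n + c)"
    unfolding A_def by (rule Suc)
  also have "(geom ^ Suc p * log_quad 0 (2 * a) b) $ n = real ((n + p) choose p) * (2 * a * h n + b)"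
    unfolding Suc by simp
  finally have "real (n + 1) * A $ (n + 1) =
     real (n + p + 1) * real ((n + p) choose p) *
       (a * ((h n)\<^sup>2 - s n) + b * h n + c + \<delta> * (2 * a * h n + b))"
  proof -
    assume *: "real (n + 1) * A $ (n + 1) =
      real (n + p + 1) * (real ((n + p) choose p) * (a * ((h n)\<^sup>2 - s n) + b * h n + c)) +
      real ((n + p) choose p) * (2 * a * h n + b)"
    have "u * B * (x + \<delta> * y) = u * (B * x) + (\<delta> * u) * (B * y)" for u B x y
      by (simp only: algebra_simps)
    then show ?thesis unfolding * by (simp only: \<delta> mult_1_left)
  qed
  also have "a * ((h n)\<^sup>2 - s n) + b * h n + c + \<delta> * (2 * a * h n + b) =
     a * ((h n + \<delta>)\<^sup>2 - (s n + \<delta>\<^sup>2)) + b * (h n + \<delta>) + c"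
    by (simp add: algebra_simps power2_eq_square)
  also have "h n + \<delta> = h (Suc n)" by (simp add: h_def \<delta>_def harm_Suc inverse_eq_divide)
  also have "s n + \<delta>\<^sup>2 = s (Suc n)" by (simp add: s_def \<delta>_def harm2_def power_divide)
  also have "real (n + p + 1) * real ((n + p) choose p) = real (n + 1) * real ((Suc n + p) choose p)"
  proof -
    have "(n + 1) * ((Suc n + p) choose p) = (n + p + 1) * ((n + p) choose p)"
      using Suc_times_binomial_eq[of "n + p" n] binomial_symmetric[of p "Suc n + p"] binomial_symmetric[of p "n + p"]
      by (simp add: mult.commute)
    then show ?thesis by (metis of_nat_mult)
  qed
  finally show ?case by (simp add: A_def del: of_nat_Suc)
qed

lemma inv_pow_nth_le:
  assumes "a \<ge> 0" shows "inv_pow a $ Suc m \<le> a * exp a * real (Suc m) powr (a - 1)"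
proof -
  have "pochhammer (a + 1) m / fact m \<le> exp (a * harm m)"
  proof (induction m)
    case 0
    then show ?case by (simp add: harm_def)
  next
    case (Suc m)
    have "pochhammer (a + 1) (Suc m) / fact (Suc m) = pochhammer (a + 1) m / fact m * (1 + a / real (Suc m))"
      by (simp add: pochhammer_Suc field_simps)
    also have "\<dots> \<le> exp (a * harm m) * exp (a / real (Suc m))"
      using Suc assms exp_ge_add_one_self[of "a / real (Suc m)"] by (intro mult_mono) auto
    also have "\<dots> = exp (a * harm (Suc m))"
      by (simp add: harm_Suc inverse_eq_divide distrib_left flip: exp_add)
    finally show ?case .
  qed
  also have "harm m \<le> 1 + ln (real (Suc m))"
  proof (cases "m = 0")
    case False
    then have "harm m \<le> euler_mascheroni + ln (real (Suc m)) - inverse (real (2 * (m + 1)))"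
      using euler_mascheroni_bounds[of m] by simp
    moreover have "inverse (real (2 * (m + 1))) \<ge> 0" by simp
    ultimately show ?thesis using euler_mascheroni_less_13_over_22 by linarith
  qed (simp add: harm_def)
  then have "exp (a * harm m) \<le> exp (a * (1 + ln (real (Suc m))))"
    using assms by (simp add: mult_left_mono)
  also have "\<dots> = exp a * real (Suc m) powr a"
    by (simp add: distrib_left exp_add powr_def)
  finally have "a / real (Suc m) * (pochhammer (a + 1) m / fact m) \<le> a / real (Suc m) * (exp a * real (Suc m) powr a)"
    using assms by (intro mult_left_mono) auto
  moreover have "inv_pow a $ Suc m = a / real (Suc m) * (pochhammer (a + 1) m / fact m)"
    by (simp add: inv_pow_nth pochhammer_rec)
  moreover have "a / real (Suc m) * (exp a * real (Suc m) powr a) = a * exp a * real (Suc m) powr (a - 1)"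
    by (simp add: powr_diff)
  ultimately show ?thesis by simp
qed

abbreviation pow_bigo :: "real \<Rightarrow> (nat \<Rightarrow> real) set" where
  "pow_bigo x \<equiv> O(\<lambda>n. real n powr x)"

lemma pow_bigoI:
  assumes "\<And>n. n \<ge> N \<Longrightarrow> \<bar>f n\<bar> \<le> C * real n powr x" shows "f \<in> pow_bigo x"
  by (rule bigoI[of _ C]) (use assms in \<open>auto intro!: eventually_at_top_linorderI[of N]\<close>)

lemma pow_bigo_mono: "f \<in> pow_bigo x \<Longrightarrow> x \<le> y \<Longrightarrow> f \<in> pow_bigo y"
proof (erule landau_o.big_trans, rule pow_bigoI[of 1 _ 1])
  fix n :: nat assume "n \<ge> 1" "x \<le> y"
  then show "\<bar>real n powr x\<bar> \<le> 1 * real n powr y" by (simp add: powr_mono)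
qed

lemma pow_bigo_mult: "f \<in> pow_bigo x \<Longrightarrow> g \<in> pow_bigo y \<Longrightarrow> (\<lambda>n. f n * g n) \<in> pow_bigo (x + y)"
  unfolding powr_add by (rule landau_o.big_mult)

lemma pow_bigo_add: "f \<in> pow_bigo x \<Longrightarrow> g \<in> pow_bigo x \<Longrightarrow> (\<lambda>n. f n + g n) \<in> pow_bigo x"
  by (rule sum_in_bigo)

lemma pow_bigo_const: "x \<ge> 0 \<Longrightarrow> (\<lambda>_. c) \<in> pow_bigo x"
  by (rule pow_bigo_mono[of _ 0]) (auto intro!: pow_bigoI[of 1 _ "\<bar>c\<bar>"])

lemma pow_bigo_cmult: "f \<in> pow_bigo x \<Longrightarrow> (\<lambda>n. c * f n) \<in> pow_bigo x"
  using pow_bigo_mult[OF pow_bigo_const[of 0 c], of f x] by simp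

lemma binomial_inverse_bigo: "(\<lambda>n. 1 / real (n choose p)) \<in> pow_bigo (- real p)"
proof (cases "p = 0")
  case False
  show ?thesis
  proof (rule pow_bigoI)
    fix n assume n: "n \<ge> p"
    have n0: "real n > 0" using n False by simp
    have "(real n / real p) ^ p \<le> real (n choose p)"
      using binomial_ge_n_over_k_pow_k[of p n, where 'a = real] n by simp
    moreover have "(real n / real p) ^ p > 0" using n0 False by simp
    ultimately have "1 / real (n choose p) \<le> 1 / (real n / real p) ^ p"
      by (intro divide_left_mono mult_pos_pos) (use n in auto)
    also have "\<dots> = real p ^ p * real n powr (- real p)"
      using n0 by (simp add: powr_minus powr_realpow power_divide field_simps)
    finally show "\<bar>1 / real (n choose p)\<bar> \<le> real p ^ p * real n powr (- real p)" by simp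
  qed
qed (auto intro!: pow_bigo_const)

lemma of_order_bigo:
  assumes "A \<in> of_order a" "a \<ge> 0" shows "(\<lambda>n. A $ n) \<in> pow_bigo (a - 1)"
proof -
  obtain C where C: "C \<ge> 0" "\<And>n. \<bar>A $ n\<bar> \<le> C * inv_pow a $ n" using assms unfolding of_order_def by blast
  show ?thesis
  proof (rule pow_bigoI)
    fix n :: nat assume "n \<ge> 1"
    then obtain m where m: "n = Suc m" by (cases n) auto
    have "\<bar>A $ n\<bar> \<le> C * (a * exp a * real n powr (a - 1))"
      unfolding m by (rule order_trans[OF C(2)], rule mult_left_mono[OF inv_pow_nth_le[OF assms(2)] C(1)])
    then show "\<bar>A $ n\<bar> \<le> C * a * exp a * real n powr (a - 1)" by (simp add: mult_ac)
  qed
qed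

lemma of_order_over_binomial:
  assumes "A \<in> of_order (real p + \<epsilon>)" "\<epsilon> \<ge> 0"
  shows "(\<lambda>n. A $ n / real (n choose p)) \<in> pow_bigo (\<epsilon> - 1)"
  using pow_bigo_mult[OF of_order_bigo[OF assms(1)] binomial_inverse_bigo[of p]] assms(2) by simp

lemma harm_asymp: "(\<lambda>n. harm (n + p) - (ln (real n) + euler_mascheroni)) \<in> pow_bigo (- 1)"
proof (rule pow_bigoI)
  fix n :: nat assume n: "n \<ge> 1"
  let ?N = "n + p"
  have "euler_mascheroni \<in> {harm ?N - ln (real (Suc ?N)) + inverse (real (2 * (?N + 1)))..
      harm ?N - ln (real (Suc ?N)) + inverse (real (2 * ?N))}"
    by (rule euler_mascheroni_bounds) (use n in simp)
  moreover have "inverse (real (2 * ?N)) \<le> 1 / real n"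
    using n by (simp add: inverse_eq_divide frac_le)
  moreover have "inverse (real (2 * (?N + 1))) \<ge> 0" by simp
  moreover have "ln (real (Suc ?N)) - ln (real n) \<le> (real p + 1) / real n"
  proof -
    have "ln (real (Suc ?N) / real n) \<le> real (Suc ?N) / real n - 1"
      using n by (intro ln_le_minus_one) auto
    also have "\<dots> = (real p + 1) / real n" using n by (simp add: field_simps)
    finally show ?thesis using n by (simp add: ln_div)
  qed
  moreover have "ln (real n) \<le> ln (real (Suc ?N))" using n by simp
  moreover have "(real p + 2) * (1 / real n) = (real p + 1) / real n + 1 / real n"
    by (simp add: add_divide_distrib)
  moreover have "1 / real n \<ge> 0" "(real p + 1) / real n \<ge> 0" by simp_all
  ultimately have "\<bar>harm ?N - (ln (real n) + euler_mascheroni)\<bar> \<le> (real p + 2) * (1 / real n)"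
    by (simp only: atLeastAtMost_iff) linarith
  then show "\<bar>harm ?N - (ln (real n) + euler_mascheroni)\<bar> \<le> (real p + 2) * real n powr - 1"
    using n by (simp add: powr_minus_divide)
qed

lemma harm2_asymp: "(\<lambda>n. harm2 (n + p) - pi\<^sup>2 / 6) \<in> pow_bigo (- 1)"
proof (rule pow_bigoI)
  fix n :: nat assume n: "n \<ge> 1"
  have step: "harm2 (N + m) - harm2 N \<le> 1 / real N - 1 / real (N + m)" if "N \<ge> 1" for N m
  proof (induction m)
    case (Suc m)
    have "1 / real (Suc (N + m)) ^ 2 \<le> 1 / real (N + m) - 1 / real (Suc (N + m))"
    proof -
      define x where "x = real (N + m)"
      have x: "x > 0" using that by (simp add: x_def)
      have "1 / (x + 1)\<^sup>2 \<le> 1 / (x * (x + 1))"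
        using x by (intro divide_left_mono mult_pos_pos) (auto simp: power2_eq_square)
      also have "\<dots> = 1 / x - 1 / (x + 1)" using x by (simp add: field_simps)
      finally show ?thesis by (simp add: x_def add_ac)
    qed
    then show ?case using Suc by (simp add: harm2_def)
  qed simp
  have "(\<lambda>m. harm2 m) \<longlonglongrightarrow> pi\<^sup>2 / 6"
  proof -
    have "harm2 m = (\<Sum>k<m. 1 / (real k + 1)\<^sup>2)" for m
      by (induction m) (simp_all add: harm2_def add.commute)
    then show ?thesis using inverse_squares_sums unfolding sums_def by (simp add: add.commute)
  qed
  then have lim: "(\<lambda>m. harm2 (n + p + m)) \<longlonglongrightarrow> pi\<^sup>2 / 6"
    using LIMSEQ_ignore_initial_segment[of harm2 "pi\<^sup>2 / 6" "n + p"] by (simp add: add_ac)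
  have mono: "harm2 (n + p) \<le> harm2 (n + p + m)" for m
    by (induction m) (auto simp: harm2_def intro: order_trans)
  have "harm2 (n + p) \<le> pi\<^sup>2 / 6"
    by (rule LIMSEQ_le_const[OF lim]) (use mono in auto)
  moreover have "harm2 (n + p + m) \<le> harm2 (n + p) + 1 / real n" for m
  proof -
    have "harm2 (n + p + m) - harm2 (n + p) \<le> 1 / real (n + p) - 1 / real (n + p + m)"
      by (rule step) (use n in simp)
    moreover have "1 / real (n + p) \<le> 1 / real n" using n by (simp add: frac_le)
    moreover have "1 / real (n + p + m) \<ge> 0" by simp
    ultimately show ?thesis by linarith
  qed
  then have "pi\<^sup>2 / 6 \<le> harm2 (n + p) + 1 / real n"
    by (intro LIMSEQ_le_const2[OF lim]) auto
  ultimately show "\<bar>harm2 (n + p) - pi\<^sup>2 / 6\<bar> \<le> 1 * real n powr - 1"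
    using n by (simp add: powr_minus_divide)
qed

lemma ln_bigo: "\<epsilon> > 0 \<Longrightarrow> (\<lambda>n. ln (real n) + c) \<in> pow_bigo \<epsilon>"
proof -
  assume e: "\<epsilon> > 0"
  have "(\<lambda>n. ln (real n)) \<in> pow_bigo \<epsilon>" using e by real_asymp
  then show ?thesis using pow_bigo_const[of \<epsilon> c] e by (intro pow_bigo_add) auto
qed

text \<open>
  The ratio of the binomial coefficients, the harmonic numbers and their second order analogues
  are all known up to \<open>O(1 / n)\<close>, and these errors are multiplied by at most two logarithms.
\<close>

lemma geom_log_quad_ratio:
  fixes p :: nat
  assumes "\<epsilon> > 0"
  defines "\<Lambda> \<equiv> \<lambda>n. ln (real n) + (euler_mascheroni - harm p)"
  shows "(\<lambda>n. (geom ^ Suc p * log_quad a b c) $ n / real (n choose p) -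
     (a * ((\<Lambda> n)\<^sup>2 - (pi\<^sup>2 / 6 - harm2 p)) + b * \<Lambda> n + c)) \<in> pow_bigo (\<epsilon> - 1)"
proof -
  \<comment> \<open>The exponent \<open>\<delta>\<close> bounds one logarithm; two of them fit into \<open>\<epsilon>\<close>, and \<open>\<delta> \<le> 1\<close> keeps squares of errors small.\<close>
  define \<delta> where "\<delta> = min (\<epsilon> / 2) 1"
  have \<delta>: "\<delta> > 0" "2 * \<delta> \<le> \<epsilon>" "\<delta> \<le> 1" using assms by (auto simp: \<delta>_def)
  define h where "h = (\<lambda>n. harm (n + p) - harm p :: real)"
  define s where "s = (\<lambda>n. harm2 (n + p) - harm2 p)"
  define e where "e = (\<lambda>n. h n - \<Lambda> n)"
  define t where "t = (\<lambda>n. s n - (pi\<^sup>2 / 6 - harm2 p))"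
  define r where "r = (\<lambda>n. real ((n + p) choose p) / real (n choose p) - 1)"
  define Q where "Q = (\<lambda>n. a * ((\<Lambda> n)\<^sup>2 - (pi\<^sup>2 / 6 - harm2 p)) + b * \<Lambda> n + c)"
  define d where "d = (\<lambda>n. a * (2 * (\<Lambda> n * e n) + e n * e n + (-1) * t n) + b * e n)"
  have \<Lambda>: "\<Lambda> \<in> pow_bigo \<delta>" unfolding \<Lambda>_def using ln_bigo[OF \<delta>(1)] by simp
  have e: "e \<in> pow_bigo (-1)" using harm_asymp[of p] by (simp add: e_def h_def \<Lambda>_def algebra_simps)
  have t: "t \<in> pow_bigo (-1)" using harm2_asymp[of p] by (simp add: t_def s_def)
  have Q: "Q \<in> pow_bigo \<epsilon>"
  proof -
    have "(\<lambda>n. \<Lambda> n * \<Lambda> n) \<in> pow_bigo \<epsilon>" using pow_bigo_mono[OF pow_bigo_mult[OF \<Lambda> \<Lambda>]] \<delta> by simp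
    moreover have "\<Lambda> \<in> pow_bigo \<epsilon>" using pow_bigo_mono[OF \<Lambda>] \<delta> by simp
    ultimately have "(\<lambda>n. a * (\<Lambda> n * \<Lambda> n + - (pi\<^sup>2 / 6 - harm2 p)) + b * \<Lambda> n + c) \<in> pow_bigo \<epsilon>"
      using assms(1) by (intro pow_bigo_add pow_bigo_cmult pow_bigo_const) auto
    then show ?thesis by (simp add: Q_def power2_eq_square algebra_simps)
  qed
  have d: "d \<in> pow_bigo (\<epsilon> - 1)"
  proof -
    have "(\<lambda>n. \<Lambda> n * e n) \<in> pow_bigo (\<epsilon> - 1)" using pow_bigo_mono[OF pow_bigo_mult[OF \<Lambda> e]] \<delta> by simp
    moreover have "(\<lambda>n. e n * e n) \<in> pow_bigo (\<epsilon> - 1)" using pow_bigo_mono[OF pow_bigo_mult[OF e e]] assms(1) by simp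
    moreover have "e \<in> pow_bigo (\<epsilon> - 1)" "t \<in> pow_bigo (\<epsilon> - 1)"
      using pow_bigo_mono[OF e] pow_bigo_mono[OF t] assms(1) by simp_all
    ultimately show ?thesis
      unfolding d_def by (intro pow_bigo_add pow_bigo_cmult)
  qed
  have r: "r \<in> pow_bigo (-1)"
  proof -
    have "(\<lambda>n. (-1) * ((hit_fps p - geom ^ Suc p) $ n / real (n choose p))) \<in> pow_bigo (0 - 1)"
      using of_order_over_binomial[of "hit_fps p - geom ^ Suc p" p 0] hit_fps_error[of p]
      by (intro pow_bigo_cmult) simp
    then have mem: "(\<lambda>n. (-1) * ((hit_fps p - geom ^ Suc p) $ n / real (n choose p))) \<in> pow_bigo (-1)" by simp
    have ev: "\<forall>\<^sub>F n in sequentially. (-1) * ((hit_fps p - geom ^ Suc p) $ n / real (n choose p)) = r n"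
    proof (rule eventually_at_top_linorderI[of p])
      fix n assume "p \<le> n"
      then have "real (n choose p) \<noteq> 0" by simp
      moreover have "(geom ^ Suc p) $ n = real ((n + p) choose p)"
        using geom_log_quad_nth[of p 0 0 1 n] by (simp add: log_quad_def)
      ultimately show "(-1) * ((hit_fps p - geom ^ Suc p) $ n / real (n choose p)) = r n"
        by (simp add: r_def hit_fps_def diff_divide_distrib)
    qed
    show ?thesis by (rule landau_o.big.in_cong[OF ev, THEN iffD1, OF mem])
  qed
  have "(\<lambda>n. r n * (Q n + d n) + d n) \<in> pow_bigo (\<epsilon> - 1)"
  proof (intro pow_bigo_add d)
    have "(\<lambda>n. Q n + d n) \<in> pow_bigo \<epsilon>" using pow_bigo_mono[OF d] by (intro pow_bigo_add Q) simp
    from pow_bigo_mult[OF r this] show "(\<lambda>n. r n * (Q n + d n)) \<in> pow_bigo (\<epsilon> - 1)" by simp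
  qed
  moreover have "(geom ^ Suc p * log_quad a b c) $ n / real (n choose p) - Q n = r n * (Q n + d n) + d n" for n
  proof -
    have "a * ((h n)\<^sup>2 - s n) + b * h n + c = Q n + d n"
      by (simp add: Q_def d_def e_def t_def power2_eq_square algebra_simps)
    then show ?thesis
      unfolding geom_log_quad_nth h_def[symmetric, THEN fun_cong] s_def[symmetric, THEN fun_cong]
      by (simp add: r_def h_def s_def algebra_simps)
  qed
  ultimately show ?thesis by (simp add: Q_def)
qed

section \<open>Mean and variance\<close>

text \<open>
  The factorial moments are derivatives of \<open>span_poly = hit_poly - anc_poly\<close> at 1.
\<close>

lemma span_moments:
  assumes "p \<ge> 1" "p \<le> n"
  shows "measure_pmf.expectation (Y_pmf n p) real = (hit_fps1 p - anc_fps1 p) $ n / real (n choose p)"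
    and "measure_pmf.variance (Y_pmf n p) real =
       (hit_fps2 p - anc_fps2 p) $ n / real (n choose p) + measure_pmf.expectation (Y_pmf n p) real
         - (measure_pmf.expectation (Y_pmf n p) real)\<^sup>2"
proof -
  let ?E = "measure_pmf.expectation (Y_pmf n p)"
  show "?E real = (hit_fps1 p - anc_fps1 p) $ n / real (n choose p)"
    unfolding expectation_Y_pmf[OF assms] poly_exp_mean
    by (simp add: hit_fps1_def anc_fps1_def anc_poly_def pderiv_diff)
  have int: "integrable (measure_pmf (Y_pmf n p)) f" for f :: "nat \<Rightarrow> real"
    by (rule integrable_measure_pmf_finite[OF finite_set_Y_pmf[OF assms(2)]])
  have "?E (\<lambda>y. real y * (real y - 1)) = (hit_fps2 p - anc_fps2 p) $ n / real (n choose p)"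
    unfolding expectation_Y_pmf[OF assms] poly_exp_factorial_2
    by (simp add: hit_fps2_def anc_fps2_def anc_poly_def pderiv_diff)
  moreover have "?E (\<lambda>y. (real y)\<^sup>2) = ?E (\<lambda>y. real y * (real y - 1)) + ?E real"
    using int by (simp flip: Bochner_Integration.integral_add) (simp add: algebra_simps power2_eq_square)
  moreover have "measure_pmf.variance (Y_pmf n p) real = ?E (\<lambda>y. (real y)\<^sup>2) - (?E real)\<^sup>2"
    by (rule measure_pmf.variance_eq) (rule int)+
  ultimately show "measure_pmf.variance (Y_pmf n p) real =
       (hit_fps2 p - anc_fps2 p) $ n / real (n choose p) + ?E real - (?E real)\<^sup>2" by simp
qed

text \<open>
  Agrees with \<open>harm (n + p) - harm p\<close> up to \<open>O(1 / n)\<close>.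
\<close>

definition shifted_ln :: "nat \<Rightarrow> nat \<Rightarrow> real" where
  "shifted_ln p n = ln (real n) + (euler_mascheroni - harm p)"

definition mean_const :: "nat \<Rightarrow> real" where
  "mean_const p = 1 - 2 * real p - 2 / (real p - 1)"

text \<open>
  Division by \<open>n choose p\<close> turns sums over subsets into expectations.
\<close>

lemma factorial_moment_ratio:
  assumes "\<epsilon> > 0" "F - geom ^ Suc p * log_quad a b c \<in> of_order (real p + \<epsilon>)"
  shows "(\<lambda>n. F $ n / real (n choose p) -
     (a * ((shifted_ln p n)\<^sup>2 - (pi\<^sup>2 / 6 - harm2 p)) + b * shifted_ln p n + c)) \<in> pow_bigo (\<epsilon> - 1)"
proof -
  let ?M = "geom ^ Suc p * log_quad a b c"
  define Q where "Q = (\<lambda>n. a * ((shifted_ln p n)\<^sup>2 - (pi\<^sup>2 / 6 - harm2 p)) + b * shifted_ln p n + c)"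
  have "(\<lambda>n. (?M $ n / real (n choose p) - Q n) + (F - ?M) $ n / real (n choose p)) \<in> pow_bigo (\<epsilon> - 1)"
    using geom_log_quad_ratio[OF assms(1), of p a b c] of_order_over_binomial[OF assms(2)] assms(1)
    unfolding shifted_ln_def Q_def by (intro pow_bigo_add) auto
  then have "(\<lambda>n. F $ n / real (n choose p) - Q n) \<in> pow_bigo (\<epsilon> - 1)"
    by (simp add: diff_divide_distrib)
  then show ?thesis unfolding Q_def .
qed

lemma mean_asymp:
  assumes p: "p \<ge> 2" and e: "\<epsilon> > 0"
  shows "(\<lambda>n. measure_pmf.expectation (Y_pmf n p) real - (2 * real p * shifted_ln p n + mean_const p)) \<in> pow_bigo (\<epsilon> - 1)"
proof -
  have "(hit_fps1 p - hit_main1 p) - (anc_fps1 p - geom ^ Suc p * log_quad 0 0 (2 / (real p - 1))) \<in> of_order (real p + \<epsilon>)"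
    using e p by (intro of_order_diff hit_fps1_asymp anc_fps1_asymp) auto
  moreover have "hit_main1 p = geom ^ Suc p * log_quad 0 (2 * real p) (mean_const p) + geom ^ Suc p * log_quad 0 0 (2 / (real p - 1))"
    unfolding hit_main1_def distrib_left[symmetric] log_quad_add by (simp add: mean_const_def)
  ultimately have "(hit_fps1 p - anc_fps1 p) - geom ^ Suc p * log_quad 0 (2 * real p) (mean_const p) \<in> of_order (real p + \<epsilon>)"
    by (simp add: algebra_simps)
  from factorial_moment_ratio[OF e this]
  have mem: "(\<lambda>n. (hit_fps1 p - anc_fps1 p) $ n / real (n choose p) - (2 * real p * shifted_ln p n + mean_const p)) \<in> pow_bigo (\<epsilon> - 1)"
    by simp
  have ev: "\<forall>\<^sub>F n in sequentially. (hit_fps1 p - anc_fps1 p) $ n / real (n choose p) - (2 * real p * shifted_ln p n + mean_const p) =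
      measure_pmf.expectation (Y_pmf n p) real - (2 * real p * shifted_ln p n + mean_const p)"
    by (rule eventually_at_top_linorderI[of p]) (use p span_moments(1)[of p] in auto)
  show ?thesis by (rule landau_o.big.in_cong[OF ev, THEN iffD1, OF mem])
qed

lemma factorial_moment_2_asymp:
  assumes p: "p \<ge> 2" and e: "\<epsilon> > 0"
  shows "(\<lambda>n. (hit_fps2 p - anc_fps2 p) $ n / real (n choose p) -
     (4 * real p ^ 2 * ((shifted_ln p n)\<^sup>2 - (pi\<^sup>2 / 6 - harm2 p)) +
      (4 * real p - 8 * real p ^ 2 - 8 * real p / (real p - 1)) * shifted_ln p n +
      (4 * real p ^ 2 + 2 * real p - 2 - (4 * (1 - 2 * real p) / (real p - 1) - 8 * real p / (real p - 1) ^ 2))))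
     \<in> pow_bigo (\<epsilon> - 1)"
proof (rule factorial_moment_ratio[OF e])
  let ?b = "8 * real p / (real p - 1)" and ?c = "4 * (1 - 2 * real p) / (real p - 1) - 8 * real p / (real p - 1) ^ 2"
  let ?M = "geom ^ Suc p * log_quad (4 * real p ^ 2) (4 * real p - 8 * real p ^ 2 - ?b) (4 * real p ^ 2 + 2 * real p - 2 - ?c)"
  have "(hit_fps2 p - hit_main2 p) - (anc_fps2 p - geom ^ Suc p * log_quad 0 ?b ?c) \<in> of_order (real p + \<epsilon>)"
    using e p by (intro of_order_diff[OF hit_fps2_asymp anc_fps2_asymp]) auto
  moreover have "hit_main2 p = ?M + geom ^ Suc p * log_quad 0 ?b ?c"
    unfolding hit_main2_def distrib_left[symmetric] log_quad_add by simp
  moreover have "(F - (M + N)) - (A - N) = (F - A) - M" for F M N A :: "real fps" by simp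
  ultimately show "hit_fps2 p - anc_fps2 p - ?M \<in> of_order (real p + \<epsilon>)" by (simp only:)
qed

text \<open>
  The squared logarithms of the second factorial moment and of the squared mean cancel.  The error
  of the mean is multiplied by the mean, which is why it is needed with a smaller exponent.
\<close>

lemma variance_asymp:
  assumes p: "p \<ge> 2" and e: "\<epsilon> > 0"
  shows "(\<lambda>n. measure_pmf.variance (Y_pmf n p) real -
      (2 * real p * shifted_ln p n - 2 / 3 * pi ^ 2 * real p ^ 2 + 4 * real p ^ 2 * harm2 p
       + 2 * (2 * real p ^ 3 - 5 * real p ^ 2 + 7 * real p - 2) / (real p - 1) ^ 2)) \<in> pow_bigo (\<epsilon> - 1)"
proof -
  \<comment> \<open>The exponent \<open>\<delta>\<close> bounds one logarithm; two of them fit into \<open>\<epsilon>\<close>, and \<open>\<delta> \<le> 1\<close> keeps squares of errors small.\<close>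
  define \<delta> where "\<delta> = min (\<epsilon> / 2) 1"
  have \<delta>: "\<delta> > 0" "2 * \<delta> \<le> \<epsilon>" "\<delta> \<le> 1" using e by (auto simp: \<delta>_def)
  define E where "E = (\<lambda>n. measure_pmf.expectation (Y_pmf n p) real)"
  define m where "m = (\<lambda>n. 2 * real p * shifted_ln p n + mean_const p)"
  define d where "d = (\<lambda>n. E n - m n)"
  define F where "F = (\<lambda>n. (hit_fps2 p - anc_fps2 p) $ n / real (n choose p))"
  define f where "f = (\<lambda>n. 4 * real p ^ 2 * ((shifted_ln p n)\<^sup>2 - (pi\<^sup>2 / 6 - harm2 p)) +
      (4 * real p - 8 * real p ^ 2 - 8 * real p / (real p - 1)) * shifted_ln p n +
      (4 * real p ^ 2 + 2 * real p - 2 - (4 * (1 - 2 * real p) / (real p - 1) - 8 * real p / (real p - 1) ^ 2)))"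
  define g where "g = (\<lambda>n. F n - f n)"
  have d: "d \<in> pow_bigo (\<delta> - 1)" using mean_asymp[OF p \<delta>(1)] by (simp add: d_def E_def m_def)
  have g: "g \<in> pow_bigo (\<epsilon> - 1)" using factorial_moment_2_asymp[OF p e] by (simp add: g_def F_def f_def)
  have m: "m \<in> pow_bigo \<delta>"
  proof -
    have "shifted_ln p \<in> pow_bigo \<delta>" unfolding shifted_ln_def by (rule ln_bigo[OF \<delta>(1)])
    then show ?thesis
      unfolding m_def using \<delta> by (intro pow_bigo_add pow_bigo_cmult pow_bigo_const) auto
  qed
  have err: "(\<lambda>n. g n + d n + (-2) * (m n * d n) + (-1) * (d n * d n)) \<in> pow_bigo (\<epsilon> - 1)"
  proof (intro pow_bigo_add pow_bigo_cmult g)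
    show "d \<in> pow_bigo (\<epsilon> - 1)" using pow_bigo_mono[OF d] \<delta> by simp
    show "(\<lambda>n. m n * d n) \<in> pow_bigo (\<epsilon> - 1)" using pow_bigo_mono[OF pow_bigo_mult[OF m d]] \<delta> by simp
    show "(\<lambda>n. d n * d n) \<in> pow_bigo (\<epsilon> - 1)" using pow_bigo_mono[OF pow_bigo_mult[OF d d]] \<delta> by simp
  qed
  have main: "f n + m n - (m n)\<^sup>2 = 2 * real p * shifted_ln p n - 2 / 3 * pi ^ 2 * real p ^ 2 + 4 * real p ^ 2 * harm2 p
       + 2 * (2 * real p ^ 3 - 5 * real p ^ 2 + 7 * real p - 2) / (real p - 1) ^ 2" for n
  proof -
    define x where "x = real p - 1"
    have x: "x > 0" "real p = x + 1" using p by (auto simp: x_def)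
    show ?thesis
      using x(1) unfolding f_def m_def mean_const_def x(2)
      by (simp add: field_simps power2_eq_square power3_eq_cube)
  qed
  have ev: "\<forall>\<^sub>F n in sequentially. g n + d n + (-2) * (m n * d n) + (-1) * (d n * d n) =
      measure_pmf.variance (Y_pmf n p) real -
      (2 * real p * shifted_ln p n - 2 / 3 * pi ^ 2 * real p ^ 2 + 4 * real p ^ 2 * harm2 p
       + 2 * (2 * real p ^ 3 - 5 * real p ^ 2 + 7 * real p - 2) / (real p - 1) ^ 2)"
  proof (rule eventually_at_top_linorderI[of p])
    fix n assume "p \<le> n"
    then have "measure_pmf.variance (Y_pmf n p) real = F n + E n - (E n)\<^sup>2"
      using span_moments(2)[of p n] p by (simp add: F_def E_def)
    then show "g n + d n + (-2) * (m n * d n) + (-1) * (d n * d n) =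
      measure_pmf.variance (Y_pmf n p) real -
      (2 * real p * shifted_ln p n - 2 / 3 * pi ^ 2 * real p ^ 2 + 4 * real p ^ 2 * harm2 p
       + 2 * (2 * real p ^ 3 - 5 * real p ^ 2 + 7 * real p - 2) / (real p - 1) ^ 2)"
      unfolding main[symmetric] by (simp add: g_def d_def power2_eq_square algebra_simps)
  qed
  show ?thesis by (rule landau_o.big.in_cong[OF ev, THEN iffD1, OF err])
qed

theorem theorem5:
  fixes p :: nat
  assumes "p \<ge> 2"
  shows
    "(\<exists>C. \<forall>\<^sub>F n in sequentially. \<forall>x::real.
        \<bar>measure_pmf.prob (Y_pmf n p)
            {y. (real y - 2 * real p * ln (real n)) / sqrt (2 * real p * ln (real n)) < x}
          - cdf std_normal_distribution x\<bar> \<le> C * (1 / sqrt (ln (real n))))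
     \<and> (\<forall>\<epsilon>::real. \<epsilon> > 0 \<longrightarrow>
        (\<lambda>n. measure_pmf.expectation (Y_pmf n p) real -
             (2 * real p * ln (real n) - 2 * real p * harm p + 2 * real p * euler_mascheroni
              + 3 - 2 * real p - 2 * real p / (real p - 1)))
          \<in> O(\<lambda>n. 1 / real n powr (1 - \<epsilon>)))
     \<and> (\<forall>\<epsilon>::real. \<epsilon> > 0 \<longrightarrow>
        (\<lambda>n. measure_pmf.variance (Y_pmf n p) real -
             (2 * real p * ln (real n) - 2 * real p * harm p + 2 * real p * euler_mascheroni
              - 2 / 3 * pi ^ 2 * real p ^ 2 + 4 * real p ^ 2 * harm2 p
              + 2 * (2 * real p ^ 3 - 5 * real p ^ 2 + 7 * real p - 2) / (real p - 1) ^ 2))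
          \<in> O(\<lambda>n. 1 / real n powr (1 - \<epsilon>)))"
proof (intro conjI allI impI)
  show "\<exists>C. \<forall>\<^sub>F n in sequentially. \<forall>x::real.
        \<bar>measure_pmf.prob (Y_pmf n p)
            {y. (real y - 2 * real p * ln (real n)) / sqrt (2 * real p * ln (real n)) < x}
          - cdf std_normal_distribution x\<bar> \<le> C * (1 / sqrt (ln (real n)))"
    by (rule Y_pmf_berry_esseen[OF assms])
next
  fix \<epsilon> :: real assume \<epsilon>: "\<epsilon> > 0"
  have rate: "1 / real n powr (1 - \<epsilon>) = real n powr (\<epsilon> - 1)" for n
    using powr_minus_divide[of "real n" "1 - \<epsilon>"] by simp
  have frac: "2 * real p / (real p - 1) = 2 + 2 / (real p - 1)"
    using assms by (simp add: field_simps)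
  have "2 * real p * shifted_ln p n + mean_const p = 2 * real p * ln (real n) - 2 * real p * harm p
      + 2 * real p * euler_mascheroni + 3 - 2 * real p - 2 * real p / (real p - 1)" for n
    unfolding shifted_ln_def mean_const_def frac by (simp add: algebra_simps)
  then show "(\<lambda>n. measure_pmf.expectation (Y_pmf n p) real -
             (2 * real p * ln (real n) - 2 * real p * harm p + 2 * real p * euler_mascheroni
              + 3 - 2 * real p - 2 * real p / (real p - 1)))
          \<in> O(\<lambda>n. 1 / real n powr (1 - \<epsilon>))"
    using mean_asymp[OF assms \<epsilon>] by (simp add: rate)
  have "2 * real p * shifted_ln p n - 2 / 3 * pi ^ 2 * real p ^ 2 = 2 * real p * ln (real n) - 2 * real p * harm p
      + 2 * real p * euler_mascheroni - 2 / 3 * pi ^ 2 * real p ^ 2" for n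
    unfolding shifted_ln_def by (simp add: algebra_simps)
  then show "(\<lambda>n. measure_pmf.variance (Y_pmf n p) real -
             (2 * real p * ln (real n) - 2 * real p * harm p + 2 * real p * euler_mascheroni
              - 2 / 3 * pi ^ 2 * real p ^ 2 + 4 * real p ^ 2 * harm2 p
              + 2 * (2 * real p ^ 3 - 5 * real p ^ 2 + 7 * real p - 2) / (real p - 1) ^ 2))
          \<in> O(\<lambda>n. 1 / real n powr (1 - \<epsilon>))"
    using variance_asymp[OF assms \<epsilon>] by (simp only: rate)
qed

end
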